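(* Let $H\in\mathcal C^2(\mathbb R)$ go to infinity at infinity (i.e. $H(x)\to+\infty$ as $|x|\to\infty$). For all $\varepsilon>0$, define $U_\varepsilon:\mathbb Z\to\mathbb R$ by $U_\varepsilon(k)=H(\varepsilon k)$ for all $k\in\mathbb Z$, and let $(X^\varepsilon_k,V^\varepsilon_k)_{k\in\mathbb N}$ be the Zig-Zag walk (persistent walk) on $\mathbb Z$ associated to $U_\varepsilon$, with some initial condition $(x_0^\varepsilon,v_0)\in\mathbb Z\times\{-1,1\}$. Suppose that $\varepsilon x_0^\varepsilon$ converges to some $x_0^*\in\mathbb R$ as $\varepsilon\to0$. Then $$\left(\varepsilon X^\varepsilon_{\lfloor t/\varepsilon\rfloor},V^\varepsilon_{\lfloor t/\varepsilon\rfloor}\right)_{t\geqslant0}\ \underset{\varepsilon\to0}{\longrightarrow}\ (Y_t,W_t)_{t\geqslant0}$$ in law in the Skorohod topology, where $(Y_t,W_t)_{t\geqslant0}$ is a Zig-Zag process on $\mathbb R$ associated to $H$ with $(Y_0,W_0)=(x_0^*,v_0)$.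
   Context: For $r\in\mathbb R$, $(r)_+=\max(r,0)$. For $U:\mathbb Z\to\mathbb R$, the Zig-Zag (or persistent) walk on $\mathbb Z$ associated to $U$ is the Markov chain on $\mathbb Z\times\{-1,1\}$ which from $(x,v)$ moves to $(x+v,v)$ with probability $\min(e^{U(x)-U(x+v)},1)=e^{-(U(x+v)-U(x))_+}$ and to $(x,-v)$ otherwise. The (continuous-time) Zig-Zag process on $\mathbb R$ associated to $H\in\mathcal C^1(\mathbb R)$ is the Markov process on $\mathbb R\times\{-1,1\}$ with generator $Lf(y,w)=w\,\partial_yf(y,w)+(wH'(y))_+\big(f(y,-w)-f(y,w)\big)$. In other words it is the piecewise deterministic Markov process which, from $(y,w)$, follows $(Y_t,W_t)=(y+tw,w)$ up to a random time $T$ with $\mathbb P(T>t)=\exp\big(-\int_0^t(wH'(y+sw))_+ds\big)$, at which it is at $(Y_T,W_T)=(y+Tw,-w)$, after which it follows again the deterministic flow up to a new random jump time, and so on. Skorohod topology on càdlàg functions from $\mathbb R_+$ to $\mathbb R^2$: $x_n\to x$ if there exist increasing $\gamma_n:\mathbb R_+\to\mathbb R_+$ such that $\sup_{t\in[0,T]}(|x_n(\gamma_n(t))-x(t)|+|\gamma_n(t)-t|)\to0$ for all $T>0$. *)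

theory Defs
  imports "HOL-Probability.Probability"
begin

section \<open>Skorohod topology and convergence in law\<close>

definition cadlag_paths :: "(real \<Rightarrow> 'a::metric_space) set" where
  "cadlag_paths = {x \<in> extensional {0..}.
     (\<forall>t\<ge>0. (x \<longlongrightarrow> x t) (at_right t)) \<and> (\<forall>t>0. \<exists>l. (x \<longlongrightarrow> l) (at_left t))}"

text \<open>The time changes are increasing bijections of the half-line. Without surjectivity a time
  change could skip a short excursion of \<open>x n\<close>, and the notion would no longer be the (J1) Skorohod
  convergence.\<close>

definition time_change :: "(real \<Rightarrow> real) \<Rightarrow> bool" where
  "time_change \<gamma> \<longleftrightarrow> strict_mono_on {0..} \<gamma> \<and> bij_betw \<gamma> {0..} {0..}"

definition skorohod_conv :: "(nat \<Rightarrow> real \<Rightarrow> 'a::metric_space) \<Rightarrow> (real \<Rightarrow> 'a) \<Rightarrow> bool" where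
  "skorohod_conv x y \<longleftrightarrow> (\<exists>\<gamma>. (\<forall>n. time_change (\<gamma> n)) \<and>
     (\<forall>T>0. uniform_limit {0..T} (\<lambda>n t. dist (x n (\<gamma> n t)) (y t) + \<bar>\<gamma> n t - t\<bar>) (\<lambda>_. 0) sequentially))"

text \<open>The Skorohod topology is metrizable, hence its open sets are the sequentially open ones.\<close>

definition skorohod_open :: "(real \<Rightarrow> 'a::metric_space) set \<Rightarrow> bool" where
  "skorohod_open U \<longleftrightarrow> U \<subseteq> cadlag_paths \<and>
     (\<forall>x y. (\<forall>n. x n \<in> cadlag_paths) \<longrightarrow> y \<in> U \<longrightarrow> skorohod_conv x y \<longrightarrow> (\<forall>\<^sub>F n in sequentially. x n \<in> U))"

definition skorohod_topology :: "(real \<Rightarrow> 'a::metric_space) topology" where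
  "skorohod_topology = topology skorohod_open"

lemma istopology_skorohod_open: "istopology skorohod_open"
  unfolding istopology_def
proof (intro conjI allI impI)
  fix S T :: "(real \<Rightarrow> 'a) set"
  assume "skorohod_open S" "skorohod_open T"
  then show "skorohod_open (S \<inter> T)"
    unfolding skorohod_open_def by (auto intro: eventually_conj)
next
  fix K :: "(real \<Rightarrow> 'a) set set"
  assume K: "\<forall>S\<in>K. skorohod_open S"
  show "skorohod_open (\<Union>K)"
    unfolding skorohod_open_def
  proof (intro conjI allI impI)
    show "\<Union>K \<subseteq> cadlag_paths" using K unfolding skorohod_open_def by blast
  next
    fix x :: "nat \<Rightarrow> real \<Rightarrow> 'a" and y
    assume x: "\<forall>n. x n \<in> cadlag_paths" and y: "y \<in> \<Union>K" and c: "skorohod_conv x y"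
    from y obtain S where S: "S \<in> K" "y \<in> S" by blast
    with K x c have "\<forall>\<^sub>F n in sequentially. x n \<in> S"
      unfolding skorohod_open_def by blast
    then show "\<forall>\<^sub>F n in sequentially. x n \<in> \<Union>K"
      by eventually_elim (use S in blast)
  qed
qed

lemma openin_skorohod_topology: "openin skorohod_topology U \<longleftrightarrow> skorohod_open U"
  unfolding skorohod_topology_def
  by (simp add: topology_inverse'[OF istopology_skorohod_open])

lemma topspace_skorohod_topology: "topspace skorohod_topology = cadlag_paths"
proof -
  have "skorohod_open cadlag_paths" unfolding skorohod_open_def by auto
  then show ?thesis
    unfolding topspace_def openin_skorohod_topology skorohod_open_def by blast
qed

text \<open>Measurability of all bounded continuous functionals is part of the conclusion, so that the
  integrals are genuine expectations; in a metrizable space it amounts to Borel measurability of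
  the random elements.\<close>

definition converges_in_law ::
  "'c topology \<Rightarrow> ('i \<Rightarrow> 'a measure) \<Rightarrow> ('i \<Rightarrow> 'a \<Rightarrow> 'c) \<Rightarrow> 'b measure \<Rightarrow> ('b \<Rightarrow> 'c) \<Rightarrow> 'i filter \<Rightarrow> bool"
  where
  "converges_in_law S M X N Z F \<longleftrightarrow>
     (\<forall>\<^sub>F i in F. (\<forall>\<omega>\<in>space (M i). X i \<omega> \<in> topspace S) \<and>
        (\<forall>f. continuous_map S euclideanreal f \<longrightarrow> bounded (f ` topspace S) \<longrightarrow>
           (\<lambda>\<omega>. f (X i \<omega>)) \<in> borel_measurable (M i))) \<and>
     (\<forall>\<omega>\<in>space N. Z \<omega> \<in> topspace S) \<and>
     (\<forall>f. continuous_map S euclideanreal f \<longrightarrow> bounded (f ` topspace S) \<longrightarrow>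
        (\<lambda>\<omega>. f (Z \<omega>)) \<in> borel_measurable N \<and>
        ((\<lambda>i. \<integral>\<omega>. f (X i \<omega>) \<partial>M i) \<longlongrightarrow> (\<integral>\<omega>. f (Z \<omega>) \<partial>N)) F)"

section \<open>The Zig-Zag walk\<close>

definition zigzag_kernel :: "(int \<Rightarrow> real) \<Rightarrow> int \<times> int \<Rightarrow> (int \<times> int) pmf" where
  "zigzag_kernel U = (\<lambda>(x, v).
     map_pmf (\<lambda>b. if b then (x + v, v) else (x, - v))
       (bernoulli_pmf (min (exp (U x - U (x + v))) 1)))"

definition markov_chain :: "'a measure \<Rightarrow> ('s \<Rightarrow> 's pmf) \<Rightarrow> 's \<Rightarrow> (nat \<Rightarrow> 'a \<Rightarrow> 's) \<Rightarrow> bool" where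
  "markov_chain M K s Z \<longleftrightarrow> prob_space M \<and>
     (\<forall>n. Z n \<in> measurable M (count_space UNIV)) \<and>
     (AE \<omega> in M. Z 0 \<omega> = s) \<and>
     (\<forall>n z. measure M {\<omega> \<in> space M. \<forall>i\<le>Suc n. Z i \<omega> = z i} =
            measure M {\<omega> \<in> space M. \<forall>i\<le>n. Z i \<omega> = z i} * pmf (K (z n)) (z (Suc n)))"

text \<open>The kernel keeps the velocity in \<open>{-1, 1}\<close>, so the chain lives on the intended state space
  as soon as \<open>v0\<close> does.\<close>

definition zigzag_walk ::
  "'a measure \<Rightarrow> (int \<Rightarrow> real) \<Rightarrow> int \<Rightarrow> int \<Rightarrow> (nat \<Rightarrow> 'a \<Rightarrow> int) \<Rightarrow> (nat \<Rightarrow> 'a \<Rightarrow> int) \<Rightarrow> bool" where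
  "zigzag_walk M U x0 v0 X V \<longleftrightarrow>
     v0 \<in> {-1, 1} \<and> markov_chain M (zigzag_kernel U) (x0, v0) (\<lambda>n \<omega>. (X n \<omega>, V n \<omega>))"

section \<open>The Zig-Zag process\<close>

definition zigzag_survival :: "(real \<Rightarrow> real) \<Rightarrow> real \<Rightarrow> real \<Rightarrow> real \<Rightarrow> real" where
  "zigzag_survival H y w t = exp (- integral {0..t} (\<lambda>s. max (w * deriv H (y + s * w)) 0))"

text \<open>\<open>T n\<close> is the (possibly infinite) waiting time between the \<open>n\<close>-th and the \<open>(n+1)\<close>-st jump. As the
  initial state is deterministic, the information available at the \<open>n\<close>-th jump is the one carried
  by \<open>T 0, \<dots>, T (n - 1)\<close>.\<close>

definition jump_time :: "(nat \<Rightarrow> 'b \<Rightarrow> ennreal) \<Rightarrow> nat \<Rightarrow> 'b \<Rightarrow> ennreal" where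
  "jump_time T n \<omega> = (\<Sum>i<n. T i \<omega>)"

definition jump_history :: "'b measure \<Rightarrow> (nat \<Rightarrow> 'b \<Rightarrow> ennreal) \<Rightarrow> nat \<Rightarrow> 'b measure" where
  "jump_history N T n =
     vimage_algebra (space N) (\<lambda>\<omega>. \<lambda>i\<in>{..<n}. T i \<omega>) (PiM {..<n} (\<lambda>_. borel))"

text \<open>The two conditions on \<open>T\<close>, for each \<open>n\<close> such that the \<open>n\<close>-th jump time \<open>S\<close> is finite: given the
  past, \<open>T n\<close> has the Zig-Zag survival function started at the state at time \<open>S\<close>; and the path
  follows the flow from that state until the next jump, where only the velocity is reversed.
  Non-explosion is not imposed: it follows almost surely for continuously differentiable \<open>H\<close>,
  the speed being 1 and the jump rate locally bounded.\<close>

definition zigzag_process ::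
  "'b measure \<Rightarrow> (real \<Rightarrow> real) \<Rightarrow> real \<Rightarrow> real \<Rightarrow> (real \<Rightarrow> 'b \<Rightarrow> real) \<Rightarrow> (real \<Rightarrow> 'b \<Rightarrow> real) \<Rightarrow> bool" where
  "zigzag_process N H y0 w0 Y W \<longleftrightarrow>
     w0 \<in> {-1, 1} \<and> prob_space N \<and>
     (\<forall>t\<ge>0. Y t \<in> borel_measurable N \<and> W t \<in> borel_measurable N) \<and>
     (\<forall>\<omega>\<in>space N. (\<lambda>t\<in>{0..}. (Y t \<omega>, W t \<omega>)) \<in> cadlag_paths) \<and>
     (AE \<omega> in N. Y 0 \<omega> = y0 \<and> W 0 \<omega> = w0) \<and>
     (\<exists>T :: nat \<Rightarrow> 'b \<Rightarrow> ennreal. (\<forall>n. T n \<in> borel_measurable N) \<and>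
       (\<forall>n. \<forall>t\<ge>0. AE \<omega> in N. jump_time T n \<omega> < \<infinity> \<longrightarrow>
          real_cond_exp N (jump_history N T n) (indicat_real {\<omega>' \<in> space N. ennreal t < T n \<omega>'}) \<omega> =
          (let S = enn2real (jump_time T n \<omega>) in zigzag_survival H (Y S \<omega>) (W S \<omega>) t)) \<and>
       (AE \<omega> in N. \<forall>n. jump_time T n \<omega> < \<infinity> \<longrightarrow>
          (let S = enn2real (jump_time T n \<omega>) in
            (\<forall>t\<ge>0. ennreal t < T n \<omega> \<longrightarrow>
               Y (S + t) \<omega> = Y S \<omega> + t * W S \<omega> \<and> W (S + t) \<omega> = W S \<omega>) \<and>
            (\<forall>t\<ge>0. T n \<omega> = ennreal t \<longrightarrow>
               Y (S + t) \<omega> = Y S \<omega> + t * W S \<omega> \<and> W (S + t) \<omega> = - W S \<omega>))))"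

section \<open>Regularity\<close>

definition C2_real :: "(real \<Rightarrow> real) \<Rightarrow> bool" where
  "C2_real H \<longleftrightarrow> (\<exists>H' H''. (\<forall>x. (H has_real_derivative H' x) (at x)) \<and>
     (\<forall>x. (H' has_real_derivative H'' x) (at x)) \<and> continuous_on UNIV H'')"

end

theory Submission
  imports Defs
begin

text \<open>The walk is coupled to the process on the probability space of the process. Let \<open>\<Lambda>\<close> be the
  cumulative jump rate along the flow started at the \<open>n\<close>-th jump. Since \<open>H\<close> tends to infinity, so does
  \<open>\<Lambda>\<close>, the waiting times are finite, and the clocks \<open>E n = \<Lambda> (T n)\<close> are independent standard
  exponentials. A Zig-Zag walk is obtained from them by letting it move ahead as long as the total
  increase of \<open>U\<close> since the last flip stays below \<open>E n\<close>, and flip otherwise; the lack of memory of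
  the exponential law yields the transition probabilities. As \<open>\<epsilon>\<close> tends to 0, the total increase
  along a run of the rescaled walk converges to \<open>\<Lambda>\<close>, so the flip times converge to the jump times
  unless \<open>\<Lambda>\<close> is flat at level \<open>E n\<close>, which has probability 0. Matching the flip times with the jump
  times by a piecewise linear time change gives almost sure Skorohod convergence of the coupled
  paths, and dominated convergence concludes.\<close>

section \<open>Skorohod convergence\<close>

text \<open>The walks for different \<epsilon> live on unrelated probability spaces, and convergence
  in law sees only their laws. Each may thus be replaced by any walk with the same kernel and start;
  the coupled ones all read the same clocks, which turns the claim into a pathwise, deterministic
  limit. The clocks are computed from the waiting times themselves, so the space \<open>N\<close>
  carries them without being enlarged. The main obstacle is that the conditional survival
  probability of \<open>T n\<close> is given only at a fixed time, outside a null set depending on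
  that time, whereas \<open>E n > c\<close> reads \<open>T n > \<rho>\<close> with a threshold
  \<rho> that depends on the history through the position at the last jump. The survival formula is
  extended to such thresholds by rounding \<rho> upwards to a grid. The other obstacle is
  measurability: the topology is given through convergent sequences, so functionals are handled by
  sequential continuity and by discretized paths, which depend on countably many
  coordinates.\<close>

lemma time_change_less: "time_change \<gamma> \<Longrightarrow> 0 \<le> s \<Longrightarrow> s < t \<Longrightarrow> \<gamma> s < \<gamma> t"
  unfolding time_change_def strict_mono_on_def by auto

lemma time_change_0: "time_change \<gamma> \<Longrightarrow> \<gamma> 0 = 0"
proof -
  assume a: "time_change \<gamma>"
  then obtain s where s: "s \<ge> 0" "\<gamma> s = 0"
    unfolding time_change_def bij_betw_def by (metis atLeast_iff imageE order_refl)
  have "\<gamma> 0 \<ge> 0" using a unfolding time_change_def bij_betw_def by (metis atLeast_iff imageI order_refl)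
  moreover have "s > 0 \<Longrightarrow> \<gamma> 0 < \<gamma> s" using time_change_less[OF a, of 0 s] by auto
  ultimately show ?thesis using s by (cases "s = 0") (auto simp: le_less)
qed

lemma time_change_nonneg: "time_change \<gamma> \<Longrightarrow> 0 \<le> s \<Longrightarrow> 0 \<le> \<gamma> s"
  unfolding time_change_def bij_betw_def by (metis atLeast_iff imageI)

lemma time_change_surj: "time_change \<gamma> \<Longrightarrow> 0 \<le> r \<Longrightarrow> \<exists>s\<ge>0. \<gamma> s = r"
  unfolding time_change_def bij_betw_def by (metis atLeast_iff imageE)

lemma time_changeI:
  assumes "\<And>s t. 0 \<le> s \<Longrightarrow> s < t \<Longrightarrow> \<gamma> s < \<gamma> t" "\<And>s. 0 \<le> s \<Longrightarrow> 0 \<le> \<gamma> s"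
    "\<And>r. 0 \<le> r \<Longrightarrow> \<exists>s\<ge>0. \<gamma> s = r"
  shows "time_change \<gamma>"
proof -
  have s: "strict_mono_on {0..} \<gamma>" using assms(1) unfolding strict_mono_on_def by auto
  have "\<gamma> ` {0..} = {0..}" using assms(2,3) by (force simp: image_iff)
  then show ?thesis using s strict_mono_on_imp_inj_on[OF s] unfolding time_change_def bij_betw_def by auto
qed

lemma time_change_linear: "c > 0 \<Longrightarrow> time_change (\<lambda>t. c * t)"
proof (rule time_changeI)
  fix r :: real assume "0 < c" "0 \<le> r"
  then show "\<exists>s\<ge>0. c * s = r" by (intro exI[of _ "r / c"]) auto
qed auto

lemma time_change_glue:
  assumes g: "time_change \<gamma>" and h: "time_change \<eta>" and a: "a \<ge> 0"
  shows "time_change (\<lambda>t. if t \<le> a then \<gamma> t else \<gamma> a + \<eta> (t - a))" (is "time_change ?g")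
proof (rule time_changeI)
  fix s t :: real assume st: "0 \<le> s" "s < t"
  have e: "t > a \<Longrightarrow> \<eta> (t - a) > 0" using time_change_less[OF h, of 0 "t-a"] time_change_0[OF h] by auto
  have m: "s \<le> a \<Longrightarrow> \<gamma> s \<le> \<gamma> a" using time_change_less[OF g, of s a] st by (cases "s = a") auto
  show "?g s < ?g t"
    using e m time_change_less[OF g, of s t] time_change_less[OF h, of "s-a" "t-a"] st by auto
next
  fix s :: real assume s: "0 \<le> s"
  show "0 \<le> ?g s" using time_change_nonneg[OF g] time_change_nonneg[OF h, of "s - a"] s a by auto
next
  fix r :: real assume r: "0 \<le> r"
  show "\<exists>s\<ge>0. ?g s = r"
  proof (cases "r \<le> \<gamma> a")
    case True
    obtain s where s: "s \<ge> 0" "\<gamma> s = r" using time_change_surj[OF g r] by auto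
    then have "s \<le> a" using time_change_less[OF g a, of s] True by (cases "s \<le> a") auto
    then show ?thesis using s by auto
  next
    case False
    obtain s where s: "s \<ge> 0" "\<eta> s = r - \<gamma> a" using time_change_surj[OF h, of "r - \<gamma> a"] False by auto
    moreover have "s \<noteq> 0" using s time_change_0[OF h] False by auto
    ultimately show ?thesis using a by (intro exI[of _ "s + a"]) auto
  qed
qed

text \<open>Between two nodes the deviation \<open>\<gamma> t - t\<close> is affine, and after the
  last node it is constant, so a bound at the nodes is a bound everywhere. The induction on the
  number of nodes glues one affine piece at a time.\<close>

lemma time_change_interpolation:
  fixes s r :: "nat \<Rightarrow> real"
  assumes "s 0 = 0" "r 0 = 0"
    and "\<And>i. i < n \<Longrightarrow> s i < s (Suc i)" "\<And>i. i < n \<Longrightarrow> r i < r (Suc i)"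
    and "\<And>i. i \<le> n \<Longrightarrow> \<bar>r i - s i\<bar> \<le> \<delta>"
  shows "\<exists>\<gamma>. time_change \<gamma> \<and> (\<forall>i\<le>n. \<gamma> (s i) = r i) \<and> (\<forall>t\<ge>0. \<bar>\<gamma> t - t\<bar> \<le> \<delta>)"
  using assms(3-5)
proof (induction n)
  case 0
  show ?case
  proof (intro exI[of _ "\<lambda>t. t"] conjI)
    show "time_change (\<lambda>t. t)" using time_change_linear[of 1] by simp
  qed (use 0 assms(1,2) in auto)
next
  case (Suc n)
  then obtain \<gamma> where g: "time_change \<gamma>" "\<And>i. i \<le> n \<Longrightarrow> \<gamma> (s i) = r i" "\<And>t. t \<ge> 0 \<Longrightarrow> \<bar>\<gamma> t - t\<bar> \<le> \<delta>"
    by (metis le_SucI less_SucI)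
  have sm: "i \<le> n \<Longrightarrow> s i \<le> s n" for i
  proof (induction "n - i" arbitrary: i)
    case (Suc m)
    then have "s (Suc i) \<le> s n" "i < n" by auto
    then show ?case using Suc.prems(1) assms(3) \<open>\<And>i. i < Suc n \<Longrightarrow> s i < s (Suc i)\<close>[of i] by auto
  qed auto
  have s0: "0 \<le> s n" using sm[of 0] assms(1) by auto
  define d where "d = s (Suc n) - s n"
  define e where "e = r (Suc n) - r n"
  have d: "d > 0" and e: "e > 0" using Suc.prems(1,2)[of n] by (auto simp: d_def e_def)
  \<comment> \<open>Slope \<open>e/d\<close> joins the two nodes; the tail of slope 1 makes the map
    a bijection of the half-line and freezes the deviation. The next induction step overwrites this
    tail.\<close>
  define \<eta> where "\<eta> = (\<lambda>t. if t \<le> d then (e/d) * t else (e/d) * d + 1 * (t - d))"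
  have h: "time_change \<eta>" unfolding \<eta>_def
    using time_change_glue[OF time_change_linear[of "e/d"] time_change_linear[of 1], of d] d e by auto
  define g' where "g' = (\<lambda>t. if t \<le> s n then \<gamma> t else \<gamma> (s n) + \<eta> (t - s n))"
  have "time_change g'" unfolding g'_def by (rule time_change_glue[OF g(1) h s0])
  moreover have "g' (s i) = r i" if "i \<le> Suc n" for i
  proof (cases "i = Suc n")
    case True
    then show ?thesis using d e g(2)[of n] by (auto simp: g'_def \<eta>_def d_def[symmetric]) (auto simp: d_def e_def)
  next
    case False
    then show ?thesis using that sm[of i] g(2)[of i] by (auto simp: g'_def)
  qed
  moreover have "\<bar>g' t - t\<bar> \<le> \<delta>" if "t \<ge> 0" for t
  proof -
    consider "t \<le> s n" | "s n < t" "t - s n \<le> d" | "d < t - s n" by linarith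
    then show ?thesis
    proof cases
      case 1 then show ?thesis using g(3)[OF that] by (auto simp: g'_def)
    next
      case 2
      define l where "l = (t - s n) / d"
      have l: "0 \<le> l" "l \<le> 1" using 2 d by (auto simp: l_def)
      have "g' t - t = r n + e * l - (s n + d * l)" using 2 d g(2)[of n] by (auto simp: g'_def \<eta>_def l_def field_simps)
      \<comment> \<open>The deviation inside the new piece is a convex combination of those at its
        two end nodes.\<close>
      also have "\<dots> = (1 - l) * (r n - s n) + l * (r (Suc n) - s (Suc n))"
        by (simp add: d_def e_def algebra_simps)
      finally have "\<bar>g' t - t\<bar> \<le> (1 - l) * \<bar>r n - s n\<bar> + l * \<bar>r (Suc n) - s (Suc n)\<bar>"
        using l by (metis abs_mult abs_of_nonneg abs_triangle_ineq diff_ge_0_iff_ge)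
      also have "\<dots> \<le> (1 - l) * \<delta> + l * \<delta>" using l Suc.prems(3)[of n] Suc.prems(3)[of "Suc n"]
        by (intro add_mono mult_left_mono) auto
      finally show ?thesis by (simp add: algebra_simps)
    next
      case 3
      then have "g' t - t = r (Suc n) - s (Suc n)" using d g(2)[of n] by (auto simp: g'_def \<eta>_def d_def e_def)
      then show ?thesis using Suc.prems(3)[of "Suc n"] by auto
    qed
  qed
  ultimately show ?case by blast
qed

text \<open>The definition demands one sequence of time changes that serves all horizons, while in
  practice a time change is found for a given horizon and precision. A diagonal choice bridges the
  gap: the n-th time change is one that achieves the best level available among the levels up to
  n.\<close>

lemma skorohod_convI:
  fixes x :: "nat \<Rightarrow> real \<Rightarrow> 'a::metric_space"
  assumes "\<And>T e. T > 0 \<Longrightarrow> e > 0 \<Longrightarrow> \<forall>\<^sub>F n in sequentially. \<exists>\<gamma>. time_change \<gamma> \<and>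
     (\<forall>t\<in>{0..T}. dist (x n (\<gamma> t)) (y t) \<le> e \<and> \<bar>\<gamma> t - t\<bar> \<le> e)"
  shows "skorohod_conv x y"
proof -
  \<comment> \<open>A single level m encodes both the horizon m and the precision 1/m, so a higher
    level implies every lower positive one.\<close>
  define P where "P n m \<gamma> \<longleftrightarrow> time_change \<gamma> \<and>
     (\<forall>t\<in>{0..real m}. dist (x n (\<gamma> t)) (y t) \<le> 1 / real m \<and> \<bar>\<gamma> t - t\<bar> \<le> 1 / real m)" for n m \<gamma>
  have "\<exists>\<gamma>. time_change \<gamma> \<and> (\<forall>m. m \<le> n \<longrightarrow> (\<forall>m'. m < m' \<and> m' \<le> n \<longrightarrow> \<not> (\<exists>\<gamma>. P n m' \<gamma>)) \<longrightarrow> (\<exists>\<gamma>. P n m \<gamma>) \<longrightarrow> P n m \<gamma>)" for n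
  proof (cases "\<exists>m\<le>n. \<exists>\<gamma>. P n m \<gamma>")
    case True
    define m where "m = (GREATEST m. m \<le> n \<and> (\<exists>\<gamma>. P n m \<gamma>))"
    have m: "m \<le> n \<and> (\<exists>\<gamma>. P n m \<gamma>)" unfolding m_def
      by (rule GreatestI_ex_nat[where b = n]) (use True in auto)
    have mx: "m' \<le> m" if "m' \<le> n" "\<exists>\<gamma>. P n m' \<gamma>" for m' unfolding m_def
      by (rule Greatest_le_nat[where b = n]) (use that in auto)
    obtain \<gamma> where g: "P n m \<gamma>" using m by auto
    show ?thesis
    proof (intro exI[of _ \<gamma>] conjI allI impI)
      show "time_change \<gamma>" using g by (auto simp: P_def)
      fix k assume k: "k \<le> n" "\<forall>m'. k < m' \<and> m' \<le> n \<longrightarrow> \<not> (\<exists>\<gamma>. P n m' \<gamma>)" "\<exists>\<gamma>. P n k \<gamma>"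
      have "k = m" using k m mx[of k] by (metis le_neq_implies_less)
      then show "P n k \<gamma>" using g by simp
    qed
  next
    case False
    then show ?thesis using time_change_linear[of 1] by auto
  qed
  then obtain G where G: "\<And>n. time_change (G n)"
    "\<And>n m. m \<le> n \<Longrightarrow> (\<forall>m'. m < m' \<and> m' \<le> n \<longrightarrow> \<not> (\<exists>\<gamma>. P n m' \<gamma>)) \<Longrightarrow> (\<exists>\<gamma>. P n m \<gamma>) \<Longrightarrow> P n m (G n)"
    by metis
  \<comment> \<open>Whenever level m is achievable for \<open>x n\<close>, the chosen
    \<open>G n\<close> achieves some level at least m.\<close>
  have ex: "\<exists>m'\<ge>m. m' \<le> n \<and> P n m' (G n)" if "m \<le> n" "\<exists>\<gamma>. P n m \<gamma>" for n m
  proof -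
    define m' where "m' = (GREATEST m. m \<le> n \<and> (\<exists>\<gamma>. P n m \<gamma>))"
    have m': "m' \<le> n \<and> (\<exists>\<gamma>. P n m' \<gamma>)" unfolding m'_def
      by (rule GreatestI_ex_nat[where b = n]) (use that in auto)
    have mx: "k \<le> m'" if "k \<le> n" "\<exists>\<gamma>. P n k \<gamma>" for k unfolding m'_def
      by (rule Greatest_le_nat[where b = n]) (use that in auto)
    have "P n m' (G n)" using m' mx by (intro G(2)) (auto dest: leD)
    then show ?thesis using m' mx that by auto
  qed
  show ?thesis unfolding skorohod_conv_def
  proof (intro exI[of _ G] conjI allI impI)
    fix T :: real assume T: "T > 0"
    show "uniform_limit {0..T} (\<lambda>n t. dist (x n (G n t)) (y t) + \<bar>G n t - t\<bar>) (\<lambda>_. 0) sequentially"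
    proof (rule uniform_limitI)
      fix e :: real assume e: "e > 0"
      obtain m where m: "real m > max T (2 / e)" using reals_Archimedean2 by blast
      then have m: "real m > T" "real m > 2 / e" "m > 0" using T by auto
      have "\<forall>\<^sub>F n in sequentially. \<exists>\<gamma>. P n m \<gamma>"
        unfolding P_def using assms[of "real m" "1 / real m"] m by auto
      moreover have "\<forall>\<^sub>F n in sequentially. n \<ge> m" by (rule eventually_ge_at_top)
      ultimately show "\<forall>\<^sub>F n in sequentially. \<forall>t\<in>{0..T}. dist (dist (x n (G n t)) (y t) + \<bar>G n t - t\<bar>) 0 < e"
      proof eventually_elim
        case (elim n)
        then obtain m' where m': "m' \<ge> m" "P n m' (G n)" using ex by blast
        have "1 / real m' \<le> 1 / real m" using m' m by (intro divide_left_mono) auto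
        also have "1 / real m < e / 2" using m e by (auto simp: field_simps)
        finally have i: "1 / real m' < e / 2" .
        show ?case
        proof
          fix t assume "t \<in> {0..T}"
          then have "t \<in> {0..real m'}" using m m' by auto
          then have "dist (x n (G n t)) (y t) \<le> 1 / real m'" "\<bar>G n t - t\<bar> \<le> 1 / real m'"
            using m'(2) by (auto simp: P_def)
          then show "dist (dist (x n (G n t)) (y t) + \<bar>G n t - t\<bar>) 0 < e" using i by auto
        qed
      qed
    qed
  qed (rule G(1))
qed

text \<open>The open sets are the sequentially open ones by definition, so the preimage of a
  neighbourhood of the limit value eventually contains the sequence.\<close>

lemma skorohod_conv_continuous_map:
  assumes f: "continuous_map skorohod_topology euclideanreal f"
    and x: "\<And>n. x n \<in> cadlag_paths" "y \<in> cadlag_paths" "skorohod_conv x y"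
  shows "(\<lambda>n. f (x n)) \<longlonglongrightarrow> f y"
proof (rule topological_tendstoI)
  fix S :: "real set" assume S: "open S" "f y \<in> S"
  have "openin skorohod_topology {z \<in> topspace skorohod_topology. f z \<in> S}"
    using f S(1) by (intro openin_continuous_map_preimage[OF f]) auto
  then have "skorohod_open {z \<in> cadlag_paths. f z \<in> S}"
    by (simp add: openin_skorohod_topology topspace_skorohod_topology)
  then have "\<forall>\<^sub>F n in sequentially. x n \<in> {z \<in> cadlag_paths. f z \<in> S}"
    using x S(2) unfolding skorohod_open_def by blast
  then show "\<forall>\<^sub>F n in sequentially. f (x n) \<in> S" by eventually_elim auto
qed

section \<open>Step paths, the common form of rescaled walks and of discretized cadlag paths\<close>

definition step_path :: "real \<Rightarrow> (nat \<Rightarrow> 'a) \<Rightarrow> real \<Rightarrow> 'a" where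
  "step_path \<epsilon> v = (\<lambda>t\<in>{0..}. v (nat \<lfloor>t / \<epsilon>\<rfloor>))"

lemma step_path_cadlag:
  assumes e: "\<epsilon> > 0"
  shows "step_path \<epsilon> v \<in> cadlag_paths"
proof -
  have "((step_path \<epsilon> v) \<longlongrightarrow> step_path \<epsilon> v t) (at_right t)" if t: "t \<ge> 0" for t
  proof (rule tendsto_eventually)
    have "t < \<epsilon> * (of_int \<lfloor>t / \<epsilon>\<rfloor> + 1)"
      using e floor_correct[of "t/\<epsilon>"] by (simp add: field_simps)
    then have "\<forall>\<^sub>F s in at_right t. s < \<epsilon> * (of_int \<lfloor>t / \<epsilon>\<rfloor> + 1)" by (auto simp: eventually_at_right)
    moreover have "\<forall>\<^sub>F s in at_right t. s > t" by (simp add: eventually_at_right_less)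
    ultimately show "\<forall>\<^sub>F s in at_right t. step_path \<epsilon> v s = step_path \<epsilon> v t"
    proof eventually_elim
      case (elim s)
      have "\<lfloor>s / \<epsilon>\<rfloor> = \<lfloor>t / \<epsilon>\<rfloor>"
      proof (rule floor_unique)
        have "t / \<epsilon> \<le> s / \<epsilon>" using e elim by (simp add: divide_right_mono)
        then show "real_of_int \<lfloor>t / \<epsilon>\<rfloor> \<le> s / \<epsilon>" using of_int_floor_le[of "t/\<epsilon>"] by linarith
        show "s / \<epsilon> < real_of_int \<lfloor>t / \<epsilon>\<rfloor> + 1" using e elim by (simp add: field_simps)
      qed
      then show ?case using t elim by (simp add: step_path_def)
    qed
  qed
  moreover have "\<exists>l. ((step_path \<epsilon> v) \<longlongrightarrow> l) (at_left t)" if t: "t > 0" for t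
  proof (intro exI tendsto_eventually)
    have "\<epsilon> * (of_int \<lceil>t / \<epsilon>\<rceil> - 1) < t" 
      using e ceiling_correct[of "t/\<epsilon>"] by (simp add: field_simps)
    then have "\<forall>\<^sub>F s in at_left t. s > \<epsilon> * (of_int \<lceil>t / \<epsilon>\<rceil> - 1)"
      by (auto simp: eventually_at_left)
    moreover have "\<forall>\<^sub>F s in at_left t. s > 0" using t by (auto simp: eventually_at_left)
    moreover have "\<forall>\<^sub>F s in at_left t. s < t" by (simp add: eventually_at_filter)
    \<comment> \<open>The index \<open>\<lceil>t / \<epsilon>\<rceil> - 1\<close> is that of the
      step just before t; it differs from the index at t exactly when t is a grid point.\<close>
    ultimately show "\<forall>\<^sub>F s in at_left t. step_path \<epsilon> v s = v (nat (\<lceil>t / \<epsilon>\<rceil> - 1))"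
    proof eventually_elim
      case (elim s)
      have "\<lfloor>s / \<epsilon>\<rfloor> = \<lceil>t / \<epsilon>\<rceil> - 1"
      proof (rule floor_unique)
        show "real_of_int (\<lceil>t / \<epsilon>\<rceil> - 1) \<le> s / \<epsilon>" using e elim by (simp add: field_simps)
        have "s / \<epsilon> < t / \<epsilon>" using e elim by (simp add: divide_strict_right_mono)
        then show "s / \<epsilon> < real_of_int (\<lceil>t / \<epsilon>\<rceil> - 1) + 1" using ceiling_correct[of "t/\<epsilon>"] by linarith
      qed
      then show ?case using t elim by (simp add: step_path_def)
    qed
  qed
  ultimately show ?thesis unfolding cadlag_paths_def by (auto simp: step_path_def)
qed

text \<open>All paths jump on the same grid, so the identity serves as time change, and only
  finitely many values matter up to a given horizon.\<close>

lemma skorohod_conv_step_path: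
  fixes v :: "nat \<Rightarrow> nat \<Rightarrow> 'a::metric_space"
  assumes e: "\<epsilon> > 0" and v: "\<And>i. (\<lambda>n. v n i) \<longlonglongrightarrow> u i"
  shows "skorohod_conv (\<lambda>n. step_path \<epsilon> (v n)) (step_path \<epsilon> u)"
proof (rule skorohod_convI)
  fix T e' :: real assume T: "T > 0" "e' > 0"
  have "\<forall>\<^sub>F n in sequentially. \<forall>i\<in>{..nat \<lfloor>T / \<epsilon>\<rfloor>}. dist (v n i) (u i) < e'"
    using tendstoD[OF v T(2)] by (intro eventually_ball_finite) auto
  then show "\<forall>\<^sub>F n in sequentially. \<exists>\<gamma>. time_change \<gamma> \<and>
     (\<forall>t\<in>{0..T}. dist (step_path \<epsilon> (v n) (\<gamma> t)) (step_path \<epsilon> u t) \<le> e' \<and> \<bar>\<gamma> t - t\<bar> \<le> e')"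
  proof eventually_elim
    case (elim n)
    show ?case
    proof (intro exI[of _ "\<lambda>t. t"] conjI ballI)
      show "time_change (\<lambda>t. t)" using time_change_linear[of 1] by simp
      fix t assume t: "t \<in> {0..T}"
      then have "nat \<lfloor>t / \<epsilon>\<rfloor> \<le> nat \<lfloor>T / \<epsilon>\<rfloor>" using e by (intro nat_mono floor_mono divide_right_mono) auto
      then show "dist (step_path \<epsilon> (v n) t) (step_path \<epsilon> u t) \<le> e'" using elim t by (auto simp: step_path_def intro: less_imp_le)
    qed (use T in auto)
  qed
qed

lemma step_path_functional_tendsto:
  fixes v :: "nat \<Rightarrow> nat \<Rightarrow> 'a::metric_space"
  assumes f: "continuous_map skorohod_topology euclideanreal f" and e: "\<epsilon> > 0"
    and v: "\<And>i. (\<lambda>n. v n i) \<longlonglongrightarrow> u i"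
  shows "(\<lambda>n. f (step_path \<epsilon> (v n))) \<longlonglongrightarrow> f (step_path \<epsilon> u)"
  by (rule skorohod_conv_continuous_map[OF f step_path_cadlag[OF e] step_path_cadlag[OF e] skorohod_conv_step_path[OF e v]])

text \<open>The functional is continuous in the sequence of values for the product topology, and the
  Borel sets of a countable product of second countable spaces are generated by the
  coordinates.\<close>

lemma step_path_functional_measurable:
  fixes v :: "'b \<Rightarrow> nat \<Rightarrow> 'a::{metric_space, second_countable_topology}"
  assumes f: "continuous_map skorohod_topology euclideanreal f" and e: "\<epsilon> > 0"
    and v: "\<And>i. (\<lambda>\<omega>. v \<omega> i) \<in> borel_measurable M"
  shows "(\<lambda>\<omega>. f (step_path \<epsilon> (v \<omega>))) \<in> borel_measurable M"
proof -
  have "continuous_on UNIV (\<lambda>u :: nat \<Rightarrow> 'a. f (step_path \<epsilon> u))"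
    unfolding continuous_on_sequentially
  proof (intro allI ballI impI, elim conjE)
    fix x :: "nat \<Rightarrow> nat \<Rightarrow> 'a" and a assume x: "x \<longlonglongrightarrow> a"
    have "(\<lambda>n. x n i) \<longlonglongrightarrow> a i" for i
      using x by (rule continuous_on_tendsto_compose[OF continuous_on_product_coordinates[of i]]) auto
    then show "((\<lambda>u. f (step_path \<epsilon> u)) \<circ> x) \<longlonglongrightarrow> f (step_path \<epsilon> a)"
      unfolding comp_def by (rule step_path_functional_tendsto[OF f e])
  qed
  then have "(\<lambda>u :: nat \<Rightarrow> 'a. f (step_path \<epsilon> u)) \<in> borel_measurable borel"
    by (rule borel_measurable_continuous_onI)
  moreover have "v \<in> borel_measurable M"
    by (rule measurable_coordinatewise_then_product) (rule v)
  ultimately show ?thesis by (rule measurable_compose_rev)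
qed

section \<open>Discretization of cadlag paths and measurability of functionals\<close>

lemma partition_interval:
  fixes s :: "nat \<Rightarrow> 'a::linorder"
  assumes "s 0 \<le> t" "t < s n"
  shows "\<exists>i<n. s i \<le> t \<and> t < s (Suc i)"
  using assms(2)
proof (induction n)
  case 0 then show ?case using assms(1) by auto
next
  case (Suc n)
  then show ?case by (cases "t < s n") (auto simp: not_less intro: less_SucI)
qed

text \<open>Take the supremum c of the endpoints up to which a partition exists. The left limit at c
  gives a last interval ending at c, so c itself is reached; right continuity at c would allow one
  more interval beyond c, so c is \<open>T\<close>.\<close>

lemma cadlag_partition:
  assumes x: "x \<in> cadlag_paths" and e: "e > 0" and T: "T \<ge> 0"
  shows "\<exists>n s. s 0 = 0 \<and> s n = T \<and> (\<forall>i<n. s i < s (Suc i)) \<and>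
    (\<forall>i<n. \<forall>a\<in>{s i..<s (Suc i)}. \<forall>b\<in>{s i..<s (Suc i)}. dist (x a) (x b) \<le> e)"
proof -
  define osc where "osc n s \<longleftrightarrow> (\<forall>i<n. \<forall>a\<in>{s i..<s (Suc i)}. \<forall>b\<in>{s i..<s (Suc i)}. dist (x a) (x b) \<le> e)"
    for n :: nat and s :: "nat \<Rightarrow> real"
  define good where "good c \<longleftrightarrow> (\<exists>n s. s 0 = 0 \<and> s n = c \<and> (\<forall>i<n. s i < s (Suc i)) \<and> osc n s)" for c :: real
  have good0: "good 0" unfolding good_def osc_def by (intro exI[of _ 0] exI[of _ "\<lambda>_. 0"]) auto
  \<comment> \<open>One more interval can be appended as soon as the path stays within
    \<open>e / 2\<close> of some point l there; l will be the left limit at c, then the value at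
    c.\<close>
  have extend: "good d" if gc: "good c" and cd: "c < d" and l: "\<And>a. c \<le> a \<Longrightarrow> a < d \<Longrightarrow> dist (x a) l < e / 2" for c d l
  proof -
    obtain n s where s: "s 0 = 0" "s n = c" "\<forall>i<n. s i < s (Suc i)" "osc n s"
      using gc unfolding good_def by blast
    have osc_last: "dist (x a) (x b) \<le> e" if ab: "c \<le> a" "a < d" "c \<le> b" "b < d" for a b
    proof -
      have "dist (x a) l < e / 2" "dist (x b) l < e / 2" using ab l by auto
      then show ?thesis using dist_triangle2[of "x a" "x b" l] by linarith
    qed
    define s' where "s' = s(Suc n := d)"
    have "osc (Suc n) s'" unfolding osc_def
    proof (intro allI impI ballI)
      fix i a b assume i: "i < Suc n" and ab: "a \<in> {s' i..<s' (Suc i)}" "b \<in> {s' i..<s' (Suc i)}"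
      show "dist (x a) (x b) \<le> e"
      proof (cases "i = n")
        case True
        then show ?thesis using ab osc_last[of a b] s(2) by (simp add: s'_def)
      next
        case False
        then have "i < n" "a \<in> {s i..<s (Suc i)}" "b \<in> {s i..<s (Suc i)}" using i ab by (simp_all add: s'_def)
        then show ?thesis using s(4) unfolding osc_def by blast
      qed
    qed
    moreover have "\<forall>i<Suc n. s' i < s' (Suc i)" using s(2,3) cd by (simp add: s'_def less_Suc_eq)
    moreover have "s' 0 = 0" "s' (Suc n) = d" using s(1) by (simp_all add: s'_def)
    ultimately show ?thesis unfolding good_def by blast
  qed
  define A where "A = {c. 0 \<le> c \<and> c \<le> T \<and> good c}"
  have A0: "0 \<in> A" and bdd: "bdd_above A" using good0 T by (auto simp: A_def bdd_above_def)
  define c where "c = Sup A"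
  have c: "0 \<le> c" "c \<le> T" unfolding c_def using A0 bdd
    by (auto intro: cSup_upper cSup_least simp: A_def)
  have "good c"
  proof (cases "c = 0")
    case False
    then have "c > 0" using c by auto
    then obtain l where "(x \<longlongrightarrow> l) (at_left c)" using x unfolding cadlag_paths_def by blast
    then have "\<forall>\<^sub>F s in at_left c. dist (x s) l < e / 2" using e by (intro tendstoD) auto
    then obtain d where d: "d < c" "\<And>s. d < s \<Longrightarrow> s < c \<Longrightarrow> dist (x s) l < e / 2"
      by (auto simp: eventually_at_left_field)
    obtain a where a: "a \<in> A" "a > d" using d(1) A0 less_cSupE[of d A] unfolding c_def by blast
    have "a \<le> c" unfolding c_def using a bdd by (auto intro: cSup_upper)
    then show ?thesis using a extend[of a c l] d(2) by (cases "a = c") (auto simp: A_def)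
  qed (use good0 in auto)
  moreover have "c = T"
  proof (rule ccontr)
    assume "c \<noteq> T"
    then have cT: "c < T" using c by auto
    have "(x \<longlongrightarrow> x c) (at_right c)" using x c unfolding cadlag_paths_def by auto
    then have "\<forall>\<^sub>F s in at_right c. dist (x s) (x c) < e / 2" using e by (intro tendstoD) auto
    then obtain d where d: "d > c" "\<And>s. c < s \<Longrightarrow> s < d \<Longrightarrow> dist (x s) (x c) < e / 2"
      by (auto simp: eventually_at_right_field)
    have "good (min d T)"
    proof (rule extend[OF \<open>good c\<close>])
      show "dist (x a) (x c) < e / 2" if "c \<le> a" "a < min d T" for a
        using d(2)[of a] that e by (cases "a = c") auto
    qed (use d cT in auto)
    then have "min d T \<in> A" using c d by (auto simp: A_def)
    then have "min d T \<le> c" unfolding c_def using bdd by (auto intro: cSup_upper)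
    then show False using d cT by auto
  qed
  ultimately show ?thesis unfolding good_def osc_def by simp
qed

text \<open>A time change moves the points of a partition of small oscillation to the grid. The
  sampled time and the true time then lie in the same interval of the partition, whence closeness of
  the values.\<close>

lemma skorohod_conv_discretization:
  assumes x: "x \<in> cadlag_paths"
  shows "skorohod_conv (\<lambda>n. step_path (1 / real (Suc n)) (\<lambda>i. x (real i / real (Suc n)))) x"
proof (rule skorohod_convI)
  fix T e :: real assume T: "T > 0" "e > 0"
  \<comment> \<open>The partition runs up to \<open>T + 1\<close> because its intervals are
    half-open and \<open>T\<close> itself must lie in one of them.\<close>
  obtain m s where s: "s 0 = 0" "s m = T + 1" "\<And>i. i < m \<Longrightarrow> s i < s (Suc i)"
      "\<And>i a b. i < m \<Longrightarrow> a \<in> {s i..<s (Suc i)} \<Longrightarrow> b \<in> {s i..<s (Suc i)} \<Longrightarrow> dist (x a) (x b) \<le> e"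
    using cadlag_partition[OF x T(2), of "T + 1"] T by force
  have inv: "(\<lambda>n. 1 / real (Suc n)) \<longlonglongrightarrow> 0" using LIMSEQ_inverse_real_of_nat by (simp add: inverse_eq_divide)
  have "\<forall>\<^sub>F n in sequentially. \<forall>i\<in>{..<m}. 1 / real (Suc n) < s (Suc i) - s i"
    using s(3) by (intro eventually_ball_finite ballI order_tendstoD[OF inv]) auto
  moreover have "\<forall>\<^sub>F n in sequentially. 1 / real (Suc n) < e"
    using T by (intro order_tendstoD[OF inv]) auto
  ultimately show "\<forall>\<^sub>F n in sequentially. \<exists>\<gamma>. time_change \<gamma> \<and>
     (\<forall>t\<in>{0..T}. dist (step_path (1 / real (Suc n)) (\<lambda>i. x (real i / real (Suc n))) (\<gamma> t)) (x t) \<le> e \<and> \<bar>\<gamma> t - t\<bar> \<le> e)"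
  proof eventually_elim
    case (elim n)
    define N where "N = real (Suc n)"
    have N: "N > 0" by (auto simp: N_def)
    \<comment> \<open>Rounding up matters: a grid point from \<open>r i\<close> on but before
      \<open>r (Suc i)\<close> then lies in \<open>[s i, s (Suc i))\<close>. The mesh is smaller
      than every gap of the partition, which keeps r strictly increasing.\<close>
    define r where "r i = of_int \<lceil>s i * N\<rceil> / N" for i
    have r: "r i < r (Suc i)" if "i < m" for i
    proof -
      have "1 / N < s (Suc i) - s i" using elim(1) that by (auto simp: N_def)
      then have "s i * N + 1 < s (Suc i) * N" using N by (simp add: field_simps)
      then have "\<lceil>s i * N\<rceil> < \<lceil>s (Suc i) * N\<rceil>" by linarith
      then show ?thesis using N by (simp add: r_def divide_strict_right_mono)
    qed
    have rs: "\<bar>r i - s i\<bar> \<le> e" for i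
    proof -
      have "s i * N \<le> of_int \<lceil>s i * N\<rceil>" "of_int \<lceil>s i * N\<rceil> \<le> s i * N + 1" by linarith+
      then have "s i \<le> r i" "r i \<le> s i + 1 / N" using N by (auto simp: r_def field_simps)
      then show ?thesis using elim(2) by (auto simp: N_def)
    qed
    obtain \<gamma> where g: "time_change \<gamma>" "\<And>i. i \<le> m \<Longrightarrow> \<gamma> (s i) = r i" "\<And>t. t \<ge> 0 \<Longrightarrow> \<bar>\<gamma> t - t\<bar> \<le> e"
      using time_change_interpolation[of s r m e] r rs s(1,3) by (auto simp: r_def)
    have sm: "i \<le> m \<Longrightarrow> 0 \<le> s i" for i
    proof (induction i)
      case (Suc i)
      then show ?case using s(3)[of i] by linarith
    qed (simp add: s(1))
    have "dist (step_path (1 / real (Suc n)) (\<lambda>i. x (real i / real (Suc n))) (\<gamma> t)) (x t) \<le> e" if t: "t \<in> {0..T}" for t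
    proof -
      obtain i where i: "i < m" "s i \<le> t" "t < s (Suc i)"
        using partition_interval[of s t m] t s(1,2) by auto
      have "r i \<le> \<gamma> t" using time_change_less[OF g(1), of "s i" t] sm[of i] i g(2)[of i]
        by (cases "s i = t") auto
      moreover have "\<gamma> t < r (Suc i)" using time_change_less[OF g(1), of t "s (Suc i)"] t i g(2)[of "Suc i"] by auto
      ultimately have "of_int \<lceil>s i * N\<rceil> \<le> \<gamma> t * N" "\<gamma> t * N < of_int \<lceil>s (Suc i) * N\<rceil>"
        using N by (auto simp: r_def field_simps)
      then have fl: "\<lceil>s i * N\<rceil> \<le> \<lfloor>\<gamma> t * N\<rfloor>" "\<lfloor>\<gamma> t * N\<rfloor> < \<lceil>s (Suc i) * N\<rceil>" by linarith+
      then have "s i * N \<le> of_int \<lfloor>\<gamma> t * N\<rfloor>" "of_int \<lfloor>\<gamma> t * N\<rfloor> < s (Suc i) * N" by linarith+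
      then have "of_int \<lfloor>\<gamma> t * N\<rfloor> / N \<in> {s i..<s (Suc i)}" using N by (auto simp: field_simps)
      then have "dist (x (of_int \<lfloor>\<gamma> t * N\<rfloor> / N)) (x t) \<le> e" using s(4) i by auto
      moreover have "\<gamma> t \<ge> 0" using time_change_nonneg[OF g(1)] t by auto
      moreover have "\<lfloor>\<gamma> t * N\<rfloor> \<ge> 0" using N \<open>\<gamma> t \<ge> 0\<close> by auto
      ultimately show ?thesis by (simp add: step_path_def N_def)
    qed
    then show ?case using g by (intro exI[of _ \<gamma>]) auto
  qed
qed

text \<open>Pointwise limit of the functional along discretizations, each of which is measurable
  because it reads the path at grid times only.\<close>

lemma cadlag_functional_measurable:
  fixes Z :: "'b \<Rightarrow> real \<Rightarrow> 'a::{metric_space, second_countable_topology}"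
  assumes f: "continuous_map skorohod_topology euclideanreal f"
    and Z: "\<And>\<omega>. \<omega> \<in> space M \<Longrightarrow> Z \<omega> \<in> cadlag_paths" "\<And>t. t \<ge> 0 \<Longrightarrow> (\<lambda>\<omega>. Z \<omega> t) \<in> borel_measurable M"
  shows "(\<lambda>\<omega>. f (Z \<omega>)) \<in> borel_measurable M"
proof (rule borel_measurable_LIMSEQ_real)
  fix \<omega> assume \<omega>: "\<omega> \<in> space M"
  show "(\<lambda>n. f (step_path (1 / real (Suc n)) (\<lambda>i. Z \<omega> (real i / real (Suc n))))) \<longlonglongrightarrow> f (Z \<omega>)"
    by (rule skorohod_conv_continuous_map[OF f step_path_cadlag Z(1)[OF \<omega>] skorohod_conv_discretization[OF Z(1)[OF \<omega>]]]) auto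
next
  fix n
  show "(\<lambda>\<omega>. f (step_path (1 / real (Suc n)) (\<lambda>i. Z \<omega> (real i / real (Suc n))))) \<in> borel_measurable M"
    by (rule step_path_functional_measurable[OF f]) (auto intro!: Z(2))
qed

section \<open>The cumulative jump rate\<close>

lemma continuous_antiderivative_exists:
  fixes g :: "real \<Rightarrow> real"
  assumes g: "continuous_on UNIV g"
  shows "\<exists>F. \<forall>x. (F has_real_derivative g x) (at x)"
proof -
  define F where "F x = integral {0..x} g - integral {x..0} g" for x
  have "(F has_real_derivative g x) (at x)" for x
  proof -
    \<comment> \<open>The base point \<open>-n\<close> lies to the left of both x and 0, so near x
      the signed integral from 0 differs by a constant from the integral started at
      \<open>-n\<close>.\<close>
    define n where "n = \<bar>x\<bar> + 1"
    have gi: "g integrable_on {a..b}" for a b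
      by (rule integrable_continuous_interval) (rule continuous_on_subset[OF g], simp)
    have F: "F y = integral {-n..y} g - integral {-n..0} g" if y: "y \<in> {-n<..<n}" for y
    proof (cases "y \<ge> 0")
      case True
      then have "integral {y..0} g = 0" by (cases "y = 0") auto
      then show ?thesis using True y gi Henstock_Kurzweil_Integration.integral_combine[of "-n" 0 y g] by (auto simp: F_def)
    next
      case False
      then show ?thesis using y gi Henstock_Kurzweil_Integration.integral_combine[of "-n" y 0 g] by (auto simp: F_def)
    qed
    have x: "x \<in> {-n<..<n}" by (auto simp: n_def)
    have "((\<lambda>y. integral {-n..y} g) has_real_derivative g x) (at x within {-n..n})"
      by (rule integral_has_real_derivative) (use x g in \<open>auto intro: continuous_on_subset\<close>)
    then have "((\<lambda>y. integral {-n..y} g) has_real_derivative g x) (at x)"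
      using x at_within_interior[of x "{-n..n}"] by simp
    then have der: "((\<lambda>y. integral {-n..y} g - integral {-n..0} g) has_real_derivative g x) (at x)"
      by (auto intro!: derivative_eq_intros)
    have ev: "\<forall>\<^sub>F y in nhds x. F y = integral {-n..y} g - integral {-n..0} g"
      using eventually_nhds_in_open[OF open_greaterThanLessThan x] by eventually_elim (rule F)
    show ?thesis using der DERIV_cong_ev[OF refl ev refl, of "g x"] by simp
  qed
  then show ?thesis by blast
qed

locale zigzag_hazard =
  fixes H h :: "real \<Rightarrow> real" and \<Phi> :: "real \<Rightarrow> real \<Rightarrow> real"
  assumes H_deriv: "\<And>x. (H has_real_derivative h x) (at x)"
    and h_cont: "continuous_on UNIV h"
    and H_top: "filterlim H at_top at_infinity"
    and \<Phi>_deriv: "\<And>w x. (\<Phi> w has_real_derivative max (w * h x) 0) (at x)"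
begin

text \<open>The cumulative jump rate along the flow. Writing it through an antiderivative on the
  whole line, with the factor w correcting the orientation when w is -1, makes its joint continuity
  in y and t immediate.\<close>

definition hazard :: "real \<Rightarrow> real \<Rightarrow> real \<Rightarrow> real" where
  "hazard y w t = w * (\<Phi> w (y + w * t) - \<Phi> w y)"

lemma hazard_0 [simp]: "hazard y w 0 = 0"
  by (simp add: hazard_def)

lemma \<Phi>_cont: "continuous_on A (\<Phi> w)"
  using \<Phi>_deriv by (meson DERIV_isCont continuous_at_imp_continuous_on)

lemma isCont_\<Phi>: "isCont (\<Phi> w) x"
  using \<Phi>_deriv by (rule DERIV_isCont)

lemma \<Phi>_measurable [measurable]: "\<Phi> w \<in> borel_measurable borel"
  by (rule borel_measurable_continuous_onI) (rule \<Phi>_cont)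

lemma hazard_cont: "continuous_on A (hazard y w)"
  unfolding hazard_def by (intro continuous_intros continuous_on_compose2[OF \<Phi>_cont[of UNIV w]]) auto

lemma hazard_tendsto:
  assumes "(f \<longlongrightarrow> y) F" "(g \<longlongrightarrow> t) F"
  shows "((\<lambda>k. hazard (f k) w (g k)) \<longlongrightarrow> hazard y w t) F"
  unfolding hazard_def
  by (intro tendsto_intros isCont_tendsto_compose[OF isCont_\<Phi>] assms)

lemma hazard_deriv:
  assumes w: "w \<in> {-1, 1}"
  shows "(hazard y w has_real_derivative max (w * h (y + w * t)) 0) (at t)"
proof -
  have "((\<lambda>t. \<Phi> w (y + w * t)) has_real_derivative max (w * h (y + w * t)) 0 * w) (at t)"
    by (rule DERIV_chain2[OF \<Phi>_deriv]) (auto intro!: derivative_eq_intros)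
  then have "(hazard y w has_real_derivative w * (max (w * h (y + w * t)) 0 * w)) (at t)"
    unfolding hazard_def by (auto intro!: derivative_eq_intros)
  then show ?thesis using w by auto
qed

lemma hazard_mono:
  assumes w: "w \<in> {-1, 1}" and "s \<le> t"
  shows "hazard y w s \<le> hazard y w t"
  by (rule DERIV_nonneg_imp_nondecreasing[OF assms(2)]) (use hazard_deriv[OF w] in \<open>meson max.cobounded2\<close>)

lemma hazard_nonneg: "w \<in> {-1, 1} \<Longrightarrow> 0 \<le> t \<Longrightarrow> 0 \<le> hazard y w t"
  using hazard_mono[of w 0 t y] by simp

text \<open>The rate dominates \<open>w * h\<close>, which is the derivative of H along the flow.
  This is how growth of H at infinity forces jumps to occur.\<close>

lemma hazard_ge:
  assumes w: "w \<in> {-1, 1}" and t: "0 \<le> t"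
  shows "H (y + w * t) - H y \<le> hazard y w t"
proof -
  have "((\<lambda>t. hazard y w t - H (y + w * t)) has_real_derivative max (w * h (y + w * t)) 0 - h (y + w * t) * w) (at t)" for t
    by (intro DERIV_diff hazard_deriv[OF w] DERIV_chain2[OF H_deriv]) (auto intro!: derivative_eq_intros)
  then have "hazard y w 0 - H (y + w * 0) \<le> hazard y w t - H (y + w * t)"
    by (intro DERIV_nonneg_imp_nondecreasing[OF t]) (metis diff_ge_0_iff_ge max.cobounded1 mult.commute)
  then show ?thesis by simp
qed

lemma hazard_at_top:
  assumes w: "w \<in> {-1, 1}"
  shows "filterlim (hazard y w) at_top at_top"
proof -
  have "filterlim (\<lambda>t. y + w * t) at_infinity at_top"
  proof (rule filterlim_norm_at_top_imp_at_infinity)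
    have "filterlim (\<lambda>t::real. - \<bar>y\<bar> + t) at_top at_top"
      by (rule filterlim_tendsto_add_at_top[OF tendsto_const filterlim_ident])
    then show "filterlim (\<lambda>t. norm (y + w * t)) at_top at_top"
      by (rule filterlim_at_top_mono) (use w in \<open>auto intro!: eventually_at_top_linorderI[of 0]\<close>)
  qed
  then have "filterlim (\<lambda>t. H (y + w * t)) at_top at_top" by (rule filterlim_compose[OF H_top])
  then have "filterlim (\<lambda>t. - H y + H (y + w * t)) at_top at_top" by (rule filterlim_tendsto_add_at_top[OF tendsto_const])
  then show ?thesis
    by (rule filterlim_at_top_mono) (use hazard_ge[OF w] in \<open>auto intro!: eventually_at_top_linorderI[of 0]\<close>)
qed

lemma zigzag_survival_eq:
  assumes w: "w \<in> {-1, 1}" and t: "0 \<le> t"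
  shows "zigzag_survival H y w t = exp (- hazard y w t)"
proof -
  have d: "deriv H = h" using H_deriv by (intro ext DERIV_imp_deriv)
  have "(hazard y w has_vector_derivative max (w * h (y + w * s)) 0) (at s within {0..t})" for s
    using hazard_deriv[OF w] has_field_derivative_at_within
    unfolding has_real_derivative_iff_has_vector_derivative[symmetric] by blast
  then have "((\<lambda>s. max (w * h (y + w * s)) 0) has_integral hazard y w t - hazard y w 0) {0..t}"
    by (rule fundamental_theorem_of_calculus[OF t])
  then have "integral {0..t} (\<lambda>s. max (w * deriv H (y + s * w)) 0) = hazard y w t"
    by (simp add: d mult.commute integral_unique)
  then show ?thesis by (simp add: zigzag_survival_def)
qed

text \<open>The speed is 1, so up to time t only rates within distance t of y are met. The bound
  serves to exclude explosion.\<close>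

lemma hazard_le:
  assumes w: "w \<in> {-1, 1}" and t: "0 \<le> t" and C: "\<And>x. \<bar>x - y\<bar> \<le> t \<Longrightarrow> \<bar>h x\<bar> \<le> C"
  shows "hazard y w t \<le> C * t"
proof -
  have "hazard y w t - C * t \<le> hazard y w 0 - C * 0"
  proof (rule DERIV_nonpos_imp_nonincreasing[OF t])
    fix s assume s: "0 \<le> s" "s \<le> t"
    have "((\<lambda>t. hazard y w t - C * t) has_real_derivative max (w * h (y + w * s)) 0 - C) (at s)"
      by (intro DERIV_diff hazard_deriv[OF w]) (auto intro!: derivative_eq_intros)
    moreover have "\<bar>h (y + w * s)\<bar> \<le> C" using s w by (intro C) auto
    then have "max (w * h (y + w * s)) 0 - C \<le> 0" using w by auto
    ultimately show "\<exists>d. ((\<lambda>t. hazard y w t - C * t) has_real_derivative d) (at s) \<and> d \<le> 0" by blast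
  qed
  then show ?thesis by simp
qed

lemma hazard_add:
  assumes w: "w \<in> {-1, 1}"
  shows "hazard y w (s + t) = hazard y w s + hazard (y + w * s) w t"
  by (simp add: hazard_def algebra_simps)

end

section \<open>The walk driven by clocks\<close>

text \<open>State: position and velocity, index of the current clock, and what is left of that clock.\<close>

primrec driven_walk :: "(int \<Rightarrow> real) \<Rightarrow> (nat \<Rightarrow> real) \<Rightarrow> int \<times> int \<Rightarrow> nat \<Rightarrow> (int \<times> int) \<times> nat \<times> real" where
  "driven_walk U E s 0 = (s, 0, E 0)"
| "driven_walk U E s (Suc m) = (case driven_walk U E s m of ((x, v), n, e) \<Rightarrow>
     (let d = max (U (x + v) - U x) 0 in
       if d < e then ((x + v, v), n, e - d) else ((x, - v), Suc n, E (Suc n))))"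

text \<open>The discrete counterpart of \<open>hazard\<close>: a run continues for k steps exactly
  as long as this quantity stays below its clock.\<close>

definition climb :: "(int \<Rightarrow> real) \<Rightarrow> int \<Rightarrow> int \<Rightarrow> nat \<Rightarrow> real" where
  "climb U x v k = (\<Sum>j<k. max (U (x + int (Suc j) * v) - U (x + int j * v)) 0)"

lemma climb_0 [simp]: "climb U x v 0 = 0"
  by (simp add: climb_def)

lemma climb_Suc: "climb U x v (Suc k) = climb U x v k + max (U (x + int k * v + v) - U (x + int k * v)) 0"
  by (simp add: climb_def algebra_simps)

lemma climb_mono: "k \<le> l \<Longrightarrow> climb U x v k \<le> climb U x v l"
  by (rule lift_Suc_mono_le[of "climb U x v"]) (auto simp: climb_Suc)

lemma driven_walk_run:
  assumes "driven_walk U E s m = ((x, v), n, E n)" "climb U x v k < E n"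
  shows "driven_walk U E s (m + k) = ((x + int k * v, v), n, E n - climb U x v k)"
  using assms(2)
proof (induction k)
  case (Suc k)
  have "climb U x v k < E n" using Suc.prems climb_mono[of k "Suc k" U x v] by simp
  then have IH: "driven_walk U E s (m + k) = ((x + int k * v, v), n, E n - climb U x v k)" by (rule Suc.IH)
  define d where "d = max (U (x + int k * v + v) - U (x + int k * v)) 0"
  have d: "d < E n - climb U x v k" using Suc.prems[unfolded climb_Suc] unfolding d_def by linarith
  then have "driven_walk U E s (m + Suc k) = ((x + int k * v + v, v), n, E n - climb U x v k - d)"
    by (simp add: IH Let_def d_def)
  then show ?case by (simp add: climb_Suc d_def algebra_simps)
qed (simp add: assms(1))

text \<open>The flip uses up a time step without displacement, hence the time
  \<open>Suc (m + k)\<close> against the position after k moves.\<close>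

lemma driven_walk_flip:
  assumes "driven_walk U E s m = ((x, v), n, E n)" "climb U x v k < E n" "E n \<le> climb U x v (Suc k)"
  shows "driven_walk U E s (Suc (m + k)) = ((x + int k * v, - v), Suc n, E (Suc n))"
  using assms(2,3) by (simp add: driven_walk_run[OF assms(1,2)] climb_Suc Let_def)

text \<open>The number of moves before the flip: the move number \<open>Suc k\<close> is the first
  one that would exhaust the clock, and it is refused.\<close>

definition run_length :: "(int \<Rightarrow> real) \<Rightarrow> int \<Rightarrow> int \<Rightarrow> real \<Rightarrow> nat" where
  "run_length U x v e = (LEAST k. e \<le> climb U x v (Suc k))"

text \<open>The components are the time index and the position at which run i begins;
  \<open>Suc\<close> accounts for the flipping step.\<close>

primrec run_start :: "(int \<Rightarrow> real) \<Rightarrow> (nat \<Rightarrow> real) \<Rightarrow> int \<Rightarrow> int \<Rightarrow> nat \<Rightarrow> nat \<times> int" where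
  "run_start U E x v 0 = (0, x)"
| "run_start U E x v (Suc i) = (case run_start U E x v i of (J, z) \<Rightarrow>
     (let k = run_length U z (v * (-1) ^ i) (E i) in (Suc (J + k), z + int k * (v * (-1) ^ i))))"

lemma nat_floor_div_bounds:
  fixes t e :: real
  assumes "0 \<le> t" "0 < e"
  shows "e * real (nat \<lfloor>t / e\<rfloor>) \<le> t" "t < e * real (nat \<lfloor>t / e\<rfloor>) + e"
proof -
  have "real (nat \<lfloor>t / e\<rfloor>) = of_int \<lfloor>t / e\<rfloor>" using assms by (simp add: zero_le_floor)
  moreover have "of_int \<lfloor>t / e\<rfloor> * e \<le> t" "t < (of_int \<lfloor>t / e\<rfloor> + 1) * e"
    using assms by (simp_all add: floor_divide_lower floor_divide_upper)
  ultimately show "e * real (nat \<lfloor>t / e\<rfloor>) \<le> t" "t < e * real (nat \<lfloor>t / e\<rfloor>) + e"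
    using assms by (simp_all add: algebra_simps)
qed

lemma nat_floor_div_tendsto:
  assumes e: "\<And>k. 0 < \<epsilon> k" "\<epsilon> \<longlonglongrightarrow> 0" and t: "0 \<le> t"
  shows "(\<lambda>k. \<epsilon> k * real (nat \<lfloor>t / \<epsilon> k\<rfloor>)) \<longlonglongrightarrow> t"
proof (rule tendsto_sandwich[OF _ _ _ tendsto_const])
  show "(\<lambda>k. t - \<epsilon> k) \<longlonglongrightarrow> t" using tendsto_diff[OF tendsto_const e(2), of t] by simp
  show "\<forall>\<^sub>F k in sequentially. \<epsilon> k * real (nat \<lfloor>t / \<epsilon> k\<rfloor>) \<le> t"
    using nat_floor_div_bounds(1)[OF t e(1)] by simp
  show "\<forall>\<^sub>F k in sequentially. t - \<epsilon> k \<le> \<epsilon> k * real (nat \<lfloor>t / \<epsilon> k\<rfloor>)"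
    using nat_floor_div_bounds(2)[OF t e(1)] by (intro always_eventually allI) (simp add: algebra_simps less_imp_le)
qed

section \<open>Scaling limit of the driven walk for fixed clock values\<close>

context zigzag_hazard
begin

text \<open>By the mean value theorem both quantities are e times a positive part of
  \<open>w * h\<close> at some point of the step. The positive part is 1-Lipschitz, so the error is
  controlled by the oscillation of h over one step.\<close>

lemma hazard_step_approx:
  assumes w: "w \<in> {-1, 1}" and e: "0 < e"
    and \<eta>: "\<And>s s'. \<bar>s - a\<bar> \<le> e \<Longrightarrow> \<bar>s' - a\<bar> \<le> e \<Longrightarrow> \<bar>s - s'\<bar> \<le> e \<Longrightarrow> \<bar>h s - h s'\<bar> \<le> \<eta>"
  shows "\<bar>max (H (a + w * e) - H a) 0 - hazard a w e\<bar> \<le> \<eta> * e"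
proof -
  have "((\<lambda>t. H (a + w * t)) has_real_derivative h (a + w * t) * w) (at t)" for t
    by (rule DERIV_chain2[OF H_deriv]) (auto intro!: derivative_eq_intros)
  from MVT2[OF e, of "\<lambda>t. H (a + w * t)", OF this]
  obtain s where s: "0 < s" "s < e" "H (a + w * e) - H a = e * (h (a + w * s) * w)" by auto
  from MVT2[OF e, of "hazard a w", OF hazard_deriv[OF w]]
  obtain s' where s': "0 < s'" "s' < e" "hazard a w e = e * max (w * h (a + w * s')) 0" by auto
  have "max (H (a + w * e) - H a) 0 = e * max (w * h (a + w * s)) 0"
    using e unfolding s(3) by (auto simp: max_def zero_le_mult_iff mult_le_0_iff algebra_simps)
  then have "\<bar>max (H (a + w * e) - H a) 0 - hazard a w e\<bar> = e * \<bar>max (w * h (a + w * s)) 0 - max (w * h (a + w * s')) 0\<bar>"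
    using e by (simp add: s'(3) abs_mult right_diff_distrib[symmetric])
  also have "\<dots> \<le> e * \<bar>h (a + w * s) - h (a + w * s')\<bar>"
    using e w by (intro mult_left_mono) auto
  also have "\<dots> \<le> e * \<eta>"
    using e w s s' by (intro mult_left_mono \<eta>) auto
  finally show ?thesis by (simp add: mult.commute)
qed

text \<open>The one-step errors add up, because the hazard is additive along the flow; \<eta> bounds
  the oscillation of h at scale e within the reach of the run.\<close>

lemma climb_approx:
  fixes w :: int
  assumes w: "w \<in> {-1, 1}" and e: "0 < e"
    and \<eta>: "\<And>s s'. \<bar>s - e * x\<bar> \<le> e * K \<Longrightarrow> \<bar>s' - e * x\<bar> \<le> e * K \<Longrightarrow> \<bar>s - s'\<bar> \<le> e \<Longrightarrow> \<bar>h s - h s'\<bar> \<le> \<eta>"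
  shows "\<bar>climb (\<lambda>j. H (e * of_int j)) x w K - hazard (e * of_int x) (of_int w) (e * real K)\<bar> \<le> real K * (\<eta> * e)"
  using \<eta>
proof (induction K)
  case (Suc K)
  have w': "real_of_int w \<in> {-1, 1}" using w by auto
  define a where "a = e * of_int (x + int K * w)"
  have a: "\<bar>a - e * x\<bar> \<le> e * K" using w e by (auto simp: a_def algebra_simps)
  have IH: "\<bar>climb (\<lambda>j. H (e * of_int j)) x w K - hazard (e * of_int x) (of_int w) (e * real K)\<bar> \<le> real K * (\<eta> * e)"
  proof (rule Suc.IH)
    fix s s' :: real assume "\<bar>s - e * x\<bar> \<le> e * K" "\<bar>s' - e * x\<bar> \<le> e * K" "\<bar>s - s'\<bar> \<le> e"
    then show "\<bar>h s - h s'\<bar> \<le> \<eta>" using e by (intro Suc.prems) (auto simp: algebra_simps)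
  qed
  have "\<bar>max (H (a + of_int w * e) - H a) 0 - hazard a (of_int w) e\<bar> \<le> \<eta> * e"
  proof (rule hazard_step_approx[OF w' e])
    fix s s' :: real assume "\<bar>s - a\<bar> \<le> e" "\<bar>s' - a\<bar> \<le> e" "\<bar>s - s'\<bar> \<le> e"
    then show "\<bar>h s - h s'\<bar> \<le> \<eta>" using a by (intro Suc.prems) (auto simp: algebra_simps)
  qed
  moreover have "climb (\<lambda>j. H (e * of_int j)) x w (Suc K) = climb (\<lambda>j. H (e * of_int j)) x w K + max (H (a + of_int w * e) - H a) 0"
    by (simp add: climb_Suc a_def algebra_simps)
  moreover have "hazard (e * of_int x) (of_int w) (e * real (Suc K)) = hazard (e * of_int x) (of_int w) (e * real K) + hazard a (of_int w) e"
    using hazard_add[OF w', of "e * of_int x" "e * real K" e] by (simp add: a_def algebra_simps)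
  ultimately show ?case using IH by (simp add: algebra_simps)
qed simp

lemma climb_tendsto:
  fixes w :: int
  assumes w: "w \<in> {-1, 1}" and e: "\<And>k. 0 < \<epsilon> k" "\<epsilon> \<longlonglongrightarrow> 0"
    and x: "(\<lambda>k. \<epsilon> k * of_int (x k)) \<longlonglongrightarrow> y" and K: "(\<lambda>k. \<epsilon> k * real (K k)) \<longlonglongrightarrow> t"
  shows "(\<lambda>k. climb (\<lambda>j. H (\<epsilon> k * of_int j)) (x k) w (K k)) \<longlonglongrightarrow> hazard y (of_int w) t"
proof -
  have "(\<lambda>k. climb (\<lambda>j. H (\<epsilon> k * of_int j)) (x k) w (K k) - hazard (\<epsilon> k * of_int (x k)) (of_int w) (\<epsilon> k * real (K k))) \<longlonglongrightarrow> 0"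
  proof (rule LIMSEQ_I)
    fix r :: real assume r: "r > 0"
    have t: "t \<ge> 0" by (rule tendsto_lowerbound[OF K]) (use e(1) in \<open>auto simp: less_imp_le\<close>)
    \<comment> \<open>The accumulated error is \<open>\<epsilon> k * K k * \<eta>\<close> and
      \<open>\<epsilon> k * K k\<close> is eventually below \<open>t + 1\<close>, so it stays below
      \<open>r / 2\<close>.\<close>
    define \<eta> where "\<eta> = r / 2 / (t + 1)"
    have \<eta>: "\<eta> > 0" using r t by (auto simp: \<eta>_def)
    \<comment> \<open>The radius \<open>t + 2\<close> allows 1 for the starting point and
      \<open>t + 1\<close> for the length of the run.\<close>
    have "uniformly_continuous_on {y - t - 2..y + t + 2} h"
      by (rule compact_uniformly_continuous) (use h_cont in \<open>auto intro: continuous_on_subset\<close>)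
    then obtain \<delta> where d: "\<delta> > 0" "\<And>s s'. s \<in> {y - t - 2..y + t + 2} \<Longrightarrow> s' \<in> {y - t - 2..y + t + 2} \<Longrightarrow> dist s' s < \<delta> \<Longrightarrow> dist (h s') (h s) < \<eta>"
      using \<eta> unfolding uniformly_continuous_on_def by blast
    have "\<forall>\<^sub>F k in sequentially. \<epsilon> k < \<delta>" using e(2) d(1) by (rule order_tendstoD)
    moreover have "\<forall>\<^sub>F k in sequentially. dist (\<epsilon> k * of_int (x k)) y < 1" by (rule tendstoD[OF x]) simp
    moreover have "\<forall>\<^sub>F k in sequentially. dist (\<epsilon> k * real (K k)) t < 1" by (rule tendstoD[OF K]) simp
    ultimately have "\<forall>\<^sub>F k in sequentially. norm (climb (\<lambda>j. H (\<epsilon> k * of_int j)) (x k) w (K k) - hazard (\<epsilon> k * of_int (x k)) (of_int w) (\<epsilon> k * real (K k)) - 0) < r"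
    proof eventually_elim
      case (elim k)
      have "\<bar>climb (\<lambda>j. H (\<epsilon> k * of_int j)) (x k) w (K k) - hazard (\<epsilon> k * of_int (x k)) (of_int w) (\<epsilon> k * real (K k))\<bar> \<le> real (K k) * (\<eta> * \<epsilon> k)"
      proof (rule climb_approx[OF w e(1)])
        fix s s' assume s: "\<bar>s - \<epsilon> k * x k\<bar> \<le> \<epsilon> k * K k" "\<bar>s' - \<epsilon> k * x k\<bar> \<le> \<epsilon> k * K k" "\<bar>s - s'\<bar> \<le> \<epsilon> k"
        then have "s \<in> {y - t - 2..y + t + 2}" "s' \<in> {y - t - 2..y + t + 2}" "dist s' s < \<delta>"
          using elim by (auto simp: dist_real_def)
        then show "\<bar>h s - h s'\<bar> \<le> \<eta>" using d(2)[of s s'] by (auto simp: dist_real_def)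
      qed
      also have "\<dots> = (\<epsilon> k * real (K k)) * \<eta>" by simp
      also have "\<dots> \<le> (t + 1) * \<eta>" using elim(3) \<eta> by (intro mult_right_mono) (auto simp: dist_real_def)
      also have "\<dots> = r / 2" using t unfolding \<eta>_def by (subst nonzero_mult_div_cancel_left[symmetric, of "t + 1"]) auto
      also have "\<dots> < r" using r by simp
      finally show ?case by simp
    qed
    then show "\<exists>no. \<forall>n\<ge>no. norm (climb (\<lambda>j. H (\<epsilon> n * of_int j)) (x n) w (K n) - hazard (\<epsilon> n * of_int (x n)) (of_int w) (\<epsilon> n * real (K n)) - 0) < r"
      by (simp add: eventually_sequentially)
  qed
  from tendsto_add[OF this hazard_tendsto[OF x K, of "of_int w"]] show ?thesis by simp
qed

text \<open>The hypotheses say that the limiting hazard crosses the level \<open>E\<close> at \<tau>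
  without being flat there. Hence the climb is eventually below \<open>E\<close> at time
  \<open>\<tau> - \<delta>\<close> and above it at \<open>\<tau> + \<delta>\<close>, which traps the
  flip in between.\<close>

lemma run_length_tendsto:
  fixes w :: int
  assumes w: "w \<in> {-1, 1}" and e: "\<And>k. 0 < \<epsilon> k" "\<epsilon> \<longlonglongrightarrow> 0"
    and x: "(\<lambda>k. \<epsilon> k * of_int (x k)) \<longlonglongrightarrow> y"
    and \<tau>: "\<tau> > 0" and less: "\<And>s. 0 \<le> s \<Longrightarrow> s < \<tau> \<Longrightarrow> hazard y (of_int w) s < E"
    and greater: "\<And>s. \<tau> < s \<Longrightarrow> E < hazard y (of_int w) s"
  shows "(\<lambda>k. \<epsilon> k * real (run_length (\<lambda>j. H (\<epsilon> k * of_int j)) (x k) w E)) \<longlonglongrightarrow> \<tau>" (is ?lim)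
    and "\<forall>\<^sub>F k in sequentially. climb (\<lambda>j. H (\<epsilon> k * of_int j)) (x k) w (run_length (\<lambda>j. H (\<epsilon> k * of_int j)) (x k) w E) < E \<and>
      E \<le> climb (\<lambda>j. H (\<epsilon> k * of_int j)) (x k) w (Suc (run_length (\<lambda>j. H (\<epsilon> k * of_int j)) (x k) w E))" (is ?ev)
proof -
  define U where "U k = (\<lambda>j::int. H (\<epsilon> k * of_int j))" for k
  define K where "K k = run_length (U k) (x k) w E" for k
  have E0: "0 < E" using less[of 0] \<tau> by simp
  have *: "\<forall>\<^sub>F k in sequentially. climb (U k) (x k) w (K k) < E \<and> E \<le> climb (U k) (x k) w (Suc (K k)) \<and>
     \<tau> - 2 * \<delta> < \<epsilon> k * real (K k) \<and> \<epsilon> k * real (K k) < \<tau> + 2 * \<delta>" if d: "0 < \<delta>" "\<delta> < \<tau>" for \<delta>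
  proof -
    define a where "a k = nat \<lfloor>(\<tau> - \<delta>) / \<epsilon> k\<rfloor>" for k
    define b where "b k = nat \<lfloor>(\<tau> + \<delta>) / \<epsilon> k\<rfloor>" for k
    have a: "(\<lambda>k. \<epsilon> k * real (a k)) \<longlonglongrightarrow> \<tau> - \<delta>" and b: "(\<lambda>k. \<epsilon> k * real (b k)) \<longlonglongrightarrow> \<tau> + \<delta>"
      unfolding a_def b_def using d by (auto intro!: nat_floor_div_tendsto e)
    have "\<forall>\<^sub>F k in sequentially. climb (U k) (x k) w (a k) < E"
      using climb_tendsto[OF w e x a] less[of "\<tau> - \<delta>"] d unfolding U_def by (intro order_tendstoD) auto
    moreover have "\<forall>\<^sub>F k in sequentially. climb (U k) (x k) w (b k) > E"
      using climb_tendsto[OF w e x b] greater[of "\<tau> + \<delta>"] d unfolding U_def by (intro order_tendstoD) auto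
    moreover have "\<forall>\<^sub>F k in sequentially. \<tau> - 2 * \<delta> < \<epsilon> k * real (a k) - \<epsilon> k"
      using d by (intro order_tendstoD[OF tendsto_diff[OF a e(2)]]) auto
    moreover have "\<forall>\<^sub>F k in sequentially. \<epsilon> k * real (b k) < \<tau> + 2 * \<delta>"
      using d by (intro order_tendstoD[OF b]) auto
    ultimately show ?thesis
    proof eventually_elim
      case (elim k)
      \<comment> \<open>The climb over no steps is 0, below \<open>E\<close>; writing
        \<open>b k\<close> as a successor provides a witness for the \<open>LEAST\<close> in
        \<open>run_length\<close>.\<close>
      have "b k \<noteq> 0" using elim(2) E0 by (intro notI) simp
      then obtain b' where b': "b k = Suc b'" using not0_implies_Suc by blast
      have ge: "E \<le> climb (U k) (x k) w (Suc (K k))" unfolding K_def run_length_def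
        by (rule LeastI[of _ b']) (use elim(2) b' in simp)
      have "K k \<le> b'" unfolding K_def run_length_def
        by (rule Least_le) (use elim(2) b' in simp)
      have lt: "climb (U k) (x k) w (K k) < E"
      proof (cases "K k")
        case (Suc j)
        then have "\<not> E \<le> climb (U k) (x k) w (Suc j)" unfolding K_def run_length_def
          by (intro not_less_Least) simp
        then show ?thesis using Suc by simp
      qed (simp add: E0)
      have "a k < Suc (K k)"
        using climb_mono[of "Suc (K k)" "a k" "U k" "x k" w] elim(1) ge by (meson linorder_not_le order.strict_trans2 not_less)
      then have "\<epsilon> k * real (a k) \<le> \<epsilon> k * real (K k)" using e(1)[of k] by (intro mult_left_mono) auto
      moreover have "\<epsilon> k * real (K k) \<le> \<epsilon> k * real (b k)" using e(1)[of k] \<open>K k \<le> b'\<close> b' by (intro mult_left_mono) auto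
      ultimately show ?case using elim ge lt e(1)[of k] by linarith
    qed
  qed
  show ?ev using *[of "\<tau> / 2"] \<tau> unfolding U_def K_def by (auto elim: eventually_mono)
  have "(\<lambda>k. \<epsilon> k * real (K k)) \<longlonglongrightarrow> \<tau>"
  proof (rule LIMSEQ_I)
    fix r :: real assume r: "r > 0"
    define \<delta> where "\<delta> = min (r / 2) (\<tau> / 2)"
    have "0 < \<delta>" "\<delta> < \<tau>" "2 * \<delta> \<le> r" using r \<tau> by (auto simp: \<delta>_def)
    from *[OF this(1,2)] have "\<forall>\<^sub>F k in sequentially. norm (\<epsilon> k * real (K k) - \<tau>) < r"
      by eventually_elim (use \<open>2 * \<delta> \<le> r\<close> in auto)
    then show "\<exists>no. \<forall>n\<ge>no. norm (\<epsilon> n * real (K n) - \<tau>) < r" by (simp add: eventually_sequentially)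
  qed
  then show ?lim unfolding K_def U_def .
qed

text \<open>The deterministic core. Start times and positions of the runs converge by induction, one
  run after the other. The time change sends each jump time to the matching start of a run, so the
  velocities agree exactly and only a small position error remains.\<close>

lemma driven_walk_skorohod_conv:
  fixes v0 :: int and y \<tau> E S :: "nat \<Rightarrow> real" and x :: "nat \<Rightarrow> int" and Z :: "real \<Rightarrow> real \<times> real"
  assumes v0: "v0 \<in> {-1, 1}" and e: "\<And>k. 0 < \<epsilon> k" "\<epsilon> \<longlonglongrightarrow> 0"
    and x: "(\<lambda>k. \<epsilon> k * of_int (x k)) \<longlonglongrightarrow> y 0"
    and y_Suc: "\<And>i. y (Suc i) = y i + of_int (v0 * (-1) ^ i) * \<tau> i"
    and \<tau>: "\<And>i. 0 < \<tau> i"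
    and less: "\<And>i s. 0 \<le> s \<Longrightarrow> s < \<tau> i \<Longrightarrow> hazard (y i) (of_int (v0 * (-1) ^ i)) s < E i"
    and greater: "\<And>i s. \<tau> i < s \<Longrightarrow> E i < hazard (y i) (of_int (v0 * (-1) ^ i)) s"
    and S_0: "S 0 = 0" and S_Suc: "\<And>i. S (Suc i) = S i + \<tau> i" and S_unbounded: "\<And>T. \<exists>n. T < S n"
    and Z: "\<And>i t. S i \<le> t \<Longrightarrow> t < S (Suc i) \<Longrightarrow>
      Z t = (y i + of_int (v0 * (-1) ^ i) * (t - S i), of_int (v0 * (-1) ^ i))"
  shows "skorohod_conv (\<lambda>k. step_path (\<epsilon> k) (\<lambda>m.
      case fst (driven_walk (\<lambda>j. H (\<epsilon> k * of_int j)) E (x k, v0) m) of (a, b) \<Rightarrow> (\<epsilon> k * real_of_int a, real_of_int b))) Z"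
proof -
  define w where "w i = v0 * (-1) ^ i" for i :: nat
  have w: "w i \<in> {-1, 1}" for i using v0 by (cases "even i") (auto simp: w_def)
  have w_Suc: "w (Suc i) = - w i" for i by (simp add: w_def)
  define U where "U k = (\<lambda>j::int. H (\<epsilon> k * of_int j))" for k
  define D where "D k = driven_walk (U k) E (x k, v0)" for k
  define J where "J i k = fst (run_start (U k) E (x k) v0 i)" for i k
  define X where "X i k = snd (run_start (U k) E (x k) v0 i)" for i k
  define K where "K i k = run_length (U k) (X i k) (w i) (E i)" for i k
  have J_Suc: "J (Suc i) k = Suc (J i k + K i k)" and X_Suc: "X (Suc i) k = X i k + int (K i k) * w i" for i k
    by (simp_all add: J_def X_def K_def w_def Let_def split: prod.split)
  note y_Suc = y_Suc[folded w_def] and less = less[folded w_def] and greater = greater[folded w_def] and Z = Z[folded w_def]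
  have lim: "(\<lambda>k. \<epsilon> k * real (J i k)) \<longlonglongrightarrow> S i \<and> (\<lambda>k. \<epsilon> k * of_int (X i k)) \<longlonglongrightarrow> y i" for i
  proof (induction i)
    case 0
    then show ?case using x S_0 by (simp add: J_def X_def)
  next
    case (Suc i)
    have K: "(\<lambda>k. \<epsilon> k * real (K i k)) \<longlonglongrightarrow> \<tau> i" using Suc.IH unfolding K_def U_def
      by (intro run_length_tendsto(1)[OF w e _ \<tau> less greater]) auto
    \<comment> \<open>The last summand is the time taken by the flip, which disappears in the
      limit.\<close>
    have "(\<lambda>k. \<epsilon> k * real (J i k) + \<epsilon> k * real (K i k) + \<epsilon> k) \<longlonglongrightarrow> S i + \<tau> i + 0"
      using Suc.IH K e(2) by (intro tendsto_intros) auto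
    moreover have "(\<lambda>k. \<epsilon> k * of_int (X i k) + of_int (w i) * (\<epsilon> k * real (K i k))) \<longlonglongrightarrow> y i + of_int (w i) * \<tau> i"
      using Suc.IH K by (intro tendsto_intros) auto
    ultimately show ?case by (simp add: J_Suc X_Suc S_Suc y_Suc algebra_simps)
  qed
  have K_ev: "\<forall>\<^sub>F k in sequentially. climb (U k) (X i k) (w i) (K i k) < E i \<and> E i \<le> climb (U k) (X i k) (w i) (Suc (K i k))" for i
    using lim[of i] unfolding K_def U_def
    by (intro run_length_tendsto(2)[OF w e _ \<tau> less greater]) auto
  have start: "\<forall>\<^sub>F k in sequentially. D k (J i k) = ((X i k, w i), i, E i)" for i
  proof (induction i)
    case 0
    show ?case by (simp add: D_def J_def X_def w_def)
  next
    case (Suc i)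
    from Suc K_ev[of i] show ?case
    proof eventually_elim
      case (elim k)
      show ?case unfolding D_def J_Suc X_Suc w_Suc
        using elim by (intro driven_walk_flip) (simp_all add: D_def)
    qed
  qed
  have run: "\<forall>\<^sub>F k in sequentially. \<forall>j\<le>K i k. fst (D k (J i k + j)) = (X i k + int j * w i, w i)" for i
    using start[of i] K_ev[of i]
  proof eventually_elim
    case (elim k)
    show ?case
    proof (intro allI impI)
      fix j assume "j \<le> K i k"
      then have "climb (U k) (X i k) (w i) j < E i" using climb_mono[of j "K i k"] elim(2) by (metis order.strict_trans1)
      then show "fst (D k (J i k + j)) = (X i k + int j * w i, w i)"
        using driven_walk_run[OF elim(1)[unfolded D_def]] by (simp add: D_def)
    qed
  qed
  have "skorohod_conv (\<lambda>k. step_path (\<epsilon> k) (\<lambda>m. case fst (D k m) of (a, b) \<Rightarrow> (\<epsilon> k * of_int a, real_of_int b))) Z"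
  proof (rule skorohod_convI)
    fix T \<eta> :: real assume T: "T > 0" and \<eta>: "\<eta> > 0"
    obtain n where n: "T < S n" using S_unbounded by blast
    \<comment> \<open>One \<delta> pays for the starting position of the run; the elapsed time costs
      three more, for the rounding to the grid, the deviation of \<gamma>, and the shift of the
      start of the run.\<close>
    define \<delta> where "\<delta> = \<eta> / 4"
    have \<delta>: "\<delta> > 0" using \<eta> by (simp add: \<delta>_def)
    have "\<forall>\<^sub>F k in sequentially. \<epsilon> k < \<delta>" using e(2) \<delta> by (rule order_tendstoD)
    moreover have "\<forall>\<^sub>F k in sequentially. \<forall>i\<in>{..n}. dist (\<epsilon> k * real (J i k)) (S i) < \<delta>"
      using lim \<delta> by (intro eventually_ball_finite ballI tendstoD) auto
    moreover have "\<forall>\<^sub>F k in sequentially. \<forall>i\<in>{..n}. dist (\<epsilon> k * of_int (X i k)) (y i) < \<delta>"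
      using lim \<delta> by (intro eventually_ball_finite ballI tendstoD) auto
    moreover have "\<forall>\<^sub>F k in sequentially. \<forall>i\<in>{..n}. \<forall>j\<le>K i k. fst (D k (J i k + j)) = (X i k + int j * w i, w i)"
      using run by (intro eventually_ball_finite ballI) auto
    ultimately show "\<forall>\<^sub>F k in sequentially. \<exists>\<gamma>. time_change \<gamma> \<and>
      (\<forall>t\<in>{0..T}. dist (step_path (\<epsilon> k) (\<lambda>m. case fst (D k m) of (a, b) \<Rightarrow> (\<epsilon> k * of_int a, real_of_int b)) (\<gamma> t)) (Z t) \<le> \<eta> \<and>
         \<bar>\<gamma> t - t\<bar> \<le> \<eta>)"
    proof eventually_elim
      case (elim k)
      define r where "r i = \<epsilon> k * real (J i k)" for i
      have ek: "\<epsilon> k > 0" by (rule e)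
      have r_less: "r i < r (Suc i)" for i using ek by (simp add: r_def J_Suc)
      have rS: "i \<le> n \<Longrightarrow> \<bar>r i - S i\<bar> \<le> \<delta>" for i using elim(2) by (auto simp: r_def dist_real_def intro: less_imp_le)
      have S_less: "S i < S (Suc i)" for i using \<tau>[of i] by (simp add: S_Suc)
      have r0: "r 0 = 0" by (simp add: r_def J_def)
      obtain \<gamma> where g: "time_change \<gamma>" "\<And>i. i \<le> n \<Longrightarrow> \<gamma> (S i) = r i" "\<And>t. t \<ge> 0 \<Longrightarrow> \<bar>\<gamma> t - t\<bar> \<le> \<delta>"
        using time_change_interpolation[of S r n \<delta>, OF S_0 r0 S_less r_less rS] by blast
      have S_ge: "0 \<le> S i" for i using lift_Suc_mono_le[of S 0 i] S_less S_0 by (simp add: less_imp_le)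
      have "dist (step_path (\<epsilon> k) (\<lambda>m. case fst (D k m) of (a, b) \<Rightarrow> (\<epsilon> k * of_int a, real_of_int b)) (\<gamma> t)) (Z t) \<le> \<eta>"
        if t: "t \<in> {0..T}" for t
      proof -
        obtain i where i: "i < n" "S i \<le> t" "t < S (Suc i)"
          using partition_interval[of S t n] t n S_0 by auto
        have "r i \<le> \<gamma> t" using time_change_less[OF g(1), of "S i" t] S_ge[of i] i g(2)[of i]
          by (cases "S i = t") auto
        moreover have "\<gamma> t < r (Suc i)" using time_change_less[OF g(1), of t "S (Suc i)"] t i g(2)[of "Suc i"] by auto
        moreover define m where "m = nat \<lfloor>\<gamma> t / \<epsilon> k\<rfloor>"
        have gt: "\<gamma> t \<ge> 0" using time_change_nonneg[OF g(1)] t by auto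
        note m = nat_floor_div_bounds[OF gt ek, folded m_def]
        ultimately have "\<epsilon> k * real (J i k) < \<epsilon> k * real (Suc m)" "\<epsilon> k * real m < \<epsilon> k * real (J (Suc i) k)"
          unfolding r_def of_nat_Suc distrib_left by linarith+
        then have "J i k < Suc m" "m < J (Suc i) k"
          unfolding mult_less_cancel_left_pos[OF ek] of_nat_less_iff .
        \<comment> \<open>Run i occupies the indices from \<open>J i k\<close> to
          \<open>J i k + K i k\<close>; the next index, at which the velocity is already reversed,
          belongs to run \<open>Suc i\<close>.\<close>
        then obtain j where j: "m = J i k + j" "j \<le> K i k"
          by (intro that[of "m - J i k"]) (auto simp: J_Suc)
        have D: "fst (D k m) = (X i k + int j * w i, w i)" using elim(4) i j by simp
        have "step_path (\<epsilon> k) (\<lambda>m. case fst (D k m) of (a, b) \<Rightarrow> (\<epsilon> k * of_int a, real_of_int b)) (\<gamma> t)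
          = (\<epsilon> k * of_int (X i k + int j * w i), of_int (w i))"
          using gt by (simp add: step_path_def m_def[symmetric] D)
        then have "dist (step_path (\<epsilon> k) (\<lambda>m. case fst (D k m) of (a, b) \<Rightarrow> (\<epsilon> k * of_int a, real_of_int b)) (\<gamma> t)) (Z t)
          = \<bar>\<epsilon> k * of_int (X i k + int j * w i) - (y i + of_int (w i) * (t - S i))\<bar>"
          by (simp add: Z[OF i(2,3)] dist_Pair_Pair dist_real_def)
        also have "\<dots> = \<bar>(\<epsilon> k * of_int (X i k) - y i) + of_int (w i) * (\<epsilon> k * real j - (t - S i))\<bar>"
          by (simp add: algebra_simps)
        also have "\<dots> \<le> \<bar>\<epsilon> k * of_int (X i k) - y i\<bar> + \<bar>\<epsilon> k * real j - (t - S i)\<bar>"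
          using w[of i] by (intro order_trans[OF abs_triangle_ineq]) (auto simp: abs_mult)
        also have "\<bar>\<epsilon> k * of_int (X i k) - y i\<bar> \<le> \<delta>" using elim(3) i by (auto simp: dist_real_def intro: less_imp_le)
        also have "\<bar>\<epsilon> k * real j - (t - S i)\<bar> \<le> 3 * \<delta>"
        proof -
          have "\<epsilon> k * real m = r i + \<epsilon> k * real j" by (simp add: j r_def algebra_simps)
          then show ?thesis using m g(3)[of t] t rS[of i] i elim(1) by auto
        qed
        finally show ?thesis by (simp add: \<delta>_def)
      qed
      moreover have "\<bar>\<gamma> t - t\<bar> \<le> \<eta>" if "t \<in> {0..T}" for t using g(3)[of t] that \<eta> by (simp add: \<delta>_def)
      ultimately show ?case using g(1) by blast
    qed
  qed
  then show ?thesis by (simp add: D_def U_def)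
qed

end

section \<open>Markov chains and exponential clocks\<close>

lemma markov_chain_prob_0:
  assumes Z: "markov_chain M K s Z"
  shows "measure M {\<omega> \<in> space M. Z 0 \<omega> = z} = (if z = s then 1 else 0)"
proof -
  interpret prob_space M using Z by (simp add: markov_chain_def)
  have m: "Z 0 \<in> measurable M (count_space UNIV)" "AE \<omega> in M. Z 0 \<omega> = s"
    using Z by (auto simp: markov_chain_def)
  have "{\<omega> \<in> space M. Z 0 \<omega> = z} \<in> events" using m(1) by measurable
  moreover have "AE \<omega> in M. (\<omega> \<in> {\<omega> \<in> space M. Z 0 \<omega> = z}) = (\<omega> \<in> (if z = s then space M else {}))"
    using m(2) AE_space by eventually_elim auto
  ultimately have "measure M {\<omega> \<in> space M. Z 0 \<omega> = z} = measure M (if z = s then space M else {})"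
    by (intro measure_eq_AE) auto
  then show ?thesis by (simp add: prob_space)
qed

lemma markov_chain_prob_eq:
  assumes M: "markov_chain M K s Z" and N: "markov_chain N K s Z'"
  shows "measure M {\<omega> \<in> space M. \<forall>i\<le>n. Z i \<omega> = z i} = measure N {\<omega> \<in> space N. \<forall>i\<le>n. Z' i \<omega> = z i}"
proof (induction n)
  case 0
  show ?case using markov_chain_prob_0[OF M, of "z 0"] markov_chain_prob_0[OF N, of "z 0"] by simp
next
  case (Suc n)
  then show ?case using M N by (simp add: markov_chain_def)
qed

lemma map_upt_eq_iff:
  "map f [0..<Suc m] = xs \<longleftrightarrow> length xs = Suc m \<and> (\<forall>i\<le>m. f i = xs ! i)"
proof -
  have "map f [0..<Suc m] = xs \<longleftrightarrow> length xs = Suc m \<and> (\<forall>i<Suc m. f i = xs ! i)"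
    unfolding list_eq_iff_nth_eq by (simp del: upt_Suc) metis
  then show ?thesis by (simp only: less_Suc_eq_le)
qed

lemma markov_chain_list_measurable:
  fixes Z :: "nat \<Rightarrow> 'b \<Rightarrow> 's::countable"
  assumes "markov_chain M K s Z"
  shows "(\<lambda>\<omega>. map (\<lambda>i. Z i \<omega>) [0..<Suc m]) \<in> measurable M (count_space UNIV)"
proof (subst measurable_count_space_eq2_countable)
  have [measurable]: "Z i \<in> measurable M (count_space UNIV)" for i
    using assms by (auto simp: markov_chain_def)
  have "(\<lambda>\<omega>. map (\<lambda>i. Z i \<omega>) [0..<Suc m]) -` {xs} \<inter> space M =
      {\<omega> \<in> space M. length xs = Suc m \<and> (\<forall>i\<le>m. Z i \<omega> = xs ! i)}" for xs
    by (auto simp: map_upt_eq_iff simp del: upt_Suc)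
  then show "(\<lambda>\<omega>. map (\<lambda>i. Z i \<omega>) [0..<Suc m]) \<in> space M \<rightarrow> UNIV \<and>
    (\<forall>xs\<in>UNIV. (\<lambda>\<omega>. map (\<lambda>i. Z i \<omega>) [0..<Suc m]) -` {xs} \<inter> space M \<in> sets M)"
    by simp
qed

text \<open>Frozen after time m, the chain is a function of the list of its first
  \<open>Suc m\<close> states. Lists of states form a countable type, so point masses determine the
  law and g may be any function.\<close>

lemma markov_chain_frozen_integral_eq:
  fixes g :: "(nat \<Rightarrow> 's::countable) \<Rightarrow> real"
  assumes M: "markov_chain M K s Z" and N: "markov_chain N K s Z'"
  shows "(\<integral>\<omega>. g (\<lambda>i. Z (min i m) \<omega>) \<partial>M) = (\<integral>\<omega>. g (\<lambda>i. Z' (min i m) \<omega>) \<partial>N)"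
proof -
  define L where "L \<omega> = map (\<lambda>i. Z i \<omega>) [0..<Suc m]" for \<omega>
  define L' where "L' \<omega> = map (\<lambda>i. Z' i \<omega>) [0..<Suc m]" for \<omega>
  interpret M: prob_space M using M by (simp add: markov_chain_def)
  interpret N: prob_space N using N by (simp add: markov_chain_def)
  have mM: "L \<in> measurable M (count_space UNIV)" unfolding L_def by (rule markov_chain_list_measurable[OF M])
  have mN: "L' \<in> measurable N (count_space UNIV)" unfolding L'_def by (rule markov_chain_list_measurable[OF N])
  have "distr M (count_space UNIV) L = distr N (count_space UNIV) L'"
  proof (rule measure_eqI_countable[of _ UNIV])
    fix xs :: "'s list"
    have "L -` {xs} \<inter> space M = (if length xs = Suc m then {\<omega> \<in> space M. \<forall>i\<le>m. Z i \<omega> = xs ! i} else {})"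
      "L' -` {xs} \<inter> space N = (if length xs = Suc m then {\<omega> \<in> space N. \<forall>i\<le>m. Z' i \<omega> = xs ! i} else {})"
      by (auto simp: L_def L'_def map_upt_eq_iff simp del: upt_Suc)
    then have "measure M (L -` {xs} \<inter> space M) = measure N (L' -` {xs} \<inter> space N)"
      using markov_chain_prob_eq[OF M N, of m "\<lambda>i. xs ! i"] by (simp only:) simp
    then show "emeasure (distr M (count_space UNIV) L) {xs} = emeasure (distr N (count_space UNIV) L') {xs}"
      by (simp add: emeasure_distr[OF mM] emeasure_distr[OF mN] M.emeasure_eq_measure N.emeasure_eq_measure)
  qed auto
  then have "(\<integral>xs. g (\<lambda>i. xs ! min i m) \<partial>distr M (count_space UNIV) L) = (\<integral>xs. g (\<lambda>i. xs ! min i m) \<partial>distr N (count_space UNIV) L')"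
    by simp
  then have "(\<integral>\<omega>. g (\<lambda>i. L \<omega> ! min i m) \<partial>M) = (\<integral>\<omega>. g (\<lambda>i. L' \<omega> ! min i m) \<partial>N)"
    by (simp add: integral_distr[OF mM] integral_distr[OF mN])
  moreover have "(\<lambda>i. L \<omega> ! min i m) = (\<lambda>i. Z (min i m) \<omega>)" for \<omega>
    by (simp add: L_def less_Suc_eq_le del: upt_Suc)
  moreover have "(\<lambda>i. L' \<omega> ! min i m) = (\<lambda>i. Z' (min i m) \<omega>)" for \<omega>
    by (simp add: L'_def less_Suc_eq_le del: upt_Suc)
  ultimately show ?thesis by simp
qed

lemma bounded_skorohod_functionalE:
  assumes "bounded (f ` topspace skorohod_topology)"
  obtains B :: real where "\<And>x. x \<in> cadlag_paths \<Longrightarrow> \<bar>f x\<bar> \<le> B"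
proof -
  obtain B where "\<And>x. x \<in> cadlag_paths \<Longrightarrow> \<bar>f x\<bar> \<le> B"
    using assms by (auto simp: bounded_iff topspace_skorohod_topology)
  then show thesis by (rule that)
qed

lemma step_path_frozen_integral_tendsto:
  fixes v :: "nat \<Rightarrow> 'b \<Rightarrow> 'a::{metric_space, second_countable_topology}"
  assumes M: "prob_space M" and v [measurable]: "\<And>i. v i \<in> borel_measurable M"
    and f: "continuous_map skorohod_topology euclideanreal f" "bounded (f ` topspace skorohod_topology)"
    and e: "0 < \<epsilon>"
  shows "(\<lambda>m. \<integral>\<omega>. f (step_path \<epsilon> (\<lambda>i. v (min i m) \<omega>)) \<partial>M) \<longlonglongrightarrow> (\<integral>\<omega>. f (step_path \<epsilon> (\<lambda>i. v i \<omega>)) \<partial>M)"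
proof -
  interpret prob_space M by (rule M)
  obtain B where B: "\<And>x. x \<in> cadlag_paths \<Longrightarrow> \<bar>f x\<bar> \<le> B" using bounded_skorohod_functionalE[OF f(2)] by blast
  note measurable_f = step_path_functional_measurable[OF f(1) e]
  have bound: "norm (f (step_path \<epsilon> u)) \<le> B" for u using B[OF step_path_cadlag[OF e]] by simp
  show ?thesis
  proof (rule integral_dominated_convergence[where w = "\<lambda>_. B"])
    show "(\<lambda>\<omega>. f (step_path \<epsilon> (\<lambda>i. v i \<omega>))) \<in> borel_measurable M"
      by (rule measurable_f) (rule v)
    show "(\<lambda>\<omega>. f (step_path \<epsilon> (\<lambda>i. v (min i m) \<omega>))) \<in> borel_measurable M" for m
      by (rule measurable_f) (rule v)
    show "AE \<omega> in M. norm (f (step_path \<epsilon> (\<lambda>i. v (min i m) \<omega>))) \<le> B" for m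
      by (intro AE_I2 bound)
    show "AE \<omega> in M. (\<lambda>m. f (step_path \<epsilon> (\<lambda>i. v (min i m) \<omega>))) \<longlonglongrightarrow> f (step_path \<epsilon> (\<lambda>i. v i \<omega>))"
    proof (intro AE_I2 step_path_functional_tendsto[OF f(1) e])
      fix \<omega> i
      show "(\<lambda>m. v (min i m) \<omega>) \<longlonglongrightarrow> v i \<omega>"
        by (rule tendsto_eventually) (auto intro!: eventually_sequentiallyI[of i] simp: min_absorb1)
    qed
  qed simp
qed

lemma markov_chain_step_path_integral_eq:
  fixes \<phi> :: "'s::countable \<Rightarrow> 'a::{metric_space, second_countable_topology}"
  assumes M: "markov_chain M K s Z" and N: "markov_chain N K s Z'"
    and f: "continuous_map skorohod_topology euclideanreal f" "bounded (f ` topspace skorohod_topology)"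
    and e: "0 < \<epsilon>"
  shows "(\<integral>\<omega>. f (step_path \<epsilon> (\<lambda>i. \<phi> (Z i \<omega>))) \<partial>M) = (\<integral>\<omega>. f (step_path \<epsilon> (\<lambda>i. \<phi> (Z' i \<omega>))) \<partial>N)"
proof -
  have [measurable]: "Z i \<in> measurable M (count_space UNIV)" "Z' i \<in> measurable N (count_space UNIV)" for i
    using M N by (auto simp: markov_chain_def)
  have "(\<lambda>m. \<integral>\<omega>. f (step_path \<epsilon> (\<lambda>i. \<phi> (Z (min i m) \<omega>))) \<partial>M) \<longlonglongrightarrow> (\<integral>\<omega>. f (step_path \<epsilon> (\<lambda>i. \<phi> (Z i \<omega>))) \<partial>M)"
    using M by (intro step_path_frozen_integral_tendsto f e) (auto simp: markov_chain_def)
  moreover have "(\<lambda>m. \<integral>\<omega>. f (step_path \<epsilon> (\<lambda>i. \<phi> (Z' (min i m) \<omega>))) \<partial>N) \<longlonglongrightarrow> (\<integral>\<omega>. f (step_path \<epsilon> (\<lambda>i. \<phi> (Z' i \<omega>))) \<partial>N)"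
    using N by (intro step_path_frozen_integral_tendsto f e) (auto simp: markov_chain_def)
  moreover have "(\<integral>\<omega>. f (step_path \<epsilon> (\<lambda>i. \<phi> (Z (min i m) \<omega>))) \<partial>M) = (\<integral>\<omega>. f (step_path \<epsilon> (\<lambda>i. \<phi> (Z' (min i m) \<omega>))) \<partial>N)" for m
    using markov_chain_frozen_integral_eq[OF M N, of "\<lambda>u. f (step_path \<epsilon> (\<lambda>i. \<phi> (u i)))"] by simp
  ultimately show ?thesis using LIMSEQ_unique by simp
qed

section \<open>Exponential clocks drive a Zig-Zag walk\<close>

lemma pmf_zigzag_kernel:
  assumes "v \<noteq> 0"
  shows "pmf (zigzag_kernel U (x, v)) s =
    (let p = exp (- max (U (x + v) - U x) 0) in if s = (x + v, v) then p else if s = (x, - v) then 1 - p else 0)"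
proof -
  define g where "g = (\<lambda>b. if b then (x + v, v) else (x, - v))"
  define p where "p = exp (- max (U (x + v) - U x) 0)"
  have p: "min (exp (U x - U (x + v))) 1 = p" by (auto simp: p_def min_def max_def)
  have p01: "0 \<le> p" "p \<le> 1" by (auto simp: p_def)
  have g: "inj g" using assms by (auto simp: g_def inj_def)
  have k: "zigzag_kernel U (x, v) = map_pmf g (bernoulli_pmf p)" by (simp add: zigzag_kernel_def g_def p)
  consider "s = g True" | "s = g False" | "s \<notin> range g" by (auto simp: g_def image_iff split: if_splits)
  then show ?thesis
  proof cases
    case 1
    then show ?thesis using pmf_map_inj'[OF g, of "bernoulli_pmf p" True] p01 by (simp add: k g_def p_def)
  next
    case 2
    then show ?thesis using pmf_map_inj'[OF g, of "bernoulli_pmf p" False] p01 assms by (simp add: k g_def p_def)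
  next
    case 3
    then have "pmf (map_pmf g (bernoulli_pmf p)) s = 0" by (intro pmf_map_outside) auto
    moreover have "s \<noteq> (x + v, v)" "s \<noteq> (x, - v)" using 3 by (auto simp: g_def image_iff)
    ultimately show ?thesis by (simp add: k)
  qed
qed

text \<open>\<open>E_law\<close> states at once that clock n is standard exponential and independent
  of the past \<open>F n\<close>. Since the clocks before n are measurable for \<open>F n\<close>,
  this is the independence of the whole sequence.\<close>

locale exponential_clocks = prob_space N for N :: "'b measure" +
  fixes F :: "nat \<Rightarrow> 'b measure" and E :: "nat \<Rightarrow> 'b \<Rightarrow> real"
  assumes subalgebra_F: "subalgebra N (F n)"
    and F_mono: "sets (F n) \<subseteq> sets (F (Suc n))"
    and E_measurable: "E n \<in> borel_measurable (F (Suc n))"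
    and E_pos: "\<omega> \<in> space N \<Longrightarrow> 0 < E n \<omega>"
    and E_law: "A \<in> sets (F n) \<Longrightarrow> 0 \<le> c \<Longrightarrow> prob (A \<inter> {\<omega> \<in> space N. c < E n \<omega>}) = exp (- c) * prob A"
begin

lemma space_F [simp]: "space (F n) = space N"
  using subalgebra_F by (simp add: subalgebra_def)

lemma sets_F: "A \<in> sets (F n) \<Longrightarrow> A \<in> events"
  using subalgebra_F by (auto simp: subalgebra_def)

lemma E_measurable_N [measurable]: "E n \<in> borel_measurable N"
  using measurable_from_subalg[OF subalgebra_F E_measurable] .

lemma E_sets_F: "{\<omega> \<in> space N. c < E n \<omega> \<and> E n \<omega> \<le> d} \<in> sets (F (Suc n))"
proof -
  have "{\<omega> \<in> space (F (Suc n)). c < E n \<omega> \<and> E n \<omega> \<le> d} \<in> sets (F (Suc n))"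
    using E_measurable[of n] by measurable
  then show ?thesis by simp
qed

lemma E_law_interval:
  assumes A: "A \<in> sets (F n)" and "0 \<le> c" "c \<le> d"
  shows "prob (A \<inter> {\<omega> \<in> space N. c < E n \<omega> \<and> E n \<omega> \<le> d}) = (exp (- c) - exp (- d)) * prob A"
proof -
  have m: "A \<inter> {\<omega> \<in> space N. x < E n \<omega>} \<in> events" for x
    using sets_F[OF A] by measurable
  have eq: "A \<inter> {\<omega> \<in> space N. c < E n \<omega> \<and> E n \<omega> \<le> d} =
      A \<inter> {\<omega> \<in> space N. c < E n \<omega>} - A \<inter> {\<omega> \<in> space N. d < E n \<omega>}"
    by auto
  have "A \<inter> {\<omega> \<in> space N. d < E n \<omega>} \<subseteq> A \<inter> {\<omega> \<in> space N. c < E n \<omega>}"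
    using \<open>c \<le> d\<close> by auto
  from finite_measure_Diff[OF m m this] show ?thesis
    using E_law[OF A, of c] E_law[OF A, of d] assms(2,3) unfolding eq by (simp add: left_diff_distrib)
qed

text \<open>By independence m consecutive clocks are all at most 1 with probability
  \<open>(1 - exp (- 1)) ^ m\<close>, which tends to 0. The fact is used to rule out
  explosion.\<close>

lemma AE_infinitely_often_gt_1: "AE \<omega> in N. \<forall>n. \<exists>i\<ge>n. 1 < E i \<omega>"
proof -
  define B where "B n m = {\<omega> \<in> space N. \<forall>i<m. E (n + i) \<omega> \<le> 1}" for n m
  have B: "B n m \<in> sets (F (n + m)) \<and> prob (B n m) = (1 - exp (- 1)) ^ m" for n m
  proof (induction m)
    case 0
    have "B n 0 = space (F n)" by (simp add: B_def)
    then show ?case using sets.top[of "F n"] by (simp add: prob_space)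
  next
    case (Suc m)
    have "B n (Suc m) = B n m \<inter> {\<omega> \<in> space N. 0 < E (n + m) \<omega> \<and> E (n + m) \<omega> \<le> 1}"
      using E_pos by (auto simp: B_def less_Suc_eq)
    moreover have "B n m \<in> sets (F (Suc (n + m)))" using Suc F_mono by blast
    ultimately show ?case using Suc E_law_interval[of "B n m" "n + m" 0 1] E_sets_F[of 0 "n + m" 1] by auto
  qed
  have "AE \<omega> in N. \<exists>i\<ge>n. 1 < E i \<omega>" for n
  proof -
    define C where "C = {\<omega> \<in> space N. \<forall>i\<ge>n. E i \<omega> \<le> 1}"
    have C: "C \<in> events" unfolding C_def by measurable
    have le: "prob C \<le> (1 - exp (- 1)) ^ m" for m
    proof -
      have "B n m \<in> events" using sets_F B by blast
      moreover have "C \<subseteq> B n m" unfolding C_def B_def by auto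
      ultimately have "prob C \<le> prob (B n m)" by (intro finite_measure_mono)
      then show ?thesis using B[of n m] by simp
    qed
    have "(\<lambda>m. (1 - exp (- 1 :: real)) ^ m) \<longlonglongrightarrow> 0" by (rule LIMSEQ_realpow_zero) auto
    then have "prob C \<le> 0" by (rule tendsto_lowerbound) (use le in auto)
    then have "emeasure N C = 0" using measure_nonneg[of N C] by (simp add: emeasure_eq_measure)
    then have "AE \<omega> in N. \<omega> \<notin> C" using C by (intro AE_not_in) (auto simp: null_sets_def)
    then show ?thesis using AE_space by eventually_elim (auto simp: C_def not_le)
  qed
  then show ?thesis by (simp add: AE_all_countable)
qed

context
  fixes U :: "int \<Rightarrow> real" and x0 v0 :: int
  assumes v0: "v0 \<in> {-1, 1}"
begin

abbreviation D :: "nat \<Rightarrow> 'b \<Rightarrow> (int \<times> int) \<times> nat \<times> real" where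
  "D m \<omega> \<equiv> driven_walk U (\<lambda>n. E n \<omega>) (x0, v0) m"

definition trajectory :: "(nat \<Rightarrow> int \<times> int) \<Rightarrow> nat \<Rightarrow> 'b set" where
  "trajectory z m = {\<omega> \<in> space N. \<forall>i\<le>m. fst (D i \<omega>) = z i}"

text \<open>Given the past \<open>A\<close> of the first \<open>n\<close> clocks, following the trajectory \<open>z\<close> up to time \<open>m\<close> means
  that the current clock exceeds the total increase \<open>c\<close> of \<open>U\<close> since the last flip.\<close>

definition explained :: "(nat \<Rightarrow> int \<times> int) \<Rightarrow> nat \<Rightarrow> nat \<Rightarrow> 'b set \<Rightarrow> real \<Rightarrow> bool" where
  "explained z m n A c \<longleftrightarrow> A \<in> sets (F n) \<and> 0 \<le> c \<and> snd (z m) \<in> {-1, 1} \<and>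
     trajectory z m = A \<inter> {\<omega> \<in> space N. c < E n \<omega>} \<and> (\<forall>\<omega>\<in>trajectory z m. D m \<omega> = (z m, n, E n \<omega> - c))"

lemma trajectory_Suc: "trajectory z (Suc m) = {\<omega> \<in> trajectory z m. fst (D (Suc m) \<omega>) = z (Suc m)}"
proof -
  have "(\<forall>i\<le>Suc m. P i) \<longleftrightarrow> (\<forall>i\<le>m. P i) \<and> P (Suc m)" for P by (auto simp: le_Suc_eq)
  then show ?thesis unfolding trajectory_def by simp
qed

text \<open>An explained trajectory has probability \<open>exp (- c) * prob A\<close>. A move adds
  the increase d to c and keeps \<open>A\<close>, which multiplies the probability by
  \<open>exp (- d)\<close>: this is the lack of memory. A flip means that clock n lies between c and
  \<open>c + d\<close>, which costs the factor \<open>1 - exp (- d)\<close>; this event joins the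
  past and a fresh clock starts with \<open>c = 0\<close>.\<close>

lemma explained_step:
  assumes ex: "explained z m n A c"
  shows "trajectory z (Suc m) = {} \<or> (\<exists>n A c. explained z (Suc m) n A c)"
    and "prob (trajectory z (Suc m)) = prob (trajectory z m) * pmf (zigzag_kernel U (z m)) (z (Suc m))"
proof -
  obtain x v where z: "z m = (x, v)" by (cases "z m")
  have A: "A \<in> sets (F n)" and c: "0 \<le> c" and v: "v \<in> {-1, 1}"
    and tr: "trajectory z m = A \<inter> {\<omega> \<in> space N. c < E n \<omega>}"
    and D: "\<And>\<omega>. \<omega> \<in> trajectory z m \<Longrightarrow> D m \<omega> = ((x, v), n, E n \<omega> - c)"
    using ex unfolding explained_def z by simp_all
  define d where "d = max (U (x + v) - U x) 0"
  have d: "0 \<le> d" by (simp add: d_def)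
  have D': "D (Suc m) \<omega> = (if c + d < E n \<omega> then ((x + v, v), n, E n \<omega> - (c + d)) else ((x, - v), Suc n, E (Suc n) \<omega>))"
    if "\<omega> \<in> trajectory z m" for \<omega>
  proof -
    have "D (Suc m) \<omega> = (if d < E n \<omega> - c then ((x + v, v), n, E n \<omega> - c - d) else ((x, - v), Suc n, E (Suc n) \<omega>))"
      unfolding driven_walk.simps D[OF that] d_def by (simp only: prod.case Let_def)
    then show ?thesis by (simp add: less_diff_eq diff_diff_eq add.commute[of d c])
  qed
  \<comment> \<open>The next state tells a move from a flip, so it reveals on which side of
    \<open>c + d\<close> the clock lies.\<close>
  have ne: "(x + v, v) \<noteq> (x, - v)" using v by auto
  have p: "prob (trajectory z m) = exp (- c) * prob A" unfolding tr by (rule E_law[OF A c])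
  have "(trajectory z (Suc m) = {} \<or> (\<exists>n A c. explained z (Suc m) n A c)) \<and>
    prob (trajectory z (Suc m)) = prob (trajectory z m) * pmf (zigzag_kernel U (z m)) (z (Suc m))"
  proof -
    have k: "pmf (zigzag_kernel U (z m)) (z (Suc m)) =
      (if z (Suc m) = (x + v, v) then exp (- d) else if z (Suc m) = (x, - v) then 1 - exp (- d) else 0)"
      using v pmf_zigzag_kernel[of v U x "z (Suc m)"] by (auto simp: z Let_def d_def)
    consider "z (Suc m) = (x + v, v)" | "z (Suc m) = (x, - v)" | "z (Suc m) \<notin> {(x + v, v), (x, - v)}" by blast
    then show ?thesis
    proof cases
      case 1
      have t: "trajectory z (Suc m) = A \<inter> {\<omega> \<in> space N. c + d < E n \<omega>}"
        unfolding trajectory_Suc using D' ne d by (auto simp: 1 tr simp del: driven_walk.simps split: if_splits)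
      then have "explained z (Suc m) n A (c + d)"
        using A c d v D' unfolding explained_def by (auto simp: 1 tr simp del: driven_walk.simps)
      moreover have "prob (trajectory z (Suc m)) = exp (- (c + d)) * prob A"
        unfolding t using A c d by (intro E_law) auto
      moreover have "pmf (zigzag_kernel U (z m)) (z (Suc m)) = exp (- d)" unfolding k using 1 by simp
      moreover have "exp (- (c + d)) = exp (- c) * exp (- d)" by (simp add: exp_add[symmetric])
      ultimately show ?thesis using p by auto
    next
      case 2
      define A' where "A' = A \<inter> {\<omega> \<in> space N. c < E n \<omega> \<and> E n \<omega> \<le> c + d}"
      have A': "A' \<in> sets (F (Suc n))" unfolding A'_def using A F_mono E_sets_F by (intro sets.Int) auto
      have t: "trajectory z (Suc m) = A'"
        unfolding trajectory_Suc A'_def using D' ne d by (auto simp: 2 tr not_less simp del: driven_walk.simps split: if_splits)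
      \<comment> \<open>Right after a flip the condition on the fresh clock must be void; this uses
        that clocks are positive everywhere, not just almost surely.\<close>
      moreover have "A' = A' \<inter> {\<omega> \<in> space N. 0 < E (Suc n) \<omega>}" using E_pos by (auto simp: A'_def)
      ultimately have "explained z (Suc m) (Suc n) A' 0"
        using A' v D' unfolding explained_def by (auto simp: 2 tr A'_def not_less simp del: driven_walk.simps)
      moreover have pr: "prob (trajectory z (Suc m)) = (exp (- c) - exp (- (c + d))) * prob A"
        unfolding t A'_def using A c d by (intro E_law_interval) auto
      moreover have pm: "pmf (zigzag_kernel U (z m)) (z (Suc m)) = 1 - exp (- d)" unfolding k using 2 ne by auto
      have "exp (- (c + d)) = exp (- c) * exp (- d)" by (simp add: exp_add[symmetric])
      then have "prob (trajectory z (Suc m)) = prob (trajectory z m) * pmf (zigzag_kernel U (z m)) (z (Suc m))"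
        unfolding pr pm p by (simp add: algebra_simps)
      ultimately show ?thesis by blast
    next
      case 3
      then have "trajectory z (Suc m) = {}" unfolding trajectory_Suc using D' by (auto simp del: driven_walk.simps split: if_splits)
      then show ?thesis using 3 by (simp add: k)
    qed
  qed
  then show "trajectory z (Suc m) = {} \<or> (\<exists>n A c. explained z (Suc m) n A c)"
    "prob (trajectory z (Suc m)) = prob (trajectory z m) * pmf (zigzag_kernel U (z m)) (z (Suc m))" by auto
qed

text \<open>The alternative of an empty event covers the sequences z that the walk cannot
  follow.\<close>

lemma trajectory_explained: "trajectory z m = {} \<or> (\<exists>n A c. explained z m n A c)"
proof (induction m)
  case 0
  show ?case
  proof (cases "z 0 = (x0, v0)")
    case True
    have "trajectory z 0 = space (F 0)" using True by (simp add: trajectory_def)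
    then have "explained z 0 0 (space (F 0)) 0" using True v0 E_pos sets.top[of "F 0"] unfolding explained_def by auto
    then show ?thesis by blast
  qed (auto simp: trajectory_def)
next
  case (Suc m)
  have "trajectory z m = {} \<Longrightarrow> trajectory z (Suc m) = {}" unfolding trajectory_Suc by auto
  then show ?case using Suc explained_step(1) by blast
qed

lemma trajectory_event: "trajectory z m \<in> events"
proof -
  have "A \<inter> {\<omega> \<in> space N. c < E n \<omega>} \<in> events" if "A \<in> sets (F n)" for A n c
    using sets_F[OF that] by measurable
  then show ?thesis using trajectory_explained[of z m] by (auto simp: explained_def)
qed

lemma driven_walk_markov_chain: "markov_chain N (zigzag_kernel U) (x0, v0) (\<lambda>m \<omega>. fst (D m \<omega>))"
  unfolding markov_chain_def
proof (intro conjI allI)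
  show "prob_space N" by unfold_locales
  show "AE \<omega> in N. fst (D 0 \<omega>) = (x0, v0)" by simp
  fix m
  show "(\<lambda>\<omega>. fst (D m \<omega>)) \<in> measurable N (count_space UNIV)"
  proof (subst measurable_count_space_eq2_countable)
    \<comment> \<open>Measurability is read off the trajectories: the event is a countable union of
      them, indexed by lists of states.\<close>
    have "(\<lambda>\<omega>. fst (D m \<omega>)) -` {s} \<inter> space N = (\<Union>xs\<in>{xs. xs ! m = s}. trajectory (\<lambda>i. xs ! i) m)" (is "?l = ?r") for s
    proof
      show "?r \<subseteq> ?l" by (auto simp: trajectory_def)
      show "?l \<subseteq> ?r"
      proof
        fix \<omega> assume "\<omega> \<in> ?l"
        then have "\<omega> \<in> trajectory (\<lambda>i. map (\<lambda>i. fst (D i \<omega>)) [0..<Suc m] ! i) m"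
          "map (\<lambda>i. fst (D i \<omega>)) [0..<Suc m] ! m = s"
          by (auto simp: trajectory_def less_Suc_eq_le simp del: upt_Suc)
        then show "\<omega> \<in> ?r" by blast
      qed
    qed
    moreover have "(\<Union>xs\<in>{xs. xs ! m = s}. trajectory (\<lambda>i. xs ! i) m) \<in> events" for s
      by (intro sets.countable_UN') (auto intro: trajectory_event)
    ultimately show "(\<lambda>\<omega>. fst (D m \<omega>)) \<in> space N \<rightarrow> UNIV \<and> (\<forall>s\<in>UNIV. (\<lambda>\<omega>. fst (D m \<omega>)) -` {s} \<inter> space N \<in> events)"
      by auto
  qed
  fix z
  show "prob {\<omega> \<in> space N. \<forall>i\<le>Suc m. fst (D i \<omega>) = z i} =
    prob {\<omega> \<in> space N. \<forall>i\<le>m. fst (D i \<omega>) = z i} * pmf (zigzag_kernel U (z m)) (z (Suc m))"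
  proof (cases "trajectory z m = {}")
    case True
    then have "trajectory z (Suc m) = {}" unfolding trajectory_Suc by auto
    then show ?thesis using True unfolding trajectory_def by (simp only: measure_empty mult_zero_left)
  next
    case False
    then show ?thesis using trajectory_explained explained_step(2) unfolding trajectory_def[symmetric] by blast
  qed
qed

end

end

section \<open>The clocks of the Zig-Zag process\<close>

lemma nn_integral_countable_index:
  fixes J :: "'a \<Rightarrow> nat"
  assumes J [measurable]: "J \<in> measurable M (count_space UNIV)"
    and g [measurable]: "\<And>j. g j \<in> borel_measurable M"
  shows "(\<integral>\<^sup>+\<omega>. g (J \<omega>) \<omega> \<partial>M) = (\<Sum>j. \<integral>\<^sup>+\<omega>. indicator {\<omega> \<in> space M. J \<omega> = j} \<omega> * g j \<omega> \<partial>M)"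
proof -
  have "(\<Sum>j. \<integral>\<^sup>+\<omega>. indicator {\<omega> \<in> space M. J \<omega> = j} \<omega> * g j \<omega> \<partial>M) =
    (\<integral>\<^sup>+\<omega>. (\<Sum>j. indicator {\<omega> \<in> space M. J \<omega> = j} \<omega> * g j \<omega>) \<partial>M)"
    by (rule nn_integral_suminf[symmetric]) measurable
  also have "\<dots> = (\<integral>\<^sup>+\<omega>. g (J \<omega>) \<omega> \<partial>M)"
  proof (rule nn_integral_cong)
    fix \<omega> assume "\<omega> \<in> space M"
    then show "(\<Sum>j. indicator {\<omega> \<in> space M. J \<omega> = j} \<omega> * g j \<omega>) = g (J \<omega>) \<omega>"
      by (subst suminf_finite[of "{J \<omega>}"]) auto
  qed
  finally show ?thesis by simp
qed

lemma exp_neg_diff_le: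
  fixes a b :: real
  assumes "0 \<le> a" "a \<le> b"
  shows "exp (- a) - exp (- b) \<le> b - a"
proof -
  have "exp (- a) - exp (- b) = exp (- a) * (1 - exp (- (b - a)))"
    by (simp add: right_diff_distrib exp_add[symmetric])
  also have "\<dots> \<le> 1 * (1 - exp (- (b - a)))"
    using assms by (intro mult_right_mono) auto
  also have "\<dots> \<le> b - a" using exp_ge_add_one_self[of "- (b - a)"] unfolding mult_1 by linarith
  finally show ?thesis .
qed

lemma jump_time_Suc: "jump_time T (Suc n) \<omega> = jump_time T n \<omega> + T n \<omega>"
  by (simp add: jump_time_def)

locale zigzag_clocks = zigzag_hazard H h \<Phi> + prob_space N
  for H h :: "real \<Rightarrow> real" and \<Phi> and N :: "'b measure" +
  fixes T :: "nat \<Rightarrow> 'b \<Rightarrow> ennreal" and Y W :: "real \<Rightarrow> 'b \<Rightarrow> real" and y0 w0 :: real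
  assumes w0: "w0 \<in> {-1, 1}"
    and init: "AE \<omega> in N. Y 0 \<omega> = y0 \<and> W 0 \<omega> = w0"
    and T_measurable [measurable]: "\<And>n. T n \<in> borel_measurable N"
    and cond_survival: "\<And>n t. 0 \<le> t \<Longrightarrow> AE \<omega> in N. jump_time T n \<omega> < \<infinity> \<longrightarrow>
      real_cond_exp N (jump_history N T n) (indicat_real {\<omega>' \<in> space N. ennreal t < T n \<omega>'}) \<omega> =
      (let S = enn2real (jump_time T n \<omega>) in zigzag_survival H (Y S \<omega>) (W S \<omega>) t)"
    and flow: "AE \<omega> in N. \<forall>n. jump_time T n \<omega> < \<infinity> \<longrightarrow>
      (let S = enn2real (jump_time T n \<omega>) in
        (\<forall>t\<ge>0. ennreal t < T n \<omega> \<longrightarrow> Y (S + t) \<omega> = Y S \<omega> + t * W S \<omega> \<and> W (S + t) \<omega> = W S \<omega>) \<and>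
        (\<forall>t\<ge>0. T n \<omega> = ennreal t \<longrightarrow> Y (S + t) \<omega> = Y S \<omega> + t * W S \<omega> \<and> W (S + t) \<omega> = - W S \<omega>))"
begin

section \<open>Jump histories and the conditional law of the waiting times\<close>

abbreviation F :: "nat \<Rightarrow> 'b measure" where
  "F \<equiv> jump_history N T"

definition \<tau> :: "nat \<Rightarrow> 'b \<Rightarrow> real" where
  "\<tau> n \<omega> = enn2real (T n \<omega>)"

definition w :: "nat \<Rightarrow> real" where
  "w n = w0 * (-1) ^ n"

text \<open>The position at the n-th jump, reconstructed from the waiting times alone. In this form
  it is measurable for the history \<open>F n\<close>; that it is the position of the process is
  part of \<open>regular\<close>.\<close>

primrec y :: "nat \<Rightarrow> 'b \<Rightarrow> real" where
  "y 0 \<omega> = y0"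
| "y (Suc n) \<omega> = y n \<omega> + w n * \<tau> n \<omega>"

abbreviation L :: "nat \<Rightarrow> 'b \<Rightarrow> real \<Rightarrow> real" where
  "L n \<omega> \<equiv> hazard (y n \<omega>) (w n)"

lemma w: "w n \<in> {-1, 1}"
  using w0 by (cases "even n") (auto simp: w_def)

lemma space_F [simp]: "space (F n) = space N"
  by (simp add: jump_history_def)

lemma history_measurable: "(\<lambda>\<omega>. \<lambda>i\<in>{..<n}. T i \<omega>) \<in> measurable N (PiM {..<n} (\<lambda>_. borel))"
  by measurable

lemma subalgebra_F: "subalgebra N (F n)"
  unfolding subalgebra_def jump_history_def
  using sets_image_in_sets[OF refl history_measurable] by (simp add: jump_history_def)

lemma sets_F: "A \<in> sets (F n) \<Longrightarrow> A \<in> events"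
  using subalgebra_F by (auto simp: subalgebra_def)

lemma T_measurable_F:
  assumes "i < n"
  shows "T i \<in> borel_measurable (F n)"
proof -
  have "(\<lambda>\<omega>. \<lambda>i\<in>{..<n}. T i \<omega>) \<in> measurable (F n) (PiM {..<n} (\<lambda>_. borel))"
    unfolding jump_history_def by (rule measurable_vimage_algebra1) (auto simp: space_PiM)
  then have "(\<lambda>\<omega>. (\<lambda>i\<in>{..<n}. T i \<omega>) i) \<in> measurable (F n) borel"
    by (rule measurable_compose[OF _ measurable_component_singleton]) (use assms in simp)
  then show ?thesis using assms by simp
qed

lemma F_mono: "sets (F n) \<subseteq> sets (F (Suc n))"
proof -
  have "(\<lambda>\<omega>. \<lambda>i\<in>{..<n}. T i \<omega>) \<in> measurable (F (Suc n)) (PiM {..<n} (\<lambda>_. borel))"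
    by (rule measurable_restrict) (auto intro: T_measurable_F)
  then have "sets (vimage_algebra (space (F (Suc n))) (\<lambda>\<omega>. \<lambda>i\<in>{..<n}. T i \<omega>) (PiM {..<n} (\<lambda>_. borel))) \<subseteq> sets (F (Suc n))"
    by (rule sets_image_in_sets[OF refl])
  then show ?thesis by (simp add: jump_history_def)
qed

lemma \<tau>_measurable_F: "i < n \<Longrightarrow> \<tau> i \<in> borel_measurable (F n)"
  unfolding \<tau>_def using T_measurable_F[of i n] by measurable

lemma y_measurable_F: "i \<le> n \<Longrightarrow> y i \<in> borel_measurable (F n)"
proof (induction i)
  case 0
  have "y 0 = (\<lambda>_. y0)" by auto
  then show ?case by simp
next
  case (Suc i)
  then have [measurable]: "y i \<in> borel_measurable (F n)" "\<tau> i \<in> borel_measurable (F n)"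
    using \<tau>_measurable_F[of i n] by auto
  have "y (Suc i) = (\<lambda>\<omega>. y i \<omega> + w i * \<tau> i \<omega>)" by auto
  then show ?case by simp
qed

lemma L_measurable_F:
  assumes "i \<le> n" "f \<in> borel_measurable (F n)"
  shows "(\<lambda>\<omega>. L i \<omega> (f \<omega>)) \<in> borel_measurable (F n)"
proof -
  note [measurable] = y_measurable_F[OF assms(1)] assms(2)
  show ?thesis unfolding hazard_def by measurable
qed

lemma measurable_F_N: "f \<in> borel_measurable (F n) \<Longrightarrow> f \<in> borel_measurable N"
  using measurable_from_subalg[OF subalgebra_F] .

text \<open>The n-th jump occurs and the state found there is the one predicted by the history;
  \<open>AE_regular\<close> shows that this holds almost surely.\<close>

definition regular :: "nat \<Rightarrow> 'b \<Rightarrow> bool" where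
  "regular n \<omega> \<longleftrightarrow> jump_time T n \<omega> < \<infinity> \<and> Y (enn2real (jump_time T n \<omega>)) \<omega> = y n \<omega> \<and> W (enn2real (jump_time T n \<omega>)) \<omega> = w n"

lemma T_law_const:
  assumes reg: "AE \<omega> in N. regular n \<omega>" and A: "A \<in> sets (F n)" and t: "0 \<le> t"
  shows "(\<integral>\<^sup>+\<omega>. indicator A \<omega> * indicator {\<omega> \<in> space N. ennreal t < T n \<omega>} \<omega> \<partial>N) =
    (\<integral>\<^sup>+\<omega>. indicator A \<omega> * ennreal (exp (- L n \<omega> t)) \<partial>N)"
proof -
  interpret finite_measure_subalgebra N "F n"
    by standard (rule subalgebra_F)
  define B where "B = {\<omega> \<in> space N. ennreal t < T n \<omega>}"
  have [measurable]: "A \<in> events" "B \<in> events" using sets_F[OF A] by (auto simp: B_def)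
  have [measurable]: "(\<lambda>\<omega>. L n \<omega> t) \<in> borel_measurable N"
    by (rule measurable_F_N[of _ n]) (rule L_measurable_F, auto)
  have ae: "AE \<omega> in N. real_cond_exp N (F n) (indicat_real B) \<omega> = exp (- L n \<omega> t)"
    using cond_survival[OF t, of n] reg unfolding B_def[symmetric]
    by eventually_elim (use zigzag_survival_eq[OF w t] in \<open>auto simp: regular_def Let_def\<close>)
  have i: "integrable N (indicat_real B)" by (simp add: integrable_indicator_iff emeasure_eq_measure)
  have "(\<integral>\<omega>. indicat_real A \<omega> * indicat_real B \<omega> \<partial>N) = (\<integral>\<omega>. indicat_real A \<omega> * real_cond_exp N (F n) (indicat_real B) \<omega> \<partial>N)"
    using real_cond_exp_intA[OF i A] by (simp add: set_lebesgue_integral_def)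
  also have "\<dots> = (\<integral>\<omega>. indicat_real A \<omega> * exp (- L n \<omega> t) \<partial>N)"
    using ae by (intro integral_cong_AE) auto
  finally have eq: "(\<integral>\<omega>. indicat_real A \<omega> * indicat_real B \<omega> \<partial>N) = (\<integral>\<omega>. indicat_real A \<omega> * exp (- L n \<omega> t) \<partial>N)" .
  have "integrable N (\<lambda>\<omega>. indicat_real A \<omega> * indicat_real B \<omega>)"
    by (rule integrable_const_bound[of _ 1]) (auto simp: indicator_def)
  then have "(\<integral>\<^sup>+\<omega>. ennreal (indicat_real A \<omega> * indicat_real B \<omega>) \<partial>N) = ennreal (\<integral>\<omega>. indicat_real A \<omega> * indicat_real B \<omega> \<partial>N)"
    by (rule nn_integral_eq_integral) auto
  moreover have "integrable N (\<lambda>\<omega>. indicat_real A \<omega> * exp (- L n \<omega> t))"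
    using hazard_nonneg[OF w t] by (intro integrable_const_bound[of _ 1]) (auto simp: indicator_def)
  then have "(\<integral>\<^sup>+\<omega>. ennreal (indicat_real A \<omega> * exp (- L n \<omega> t)) \<partial>N) = ennreal (\<integral>\<omega>. indicat_real A \<omega> * exp (- L n \<omega> t) \<partial>N)"
    by (rule nn_integral_eq_integral) auto
  ultimately show ?thesis unfolding B_def[symmetric]
    by (simp add: eq ennreal_mult' ennreal_indicator)
qed

text \<open>On the event that \<open>J\<close> equals j the threshold is constant, and this event is
  in \<open>F n\<close>, so it can be merged with \<open>A\<close>; the contributions of all j are
  then summed.\<close>

lemma T_law_countable:
  fixes J :: "'b \<Rightarrow> nat"
  assumes reg: "AE \<omega> in N. regular n \<omega>" and A: "A \<in> sets (F n)"
    and J: "J \<in> measurable (F n) (count_space UNIV)" and r: "0 \<le> r"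
  shows "(\<integral>\<^sup>+\<omega>. indicator A \<omega> * indicator {\<omega> \<in> space N. ennreal (real (J \<omega>) * r) < T n \<omega>} \<omega> \<partial>N) =
    (\<integral>\<^sup>+\<omega>. indicator A \<omega> * ennreal (exp (- L n \<omega> (real (J \<omega>) * r))) \<partial>N)"
proof -
  have [measurable]: "A \<in> events" using sets_F[OF A] .
  have [measurable]: "J \<in> measurable N (count_space UNIV)" using measurable_from_subalg[OF subalgebra_F J] .
  have [measurable]: "(\<lambda>\<omega>. L n \<omega> t) \<in> borel_measurable N" for t
    by (rule measurable_F_N[of _ n]) (rule L_measurable_F, auto)
  have "(\<integral>\<^sup>+\<omega>. indicator A \<omega> * indicator {\<omega> \<in> space N. ennreal (real (J \<omega>) * r) < T n \<omega>} \<omega> \<partial>N) =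
     (\<integral>\<^sup>+\<omega>. (\<lambda>j \<omega>. indicator A \<omega> * indicator {\<omega> \<in> space N. ennreal (real j * r) < T n \<omega>} \<omega>) (J \<omega>) \<omega> \<partial>N)"
    by (intro nn_integral_cong) (auto simp: indicator_def)
  also have "\<dots> = (\<Sum>j. \<integral>\<^sup>+\<omega>. indicator {\<omega> \<in> space N. J \<omega> = j} \<omega> * (indicator A \<omega> * indicator {\<omega> \<in> space N. ennreal (real j * r) < T n \<omega>} \<omega>) \<partial>N)"
    by (rule nn_integral_countable_index) measurable
  also have "\<dots> = (\<Sum>j. \<integral>\<^sup>+\<omega>. indicator {\<omega> \<in> space N. J \<omega> = j} \<omega> * (indicator A \<omega> * ennreal (exp (- L n \<omega> (real j * r)))) \<partial>N)"
  proof (intro suminf_cong)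
    fix j
    have "{\<omega> \<in> space (F n). J \<omega> = j} \<in> sets (F n)" using J by measurable
    then have "A \<inter> {\<omega> \<in> space N. J \<omega> = j} \<in> sets (F n)" using A by auto
    from T_law_const[OF reg this, of "real j * r"] r
    show "(\<integral>\<^sup>+\<omega>. indicator {\<omega> \<in> space N. J \<omega> = j} \<omega> * (indicator A \<omega> * indicator {\<omega> \<in> space N. ennreal (real j * r) < T n \<omega>} \<omega>) \<partial>N) =
      (\<integral>\<^sup>+\<omega>. indicator {\<omega> \<in> space N. J \<omega> = j} \<omega> * (indicator A \<omega> * ennreal (exp (- L n \<omega> (real j * r)))) \<partial>N)"
      by (simp add: indicator_inter_arith ac_simps)
  qed
  also have "\<dots> = (\<integral>\<^sup>+\<omega>. (\<lambda>j \<omega>. indicator A \<omega> * ennreal (exp (- L n \<omega> (real j * r)))) (J \<omega>) \<omega> \<partial>N)"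
    by (rule nn_integral_countable_index[symmetric]) measurable
  finally show ?thesis .
qed

text \<open>The formula holds for grid-valued thresholds \<open>R m\<close> converging to \<rho>,
  and both sides pass to the limit by dominated convergence.\<close>

lemma T_law_random:
  assumes reg: "AE \<omega> in N. regular n \<omega>" and A: "A \<in> sets (F n)"
    and \<rho>: "\<rho> \<in> borel_measurable (F n)" "\<And>\<omega>. \<omega> \<in> space N \<Longrightarrow> 0 \<le> \<rho> \<omega>"
  shows "prob (A \<inter> {\<omega> \<in> space N. ennreal (\<rho> \<omega>) < T n \<omega>}) = (\<integral>\<omega>. indicat_real A \<omega> * exp (- L n \<omega> (\<rho> \<omega>)) \<partial>N)"
proof -
  \<comment> \<open>The \<open>+ 1\<close> puts \<open>R m\<close> strictly above \<rho>.
    Approximation from above is essential: the indicator of \<open>r < T n\<close> is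
    right-continuous in r, whereas values below \<rho> would give the wrong limit when
    \<open>T n\<close> equals \<rho>.\<close>
  define J where "J m \<omega> = nat \<lfloor>\<rho> \<omega> * real (Suc m)\<rfloor> + 1" for m \<omega>
  define R where "R m \<omega> = real (J m \<omega>) * (1 / real (Suc m))" for m \<omega>
  have JF: "J m \<in> measurable (F n) (count_space UNIV)" for m
    using \<rho>(1) unfolding J_def by measurable
  have RF: "R m \<in> borel_measurable (F n)" for m using JF[of m] unfolding R_def by measurable
  have [measurable]: "A \<in> events" using sets_F[OF A] .
  have [measurable]: "\<rho> \<in> borel_measurable N" "R m \<in> borel_measurable N" for m
    using measurable_F_N \<rho>(1) RF by auto
  have [measurable]: "(\<lambda>\<omega>. L n \<omega> (R m \<omega>)) \<in> borel_measurable N" "(\<lambda>\<omega>. L n \<omega> (\<rho> \<omega>)) \<in> borel_measurable N" for m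
    using measurable_F_N L_measurable_F \<rho>(1) RF by blast+
  have R: "\<rho> \<omega> < R m \<omega>" "R m \<omega> \<le> \<rho> \<omega> + 1 / real (Suc m)" if "\<omega> \<in> space N" for \<omega> m
  proof -
    define k where "k = real (Suc m)"
    have k: "0 < k" by (simp add: k_def)
    have "real (nat \<lfloor>\<rho> \<omega> * k\<rfloor>) = of_int \<lfloor>\<rho> \<omega> * k\<rfloor>" using \<rho>(2)[OF that] k by simp
    then have "\<rho> \<omega> * k < real (J m \<omega>)" "real (J m \<omega>) \<le> \<rho> \<omega> * k + 1"
      unfolding J_def k_def[symmetric] of_nat_add of_nat_1 by linarith+
    then show "\<rho> \<omega> < R m \<omega>" "R m \<omega> \<le> \<rho> \<omega> + 1 / real (Suc m)"
      using k unfolding R_def k_def[symmetric] by (simp_all add: field_simps)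
  qed
  have R_lim: "(\<lambda>m. R m \<omega>) \<longlonglongrightarrow> \<rho> \<omega>" if "\<omega> \<in> space N" for \<omega>
  proof (rule tendsto_sandwich[OF _ _ tendsto_const])
    have "(\<lambda>m. \<rho> \<omega> + 1 / real (Suc m)) \<longlonglongrightarrow> \<rho> \<omega> + 0"
      using LIMSEQ_inverse_real_of_nat by (intro tendsto_intros) (simp add: inverse_eq_divide)
    then show "(\<lambda>m. \<rho> \<omega> + 1 / real (Suc m)) \<longlonglongrightarrow> \<rho> \<omega>" by simp
  qed (use R[OF that] in \<open>auto simp: less_imp_le\<close>)
  have eq: "(\<integral>\<omega>. indicat_real A \<omega> * indicat_real {\<omega> \<in> space N. ennreal (R m \<omega>) < T n \<omega>} \<omega> \<partial>N) =
     (\<integral>\<omega>. indicat_real A \<omega> * exp (- L n \<omega> (R m \<omega>)) \<partial>N)" for m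
  proof -
    have "(\<integral>\<^sup>+\<omega>. ennreal (indicat_real A \<omega> * indicat_real {\<omega> \<in> space N. ennreal (R m \<omega>) < T n \<omega>} \<omega>) \<partial>N) =
      (\<integral>\<^sup>+\<omega>. ennreal (indicat_real A \<omega> * exp (- L n \<omega> (R m \<omega>))) \<partial>N)"
      using T_law_countable[OF reg A JF, of "1 / real (Suc m)" m]
      by (simp add: R_def ennreal_mult' ennreal_indicator)
    then show ?thesis by (subst (1 2) integral_eq_nn_integral) auto
  qed
  have "(\<lambda>m. \<integral>\<omega>. indicat_real A \<omega> * indicat_real {\<omega> \<in> space N. ennreal (R m \<omega>) < T n \<omega>} \<omega> \<partial>N) \<longlonglongrightarrow>
      (\<integral>\<omega>. indicat_real A \<omega> * indicat_real {\<omega> \<in> space N. ennreal (\<rho> \<omega>) < T n \<omega>} \<omega> \<partial>N)"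
  proof (rule integral_dominated_convergence[where w = "\<lambda>_. 1"])
    show "AE \<omega> in N. (\<lambda>m. indicat_real A \<omega> * indicat_real {\<omega> \<in> space N. ennreal (R m \<omega>) < T n \<omega>} \<omega>) \<longlonglongrightarrow>
       indicat_real A \<omega> * indicat_real {\<omega> \<in> space N. ennreal (\<rho> \<omega>) < T n \<omega>} \<omega>"
    proof (intro AE_I2 tendsto_mult tendsto_const tendsto_eventually)
      fix \<omega> assume \<omega>: "\<omega> \<in> space N"
      have "\<forall>\<^sub>F m in sequentially. (ennreal (R m \<omega>) < T n \<omega>) = (ennreal (\<rho> \<omega>) < T n \<omega>)"
      proof (cases "ennreal (\<rho> \<omega>) < T n \<omega>")
        case True
        have "(\<lambda>m. ennreal (R m \<omega>)) \<longlonglongrightarrow> ennreal (\<rho> \<omega>)" by (intro tendsto_ennrealI R_lim \<omega>)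
        from order_tendstoD(2)[OF this True] show ?thesis by eventually_elim (use True in auto)
      next
        case False
        have "ennreal (\<rho> \<omega>) \<le> ennreal (R m \<omega>)" for m using R(1)[OF \<omega>, of m] by (simp add: ennreal_leI)
        then have "\<not> ennreal (R m \<omega>) < T n \<omega>" for m using False by (meson le_less_trans)
        then show ?thesis using False by simp
      qed
      then show "\<forall>\<^sub>F m in sequentially. indicat_real {\<omega> \<in> space N. ennreal (R m \<omega>) < T n \<omega>} \<omega> =
          indicat_real {\<omega> \<in> space N. ennreal (\<rho> \<omega>) < T n \<omega>} \<omega>"
        by eventually_elim (auto simp: indicator_def)
    qed
  qed (auto simp: indicator_def)
  moreover have "(\<lambda>m. \<integral>\<omega>. indicat_real A \<omega> * exp (- L n \<omega> (R m \<omega>)) \<partial>N) \<longlonglongrightarrow> (\<integral>\<omega>. indicat_real A \<omega> * exp (- L n \<omega> (\<rho> \<omega>)) \<partial>N)"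
  proof (rule integral_dominated_convergence[where w = "\<lambda>_. 1"])
    show "AE \<omega> in N. (\<lambda>m. indicat_real A \<omega> * exp (- L n \<omega> (R m \<omega>))) \<longlonglongrightarrow> indicat_real A \<omega> * exp (- L n \<omega> (\<rho> \<omega>))"
      by (intro AE_I2 tendsto_intros hazard_tendsto R_lim) auto
    show "AE \<omega> in N. norm (indicat_real A \<omega> * exp (- L n \<omega> (R m \<omega>))) \<le> 1" for m
    proof (intro AE_I2)
      fix \<omega> assume "\<omega> \<in> space N"
      then have nonneg: "0 \<le> R m \<omega>" using R(1)[of \<omega> m] \<rho>(2)[of \<omega>] by simp
      then show "norm (indicat_real A \<omega> * exp (- L n \<omega> (R m \<omega>))) \<le> 1"
        using hazard_nonneg[OF w nonneg, of "y n \<omega>" n] by (auto simp: indicator_def)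
    qed
  qed auto
  ultimately have "(\<integral>\<omega>. indicat_real A \<omega> * indicat_real {\<omega> \<in> space N. ennreal (\<rho> \<omega>) < T n \<omega>} \<omega> \<partial>N) =
    (\<integral>\<omega>. indicat_real A \<omega> * exp (- L n \<omega> (\<rho> \<omega>)) \<partial>N)"
    unfolding eq by (rule LIMSEQ_unique)
  moreover have "indicat_real A \<omega> * indicat_real {\<omega> \<in> space N. ennreal (\<rho> \<omega>) < T n \<omega>} \<omega> =
    indicat_real (A \<inter> {\<omega> \<in> space N. ennreal (\<rho> \<omega>) < T n \<omega>}) \<omega>" for \<omega>
    by (simp add: indicator_inter_arith)
  ultimately show ?thesis by simp
qed

text \<open>The probability that \<open>T n\<close> exceeds k is the expectation of
  \<open>exp (- L n \<omega> k)\<close>, which tends to 0 since the hazard tends to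
  infinity.\<close>

lemma T_finite:
  assumes reg: "AE \<omega> in N. regular n \<omega>"
  shows "AE \<omega> in N. T n \<omega> < \<infinity>"
proof -
  have [measurable]: "(\<lambda>\<omega>. L n \<omega> t) \<in> borel_measurable N" for t
    by (rule measurable_F_N[of _ n]) (rule L_measurable_F, auto)
  have p: "prob {\<omega> \<in> space N. ennreal (real k) < T n \<omega>} = (\<integral>\<omega>. exp (- L n \<omega> (real k)) \<partial>N)" for k
  proof -
    have "prob (space N \<inter> {\<omega> \<in> space N. ennreal (real k) < T n \<omega>}) = (\<integral>\<omega>. indicat_real (space N) \<omega> * exp (- L n \<omega> (real k)) \<partial>N)"
      by (rule T_law_random[OF reg]) (use sets.top[of "F n"] in auto)
    moreover have "(\<integral>\<omega>. indicat_real (space N) \<omega> * exp (- L n \<omega> (real k)) \<partial>N) = (\<integral>\<omega>. exp (- L n \<omega> (real k)) \<partial>N)"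
      by (intro Bochner_Integration.integral_cong) auto
    moreover have "space N \<inter> {\<omega> \<in> space N. ennreal (real k) < T n \<omega>} = {\<omega> \<in> space N. ennreal (real k) < T n \<omega>}" by auto
    ultimately show ?thesis by simp
  qed
  have "(\<lambda>k. \<integral>\<omega>. exp (- L n \<omega> (real k)) \<partial>N) \<longlonglongrightarrow> (\<integral>\<omega>. 0 \<partial>N)"
  proof (rule integral_dominated_convergence[where w = "\<lambda>_. 1"])
    show "AE \<omega> in N. (\<lambda>k. exp (- L n \<omega> (real k))) \<longlonglongrightarrow> 0"
    proof (intro AE_I2)
      fix \<omega>
      have "filterlim (\<lambda>k. L n \<omega> (real k)) at_top sequentially"
        by (rule filterlim_compose[OF hazard_at_top[OF w] filterlim_real_sequentially])
      then have "filterlim (\<lambda>k. - L n \<omega> (real k)) at_bot sequentially" by (simp add: filterlim_uminus_at_top)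
      then show "(\<lambda>k. exp (- L n \<omega> (real k))) \<longlonglongrightarrow> 0" by (rule filterlim_compose[OF exp_at_bot])
    qed
    show "AE \<omega> in N. norm (exp (- L n \<omega> (real k))) \<le> 1" for k
      using hazard_nonneg[OF w, of "real k"] by auto
  qed auto
  then have lim: "(\<lambda>k. prob {\<omega> \<in> space N. ennreal (real k) < T n \<omega>}) \<longlonglongrightarrow> 0" by (simp add: p)
  define I where "I = {\<omega> \<in> space N. T n \<omega> = \<infinity>}"
  have I [measurable]: "I \<in> events" unfolding I_def by measurable
  have "prob I \<le> prob {\<omega> \<in> space N. ennreal (real k) < T n \<omega>}" for k
    by (rule finite_measure_mono) (auto simp: I_def)
  then have "prob I \<le> 0" using lim by (intro tendsto_lowerbound[OF lim]) auto
  then have "emeasure N I = 0" using measure_nonneg[of N I] by (simp add: emeasure_eq_measure)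
  then have "AE \<omega> in N. \<omega> \<notin> I" using I by (intro AE_not_in) (auto simp: null_sets_def)
  then show ?thesis using AE_space by eventually_elim (auto simp: I_def less_top)
qed

text \<open>The law of \<open>T n\<close> can be used only when the state at jump n is known.
  Regularity and finiteness are therefore obtained in alternation: regularity at n makes
  \<open>T n\<close> finite, and then the flow carries the prediction over to jump
  \<open>Suc n\<close>.\<close>

lemma AE_regular: "AE \<omega> in N. regular n \<omega>"
proof (induction n)
  case 0
  show ?case using init by eventually_elim (simp add: regular_def jump_time_def w_def)
next
  case (Suc n)
  show ?case using Suc T_finite[OF Suc] flow
  proof eventually_elim
    case (elim \<omega>)
    define S where "S = enn2real (jump_time T n \<omega>)"
    have fin: "jump_time T n \<omega> < \<infinity>" using elim(1) by (simp add: regular_def)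
    have T: "T n \<omega> = ennreal (\<tau> n \<omega>)" "0 \<le> \<tau> n \<omega>" using elim(2) by (auto simp: \<tau>_def)
    have "enn2real (jump_time T (Suc n) \<omega>) = S + \<tau> n \<omega>"
      using fin elim(2) by (simp add: jump_time_Suc S_def \<tau>_def enn2real_plus)
    moreover have "Y (S + \<tau> n \<omega>) \<omega> = Y S \<omega> + \<tau> n \<omega> * W S \<omega> \<and> W (S + \<tau> n \<omega>) \<omega> = - W S \<omega>"
      using elim(3) fin T unfolding Let_def S_def by blast
    moreover have "Y S \<omega> = y n \<omega>" "W S \<omega> = w n" using elim(1) by (auto simp: regular_def S_def)
    ultimately show ?case using fin elim(2) by (simp add: regular_def jump_time_Suc w_def)
  qed
qed

section \<open>From waiting times to exponential clocks\<close>

definition hazard_inv :: "real \<Rightarrow> real \<Rightarrow> real \<Rightarrow> real" where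
  "hazard_inv a v c = Sup {t. 0 \<le> t \<and> hazard a v t \<le> c}"

text \<open>The supremum selects the right end of a possible flat piece of the hazard at level c.
  This choice of inverse makes the equivalence between times and levels exact for strict
  inequalities.\<close>

lemma hazard_inv:
  assumes v: "v \<in> {-1, 1}" and c: "0 \<le> c"
  shows "0 \<le> hazard_inv a v c" "hazard a v (hazard_inv a v c) = c"
    "0 \<le> t \<Longrightarrow> hazard_inv a v c < t \<longleftrightarrow> c < hazard a v t"
proof -
  define A where "A = {t. 0 \<le> t \<and> hazard a v t \<le> c}"
  obtain b where b: "0 \<le> b" "c < hazard a v b"
    using eventually_conj[OF eventually_ge_at_top[of 0] filterlim_at_top_dense[THEN iffD1, OF hazard_at_top[OF v, of a], rule_format, of c]]
    by (auto simp: eventually_at_top_linorder)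
  have A0: "0 \<in> A" using c by (simp add: A_def)
  have bdd: "bdd_above A"
  proof (rule bdd_aboveI)
    fix t assume "t \<in> A"
    then show "t \<le> b" using b hazard_mono[OF v, of b t a] by (force simp: A_def)
  qed
  have "A = {0..} \<inter> {t. hazard a v t \<le> c}" by (auto simp: A_def)
  moreover have "closed {t. hazard a v t \<le> c}"
    by (intro closed_Collect_le hazard_cont continuous_on_const)
  ultimately have "closed A" by auto
  then have S: "hazard_inv a v c \<in> A"
    unfolding hazard_inv_def A_def[symmetric] using A0 bdd by (intro closed_contains_Sup) auto
  then show nonneg: "0 \<le> hazard_inv a v c" by (simp add: A_def)
  have upper: "t \<le> hazard_inv a v c" if "0 \<le> t" "hazard a v t \<le> c" for t
    unfolding hazard_inv_def A_def[symmetric] using that bdd by (intro cSup_upper) (auto simp: A_def)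
  obtain u where u: "0 \<le> u" "hazard a v u = c"
    using IVT'[of "hazard a v" 0 c b] b c hazard_cont by auto
  then have "hazard a v u \<le> hazard a v (hazard_inv a v c)" using upper by (intro hazard_mono[OF v]) auto
  then show eq: "hazard a v (hazard_inv a v c) = c" using S u by (simp add: A_def)
  show "hazard_inv a v c < t \<longleftrightarrow> c < hazard a v t" if "0 \<le> t"
    using upper[of t] that hazard_mono[OF v, of t "hazard_inv a v c" a] eq by fastforce
qed

text \<open>With \<rho> the inverse of the hazard at level c, the event \<open>c < L\<close> at time
  \<tau> is \<open>\<rho> < T n\<close> up to a null set, and the survival probability at \<rho> is
  \<open>exp (- c)\<close>. The level may depend on the history, as \<open>AE_L_neq\<close>
  requires.\<close>

lemma L_law:
  assumes A: "A \<in> sets (F n)"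
    and c: "c \<in> borel_measurable (F n)" "\<And>\<omega>. \<omega> \<in> space N \<Longrightarrow> 0 \<le> c \<omega>"
  shows "prob (A \<inter> {\<omega> \<in> space N. c \<omega> < L n \<omega> (\<tau> n \<omega>)}) = (\<integral>\<omega>. indicat_real A \<omega> * exp (- c \<omega>) \<partial>N)"
proof -
  define \<rho> where "\<rho> \<omega> = hazard_inv (y n \<omega>) (w n) (c \<omega>)" for \<omega>
  have \<rho>: "0 \<le> \<rho> \<omega>" "L n \<omega> (\<rho> \<omega>) = c \<omega>" "0 \<le> t \<Longrightarrow> \<rho> \<omega> < t \<longleftrightarrow> c \<omega> < L n \<omega> t" if "\<omega> \<in> space N" for \<omega> t
    using hazard_inv[OF w c(2)[OF that]] by (auto simp: \<rho>_def)
  have meas: "\<rho> \<in> borel_measurable (F n)"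
    unfolding borel_measurable_iff_less
  proof
    fix t
    show "{\<omega> \<in> space (F n). \<rho> \<omega> < t} \<in> sets (F n)"
    proof (cases "0 \<le> t")
      case True
      have [measurable]: "(\<lambda>\<omega>. L n \<omega> t) \<in> borel_measurable (F n)" "c \<in> borel_measurable (F n)"
        using c by (auto intro: L_measurable_F)
      have "{\<omega> \<in> space (F n). \<rho> \<omega> < t} = {\<omega> \<in> space (F n). c \<omega> < L n \<omega> t}" using \<rho>(3) True by auto
      also have "\<dots> \<in> sets (F n)" by measurable
      finally show ?thesis .
    next
      case False
      then have empty: "{\<omega> \<in> space (F n). \<rho> \<omega> < t} = {}" using \<rho>(1) by force
      show ?thesis unfolding empty by simp
    qed
  qed
  have [measurable]: "A \<in> events" "\<rho> \<in> borel_measurable N" "c \<in> borel_measurable N" "\<tau> n \<in> borel_measurable N"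
    using sets_F[OF A] measurable_F_N meas c(1) \<tau>_measurable_F[of n "Suc n"] by auto
  have [measurable]: "(\<lambda>\<omega>. L n \<omega> (\<tau> n \<omega>)) \<in> borel_measurable N"
    by (rule measurable_F_N[OF L_measurable_F[of n "Suc n"]]) (auto intro: \<tau>_measurable_F)
  have "prob (A \<inter> {\<omega> \<in> space N. c \<omega> < L n \<omega> (\<tau> n \<omega>)}) = prob (A \<inter> {\<omega> \<in> space N. ennreal (\<rho> \<omega>) < T n \<omega>})"
  proof (rule measure_eq_AE)
    show "AE \<omega> in N. (\<omega> \<in> A \<inter> {\<omega> \<in> space N. c \<omega> < L n \<omega> (\<tau> n \<omega>)}) = (\<omega> \<in> A \<inter> {\<omega> \<in> space N. ennreal (\<rho> \<omega>) < T n \<omega>})"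
      using T_finite[OF AE_regular[of n]] AE_space
    proof eventually_elim
      case (elim \<omega>)
      have T: "T n \<omega> = ennreal (\<tau> n \<omega>)" "0 \<le> \<tau> n \<omega>" using elim(1) by (auto simp: \<tau>_def)
      show ?case using \<rho>(3)[OF elim(2) T(2)] \<rho>(1)[OF elim(2)] by (simp add: T(1) ennreal_less_iff)
    qed
  qed measurable
  also have "\<dots> = (\<integral>\<omega>. indicat_real A \<omega> * exp (- L n \<omega> (\<rho> \<omega>)) \<partial>N)"
    by (rule T_law_random[OF AE_regular A meas]) (rule \<rho>(1))
  also have "\<dots> = (\<integral>\<omega>. indicat_real A \<omega> * exp (- c \<omega>) \<partial>N)"
    by (intro Bochner_Integration.integral_cong) (auto simp: \<rho>(2))
  finally show ?thesis .
qed

lemma L_\<tau>_measurable_F: "(\<lambda>\<omega>. L n \<omega> (\<tau> n \<omega>)) \<in> borel_measurable (F (Suc n))"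
  by (rule L_measurable_F) (auto intro: \<tau>_measurable_F)

lemma L_\<tau>_measurable [measurable]: "(\<lambda>\<omega>. L n \<omega> (\<tau> n \<omega>)) \<in> borel_measurable N"
  by (rule measurable_F_N[OF L_\<tau>_measurable_F])

lemma AE_L_pos: "AE \<omega> in N. 0 < L n \<omega> (\<tau> n \<omega>)"
proof -
  have "prob (space N \<inter> {\<omega> \<in> space N. 0 < L n \<omega> (\<tau> n \<omega>)}) = (\<integral>\<omega>. indicat_real (space N) \<omega> * exp (- 0) \<partial>N)"
    by (rule L_law) (use sets.top[of "F n"] in auto)
  then have "prob {\<omega> \<in> space N. 0 < L n \<omega> (\<tau> n \<omega>)} = 1" by (simp add: prob_space Int_def)
  then show ?thesis by (simp add: prob_Collect_eq_1)
qed

text \<open>The value 1 on the null set makes the clocks positive everywhere.\<close>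

definition clock :: "nat \<Rightarrow> 'b \<Rightarrow> real" where
  "clock n \<omega> = (if 0 < L n \<omega> (\<tau> n \<omega>) then L n \<omega> (\<tau> n \<omega>) else 1)"

lemma exponential_clocks_clock: "exponential_clocks N F clock"
proof (intro exponential_clocks.intro exponential_clocks_axioms.intro)
  show "prob_space N" by unfold_locales
  show "clock n \<in> borel_measurable (F (Suc n))" for n
    unfolding clock_def using L_\<tau>_measurable_F[of n] by measurable
  have [measurable]: "clock n \<in> borel_measurable N" for n unfolding clock_def by measurable
  show "prob (A \<inter> {\<omega> \<in> space N. c < clock n \<omega>}) = exp (- c) * prob A" if A: "A \<in> sets (F n)" and c: "0 \<le> c" for A n c
  proof -
    have [measurable]: "A \<in> events" using sets_F[OF A] .
    have "prob (A \<inter> {\<omega> \<in> space N. c < clock n \<omega>}) = prob (A \<inter> {\<omega> \<in> space N. c < L n \<omega> (\<tau> n \<omega>)})"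
    proof (rule measure_eq_AE)
      show "AE \<omega> in N. (\<omega> \<in> A \<inter> {\<omega> \<in> space N. c < clock n \<omega>}) = (\<omega> \<in> A \<inter> {\<omega> \<in> space N. c < L n \<omega> (\<tau> n \<omega>)})"
        using AE_L_pos[of n] by eventually_elim (simp add: clock_def)
    qed measurable
    also have "\<dots> = (\<integral>\<omega>. indicat_real A \<omega> * exp (- c) \<partial>N)" by (rule L_law[OF A]) (use c in auto)
    also have "\<dots> = exp (- c) * prob A" by simp
    finally show ?thesis .
  qed
qed (auto simp: subalgebra_F F_mono clock_def intro: F_mono[THEN subsetD])

text \<open>The exponential law has no atoms, even at a level that depends on the history: the
  probability of hitting c is at most that of an interval of length \<open>1 / Suc k\<close> ending
  at c. Used for rational a, this excludes a hazard that is flat at the level of the clock.\<close>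

lemma AE_L_neq:
  assumes a: "0 \<le> a"
  shows "AE \<omega> in N. L n \<omega> (\<tau> n \<omega>) \<noteq> L n \<omega> a"
proof -
  define c where "c \<omega> = L n \<omega> a" for \<omega>
  define c' where "c' k \<omega> = max (c \<omega> - 1 / real (Suc k)) 0" for k \<omega>
  have cF: "c \<in> borel_measurable (F n)" unfolding c_def by (rule L_measurable_F) auto
  have c'F: "c' k \<in> borel_measurable (F n)" for k unfolding c'_def using cF by measurable
  have [measurable]: "c \<in> borel_measurable N" "c' k \<in> borel_measurable N" for k
    using measurable_F_N cF c'F by auto
  have c: "0 \<le> c \<omega>" "0 \<le> c' k \<omega>" "c' k \<omega> \<le> c \<omega>" "c \<omega> - c' k \<omega> \<le> 1 / real (Suc k)" for k \<omega>
    using hazard_nonneg[OF w a] by (auto simp: c_def c'_def)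
  \<comment> \<open>Restricting to a positive value keeps \<open>c' k\<close> strictly below c on
    \<open>B\<close> even when the truncation at 0 is active; the value 0 is excluded separately by
    \<open>AE_L_pos\<close>.\<close>
  define B where "B = {\<omega> \<in> space N. 0 < L n \<omega> (\<tau> n \<omega>) \<and> L n \<omega> (\<tau> n \<omega>) = c \<omega>}"
  have B: "B \<in> events" unfolding B_def by measurable
  have law: "prob {\<omega> \<in> space N. d \<omega> < L n \<omega> (\<tau> n \<omega>)} = (\<integral>\<omega>. exp (- d \<omega>) \<partial>N)"
    if "d \<in> borel_measurable (F n)" "\<And>\<omega>. 0 \<le> d \<omega>" for d
  proof -
    have "prob (space N \<inter> {\<omega> \<in> space N. d \<omega> < L n \<omega> (\<tau> n \<omega>)}) = (\<integral>\<omega>. indicat_real (space N) \<omega> * exp (- d \<omega>) \<partial>N)"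
      by (rule L_law) (use that sets.top[of "F n"] in auto)
    also have "\<dots> = (\<integral>\<omega>. exp (- d \<omega>) \<partial>N)" by (intro Bochner_Integration.integral_cong) auto
    finally show ?thesis by (simp add: Int_def)
  qed
  have "prob B \<le> 1 / real (Suc k)" for k
  proof -
    have "B \<subseteq> {\<omega> \<in> space N. c' k \<omega> < L n \<omega> (\<tau> n \<omega>)} - {\<omega> \<in> space N. c \<omega> < L n \<omega> (\<tau> n \<omega>)}"
      by (auto simp: B_def c'_def)
    then have "prob B \<le> prob ({\<omega> \<in> space N. c' k \<omega> < L n \<omega> (\<tau> n \<omega>)} - {\<omega> \<in> space N. c \<omega> < L n \<omega> (\<tau> n \<omega>)})"
      by (intro finite_measure_mono) auto
    also have "\<dots> = prob {\<omega> \<in> space N. c' k \<omega> < L n \<omega> (\<tau> n \<omega>)} - prob {\<omega> \<in> space N. c \<omega> < L n \<omega> (\<tau> n \<omega>)}"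
      using c(3)[of k] by (intro finite_measure_Diff) (auto intro: le_less_trans)
    also have "\<dots> = (\<integral>\<omega>. exp (- c' k \<omega>) \<partial>N) - (\<integral>\<omega>. exp (- c \<omega>) \<partial>N)"
      using law[OF c'F c(2), of k] law[OF cF c(1)] by simp
    also have "\<dots> = (\<integral>\<omega>. exp (- c' k \<omega>) - exp (- c \<omega>) \<partial>N)"
      by (intro Bochner_Integration.integral_diff[symmetric] integrable_const_bound[of _ 1]) (auto simp: c)
    also have "\<dots> \<le> (\<integral>\<omega>. 1 / real (Suc k) \<partial>N)"
    proof (rule integral_mono)
      show "integrable N (\<lambda>\<omega>. exp (- c' k \<omega>) - exp (- c \<omega>))"
        by (intro Bochner_Integration.integrable_diff integrable_const_bound[of _ 1]) (auto simp: c)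
      show "exp (- c' k \<omega>) - exp (- c \<omega>) \<le> 1 / real (Suc k)" for \<omega>
        using exp_neg_diff_le[OF c(2,3)[of k \<omega>]] c(4)[of \<omega> k] by linarith
    qed simp
    also have "\<dots> = 1 / real (Suc k)" by (simp add: prob_space)
    finally show ?thesis .
  qed
  moreover have "(\<lambda>k. 1 / real (Suc k)) \<longlonglongrightarrow> 0" using LIMSEQ_inverse_real_of_nat by (simp add: inverse_eq_divide)
  ultimately have "prob B \<le> 0" by (intro tendsto_lowerbound) auto
  then have "emeasure N B = 0" using measure_nonneg[of N B] by (simp add: emeasure_eq_measure)
  then have "AE \<omega> in N. \<omega> \<notin> B" using B by (intro AE_not_in) (auto simp: null_sets_def)
  then show ?thesis using AE_L_pos[of n] AE_space by eventually_elim (auto simp: B_def c_def)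
qed

end

section \<open>The coupling\<close>

context zigzag_clocks
begin

definition S :: "nat \<Rightarrow> 'b \<Rightarrow> real" where
  "S n \<omega> = (\<Sum>i<n. \<tau> i \<omega>)"

lemma \<tau>_nonneg: "0 \<le> \<tau> n \<omega>"
  by (simp add: \<tau>_def)

lemma enn2real_jump_time:
  assumes "\<And>i. T i \<omega> < \<infinity>"
  shows "jump_time T n \<omega> < \<infinity> \<and> enn2real (jump_time T n \<omega>) = S n \<omega>"
proof (induction n)
  case 0
  show ?case by (simp add: jump_time_def S_def)
next
  case (Suc n)
  then show ?case using assms[of n] by (simp add: jump_time_Suc S_def \<tau>_def enn2real_plus)
qed

lemma y_close: "\<bar>y n \<omega> - y0\<bar> \<le> S n \<omega>"
proof (induction n)
  case (Suc n)
  have "\<bar>w n * \<tau> n \<omega>\<bar> = \<tau> n \<omega>" using w[of n] \<tau>_nonneg[of n \<omega>] by (auto simp: abs_mult)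
  then show ?case using Suc by (simp add: S_def)
qed (simp add: S_def)

text \<open>Non-explosion: if the jump times stayed bounded, the jump rate along the path would be bounded,
  so the clock values, at most a constant times the waiting times, would tend to zero.\<close>

lemma S_unbounded:
  assumes L: "\<And>n. clock n \<omega> = L n \<omega> (\<tau> n \<omega>)" and large: "\<forall>n. \<exists>i\<ge>n. 1 < clock i \<omega>"
  shows "\<exists>n. B < S n \<omega>"
proof (rule ccontr)
  assume "\<nexists>n. B < S n \<omega>"
  then have B: "S n \<omega> \<le> B" for n by (auto simp: not_less)
  have inc: "\<tau> n \<omega> \<le> S (Suc n) \<omega>" for n
    using sum_nonneg[of "{..<n}" "\<lambda>i. \<tau> i \<omega>"] by (simp add: S_def \<tau>_nonneg)
  have sm: "summable (\<lambda>n. \<tau> n \<omega>)"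
    using B by (intro bounded_imp_summable[of _ B]) (auto simp: \<tau>_nonneg S_def lessThan_Suc_atMost[symmetric] simp del: sum.lessThan_Suc)
  \<comment> \<open>Each jump position is within \<open>B\<close> of \<open>y0\<close>, and the
    following run is itself no longer than \<open>B\<close>.\<close>
  have "bounded (h ` {y0 - 2 * B..y0 + 2 * B})"
    using h_cont by (intro compact_imp_bounded compact_continuous_image) (auto intro: continuous_on_subset)
  then obtain C where C: "\<forall>x\<in>{y0 - 2 * B..y0 + 2 * B}. \<bar>h x\<bar> \<le> C"
    by (auto simp: bounded_iff)
  have le: "clock n \<omega> \<le> C * \<tau> n \<omega>" for n
    unfolding L
  proof (rule hazard_le[OF w \<tau>_nonneg])
    fix x assume "\<bar>x - y n \<omega>\<bar> \<le> \<tau> n \<omega>"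
    then have "x \<in> {y0 - 2 * B..y0 + 2 * B}"
      using y_close[of n \<omega>] B[of n] B[of "Suc n"] inc[of n] by auto
    then show "\<bar>h x\<bar> \<le> C" using C by blast
  qed
  have "(\<lambda>n. C * \<tau> n \<omega>) \<longlonglongrightarrow> C * 0" by (intro tendsto_intros summable_LIMSEQ_zero sm)
  then have "\<forall>\<^sub>F n in sequentially. C * \<tau> n \<omega> < 1" by (intro order_tendstoD) auto
  then obtain n where "\<And>i. i \<ge> n \<Longrightarrow> C * \<tau> i \<omega> < 1" by (auto simp: eventually_sequentially)
  then show False using large le by (meson less_le_not_le order.strict_trans1 order.asym)
qed

lemma path_between_jumps:
  assumes reg: "\<And>n. regular n \<omega>" and fin: "\<And>n. T n \<omega> < \<infinity>"
    and fl: "\<forall>n. jump_time T n \<omega> < \<infinity> \<longrightarrow>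
      (let S = enn2real (jump_time T n \<omega>) in
        (\<forall>t\<ge>0. ennreal t < T n \<omega> \<longrightarrow> Y (S + t) \<omega> = Y S \<omega> + t * W S \<omega> \<and> W (S + t) \<omega> = W S \<omega>) \<and>
        (\<forall>t\<ge>0. T n \<omega> = ennreal t \<longrightarrow> Y (S + t) \<omega> = Y S \<omega> + t * W S \<omega> \<and> W (S + t) \<omega> = - W S \<omega>))"
    and t: "S n \<omega> \<le> t" "t < S (Suc n) \<omega>"
  shows "Y t \<omega> = y n \<omega> + w n * (t - S n \<omega>)" "W t \<omega> = w n"
proof -
  have J: "jump_time T n \<omega> < \<infinity>" "enn2real (jump_time T n \<omega>) = S n \<omega>"
    using enn2real_jump_time[of \<omega> n] fin by auto
  have "T n \<omega> = ennreal (\<tau> n \<omega>)" using fin[of n] by (simp add: \<tau>_def)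
  then have "ennreal (t - S n \<omega>) < T n \<omega>" using t by (simp add: ennreal_less_iff S_def)
  moreover have "Y (S n \<omega>) \<omega> = y n \<omega>" "W (S n \<omega>) \<omega> = w n" using reg[of n] J by (auto simp: regular_def)
  ultimately have "Y (S n \<omega> + (t - S n \<omega>)) \<omega> = y n \<omega> + (t - S n \<omega>) * w n \<and> W (S n \<omega> + (t - S n \<omega>)) \<omega> = w n"
    using fl[THEN spec, THEN mp, OF J(1), unfolded J(2) Let_def, THEN conjunct1, THEN spec, of "t - S n \<omega>"] t(1) by auto
  then show "Y t \<omega> = y n \<omega> + w n * (t - S n \<omega>)" "W t \<omega> = w n" by (auto simp: mult.commute)
qed

text \<open>Outside countably many null sets all hypotheses of the deterministic limit hold at once;
  the exceptional set depends neither on the sequence \<epsilon> nor on the starting points.\<close>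

lemma AE_driven_walk_skorohod_conv:
  fixes v0 :: int and x :: "nat \<Rightarrow> int"
  assumes v0: "w0 = of_int v0" and e: "\<And>k. 0 < \<epsilon> k" "\<epsilon> \<longlonglongrightarrow> 0"
    and x: "(\<lambda>k. \<epsilon> k * of_int (x k)) \<longlonglongrightarrow> y0"
  shows "AE \<omega> in N. skorohod_conv (\<lambda>k. step_path (\<epsilon> k) (\<lambda>m.
      case fst (driven_walk (\<lambda>j. H (\<epsilon> k * of_int j)) (\<lambda>n. clock n \<omega>) (x k, v0) m) of
        (a, b) \<Rightarrow> (\<epsilon> k * real_of_int a, real_of_int b)))
      (\<lambda>t\<in>{0..}. (Y t \<omega>, W t \<omega>))"
proof -
  interpret E: exponential_clocks N F clock by (rule exponential_clocks_clock)
  have "AE \<omega> in N. \<forall>n. regular n \<omega>" using AE_regular by (simp add: AE_all_countable)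
  moreover have "AE \<omega> in N. \<forall>n. T n \<omega> < \<infinity>" using T_finite[OF AE_regular] unfolding AE_all_countable by blast
  moreover have "AE \<omega> in N. \<forall>n. 0 < L n \<omega> (\<tau> n \<omega>)" using AE_L_pos by (simp add: AE_all_countable)
  moreover have "AE \<omega> in N. \<forall>n. \<forall>a\<in>{a \<in> \<rat>. 0 \<le> a}. L n \<omega> (\<tau> n \<omega>) \<noteq> L n \<omega> a"
  proof -
    have cnt: "countable {a \<in> \<rat>. 0 \<le> (a::real)}" by (rule countable_subset[OF _ countable_rat]) auto
    show ?thesis unfolding AE_all_countable AE_ball_countable[OF cnt] using AE_L_neq by blast
  qed
  ultimately show ?thesis using E.AE_infinitely_often_gt_1 flow
  proof eventually_elim
    case (elim \<omega>)
    have clock: "clock n \<omega> = L n \<omega> (\<tau> n \<omega>)" for n using elim(3) by (simp add: clock_def)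
    have pos: "0 < \<tau> n \<omega>" for n
    proof (rule ccontr)
      assume "\<not> 0 < \<tau> n \<omega>"
      then have "\<tau> n \<omega> = 0" using \<tau>_nonneg[of n \<omega>] by simp
      then show False using elim(3)[rule_format, of n] by simp
    qed
    have w_eq: "of_int (v0 * (-1) ^ i) = w i" for i unfolding w_def by (simp add: v0)
    have neq: "L n \<omega> (\<tau> n \<omega>) \<noteq> L n \<omega> a" if "a \<in> \<rat>" "0 \<le> a" for n a using elim(4) that by auto
    show ?case
    proof (rule driven_walk_skorohod_conv[where y = "\<lambda>n. y n \<omega>" and \<tau> = "\<lambda>n. \<tau> n \<omega>" and S = "\<lambda>n. S n \<omega>", OF _ e])
      have "real_of_int v0 = -1 \<or> real_of_int v0 = 1" using w0 v0 by auto
      then have "v0 = -1 \<or> v0 = 1" by linarith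
      then show "v0 \<in> {-1, 1}" by simp
      show "(\<lambda>k. \<epsilon> k * of_int (x k)) \<longlonglongrightarrow> y 0 \<omega>" using x by simp
      show "y (Suc i) \<omega> = y i \<omega> + of_int (v0 * (-1) ^ i) * \<tau> i \<omega>" for i unfolding w_eq by simp
      show "0 < \<tau> i \<omega>" for i by (rule pos)
      show "S 0 \<omega> = 0" "S (Suc i) \<omega> = S i \<omega> + \<tau> i \<omega>" for i by (simp_all add: S_def)
      show "\<exists>n. B < S n \<omega>" for B by (rule S_unbounded[OF clock elim(5)])
      show "hazard (y i \<omega>) (of_int (v0 * (-1) ^ i)) s < clock i \<omega>" if s: "0 \<le> s" "s < \<tau> i \<omega>" for i s
      proof -
        \<comment> \<open>Monotonicity alone gives a weak inequality. A rational strictly in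
          between, where the hazard differs from its value at the jump, makes it strict.\<close>
        obtain a where a: "a \<in> \<rat>" "s < a" "a < \<tau> i \<omega>" using Rats_dense_in_real[OF s(2)] by blast
        have "L i \<omega> s \<le> L i \<omega> a" "L i \<omega> a \<le> L i \<omega> (\<tau> i \<omega>)" using a by (auto intro!: hazard_mono[OF w])
        then show ?thesis unfolding w_eq clock using neq[of a i] a s by auto
      qed
      show "clock i \<omega> < hazard (y i \<omega>) (of_int (v0 * (-1) ^ i)) s" if s: "\<tau> i \<omega> < s" for i s
      proof -
        obtain a where a: "a \<in> \<rat>" "\<tau> i \<omega> < a" "a < s" using Rats_dense_in_real[OF s] by blast
        have "L i \<omega> (\<tau> i \<omega>) \<le> L i \<omega> a" "L i \<omega> a \<le> L i \<omega> s" using a by (auto intro!: hazard_mono[OF w])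
        then show ?thesis unfolding w_eq clock using neq[of a i] a pos[of i] by auto
      qed
      show "(\<lambda>t\<in>{0..}. (Y t \<omega>, W t \<omega>)) t =
        (y i \<omega> + of_int (v0 * (-1) ^ i) * (t - S i \<omega>), of_int (v0 * (-1) ^ i))"
        if t: "S i \<omega> \<le> t" "t < S (Suc i) \<omega>" for i t
      proof -
        have "0 \<le> S i \<omega>" by (simp add: S_def sum_nonneg \<tau>_nonneg)
        then show ?thesis unfolding w_eq
          using path_between_jumps[OF elim(1)[rule_format] elim(2)[rule_format] elim(6) t] t(1) by simp
      qed
    qed
  qed
qed

end

theorem theorem3:
  fixes H :: "real \<Rightarrow> real"
    and M :: "real \<Rightarrow> 'a measure"
    and X V :: "real \<Rightarrow> nat \<Rightarrow> 'a \<Rightarrow> int"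
    and x0 :: "real \<Rightarrow> int" and v0 :: int and x0_star :: real
    and N :: "'b measure"
    and Y W :: "real \<Rightarrow> 'b \<Rightarrow> real"
  assumes "C2_real H"
    and "filterlim H at_top at_infinity"
    and "v0 \<in> {-1, 1}"
    and "\<And>\<epsilon>. \<epsilon> > 0 \<Longrightarrow>
      zigzag_walk (M \<epsilon>) (\<lambda>k. H (\<epsilon> * real_of_int k)) (x0 \<epsilon>) v0 (X \<epsilon>) (V \<epsilon>)"
    and "((\<lambda>\<epsilon>. \<epsilon> * real_of_int (x0 \<epsilon>)) \<longlongrightarrow> x0_star) (at_right 0)"
    and "zigzag_process N H x0_star (real_of_int v0) Y W"
  shows "converges_in_law skorohod_topology
    M (\<lambda>\<epsilon> \<omega>. \<lambda>t\<in>{0..}. (\<epsilon> * real_of_int (X \<epsilon> (nat \<lfloor>t / \<epsilon>\<rfloor>) \<omega>), real_of_int (V \<epsilon> (nat \<lfloor>t / \<epsilon>\<rfloor>) \<omega>)))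
    N (\<lambda>\<omega>. \<lambda>t\<in>{0..}. (Y t \<omega>, W t \<omega>))
    (at_right 0)"
proof -
  obtain h h' where h: "\<And>x. (H has_real_derivative h x) (at x)" and h': "\<And>x. (h has_real_derivative h' x) (at x)"
    using assms(1) unfolding C2_real_def by blast
  have h_cont: "continuous_on UNIV h"
    using h' by (intro continuous_at_imp_continuous_on ballI DERIV_isCont) auto
  have "\<forall>w. \<exists>F. \<forall>x. (F has_real_derivative max (w * h x) 0) (at x)"
    by (intro allI continuous_antiderivative_exists continuous_intros h_cont)
  then obtain \<Phi> where \<Phi>: "\<And>w x. (\<Phi> w has_real_derivative max (w * h x) 0) (at x)" by metis
  note process = assms(6)[unfolded zigzag_process_def]
  then interpret prob_space N by simp
  have YW_measurable: "\<And>t. 0 \<le> t \<Longrightarrow> Y t \<in> borel_measurable N" "\<And>t. 0 \<le> t \<Longrightarrow> W t \<in> borel_measurable N"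
    and YW_cadlag: "\<And>\<omega>. \<omega> \<in> space N \<Longrightarrow> (\<lambda>t\<in>{0..}. (Y t \<omega>, W t \<omega>)) \<in> cadlag_paths"
    using process by auto
  obtain T where T: "\<And>n. T n \<in> borel_measurable N"
    "\<And>n t. 0 \<le> t \<Longrightarrow> AE \<omega> in N. jump_time T n \<omega> < \<infinity> \<longrightarrow>
      real_cond_exp N (jump_history N T n) (indicat_real {\<omega>' \<in> space N. ennreal t < T n \<omega>'}) \<omega> =
      (let S = enn2real (jump_time T n \<omega>) in zigzag_survival H (Y S \<omega>) (W S \<omega>) t)"
    "AE \<omega> in N. \<forall>n. jump_time T n \<omega> < \<infinity> \<longrightarrow>
      (let S = enn2real (jump_time T n \<omega>) in
        (\<forall>t\<ge>0. ennreal t < T n \<omega> \<longrightarrow> Y (S + t) \<omega> = Y S \<omega> + t * W S \<omega> \<and> W (S + t) \<omega> = W S \<omega>) \<and>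
        (\<forall>t\<ge>0. T n \<omega> = ennreal t \<longrightarrow> Y (S + t) \<omega> = Y S \<omega> + t * W S \<omega> \<and> W (S + t) \<omega> = - W S \<omega>))"
    using process by blast
  have "zigzag_clocks H h \<Phi> N T Y W x0_star (real_of_int v0)"
  proof (intro zigzag_clocks.intro zigzag_clocks_axioms.intro)
    show "zigzag_hazard H h \<Phi>" using h h_cont assms(2) \<Phi> by (rule zigzag_hazard.intro)
    show "prob_space N" by unfold_locales
    show "real_of_int v0 \<in> {-1, 1}" using assms(3) by auto
    show "AE \<omega> in N. Y 0 \<omega> = x0_star \<and> W 0 \<omega> = real_of_int v0" using process by blast
  qed (fact T)+
  then interpret zigzag_clocks H h \<Phi> N T Y W x0_star "real_of_int v0" .
  interpret E: exponential_clocks N F clock by (rule exponential_clocks_clock)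
  define \<phi> where "\<phi> \<epsilon> = (\<lambda>(a, b). (\<epsilon> * real_of_int a, real_of_int b))" for \<epsilon>
  \<comment> \<open>One family of clocks on \<open>N\<close> drives the walks for all \<epsilon>;
    only the potential and the starting point change.\<close>
  define D where "D \<epsilon> m \<omega> = fst (driven_walk (\<lambda>j. H (\<epsilon> * of_int j)) (\<lambda>n. clock n \<omega>) (x0 \<epsilon>, v0) m)" for \<epsilon> m \<omega>
  have chain_M: "markov_chain (M \<epsilon>) (zigzag_kernel (\<lambda>k. H (\<epsilon> * of_int k))) (x0 \<epsilon>, v0) (\<lambda>n \<omega>. (X \<epsilon> n \<omega>, V \<epsilon> n \<omega>))" if "0 < \<epsilon>" for \<epsilon>
    using assms(4)[OF that] by (simp add: zigzag_walk_def)
  have chain_N: "markov_chain N (zigzag_kernel (\<lambda>k. H (\<epsilon> * of_int k))) (x0 \<epsilon>, v0) (D \<epsilon>)" for \<epsilon>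
    unfolding D_def by (rule E.driven_walk_markov_chain[OF assms(3)])
  have D_measurable: "(\<lambda>\<omega>. \<phi> \<epsilon> (D \<epsilon> n \<omega>)) \<in> borel_measurable N" for \<epsilon> n
    by (rule measurable_compose[of _ _ "count_space UNIV"]) (use chain_N in \<open>auto simp: markov_chain_def\<close>)
  have XV_measurable: "(\<lambda>\<omega>. \<phi> \<epsilon> (X \<epsilon> n \<omega>, V \<epsilon> n \<omega>)) \<in> borel_measurable (M \<epsilon>)" if "0 < \<epsilon>" for \<epsilon> n
    by (rule measurable_compose[of _ _ "count_space UNIV"]) (use chain_M[OF that] in \<open>auto simp: markov_chain_def\<close>)
  have path_eq: "(\<lambda>t\<in>{0..}. (\<epsilon> * real_of_int (X \<epsilon> (nat \<lfloor>t / \<epsilon>\<rfloor>) \<omega>), real_of_int (V \<epsilon> (nat \<lfloor>t / \<epsilon>\<rfloor>) \<omega>))) =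
      step_path \<epsilon> (\<lambda>m. \<phi> \<epsilon> (X \<epsilon> m \<omega>, V \<epsilon> m \<omega>))" for \<epsilon> \<omega>
    by (simp add: step_path_def \<phi>_def)
  have pos: "\<forall>\<^sub>F \<epsilon>::real in at_right 0. 0 < \<epsilon>" by (simp add: eventually_at_right_less)
  show ?thesis
    unfolding converges_in_law_def path_eq topspace_skorohod_topology
  proof (intro conjI allI impI)
    show "\<forall>\<^sub>F \<epsilon> in at_right 0.
      (\<forall>\<omega>\<in>space (M \<epsilon>). step_path \<epsilon> (\<lambda>m. \<phi> \<epsilon> (X \<epsilon> m \<omega>, V \<epsilon> m \<omega>)) \<in> cadlag_paths) \<and>
      (\<forall>f. continuous_map skorohod_topology euclideanreal f \<longrightarrow> bounded (f ` cadlag_paths) \<longrightarrow>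
        (\<lambda>\<omega>. f (step_path \<epsilon> (\<lambda>m. \<phi> \<epsilon> (X \<epsilon> m \<omega>, V \<epsilon> m \<omega>)))) \<in> borel_measurable (M \<epsilon>))"
      using pos
    proof eventually_elim
      case (elim \<epsilon>)
      show ?case
        by (intro conjI ballI allI impI step_path_cadlag step_path_functional_measurable XV_measurable elim)
    qed
    show "\<forall>\<omega>\<in>space N. (\<lambda>t\<in>{0..}. (Y t \<omega>, W t \<omega>)) \<in> cadlag_paths" using YW_cadlag by blast
    fix f :: "(real \<Rightarrow> real \<times> real) \<Rightarrow> real"
    assume f: "continuous_map skorohod_topology euclideanreal f" and bdd: "bounded (f ` cadlag_paths)"
    have bdd': "bounded (f ` topspace skorohod_topology)" using bdd by (simp add: topspace_skorohod_topology)
    obtain B where B: "\<And>x. x \<in> cadlag_paths \<Longrightarrow> \<bar>f x\<bar> \<le> B" using bounded_skorohod_functionalE[OF bdd'] by blast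
    show Z_measurable: "(\<lambda>\<omega>. f (\<lambda>t\<in>{0..}. (Y t \<omega>, W t \<omega>))) \<in> borel_measurable N"
      by (rule cadlag_functional_measurable[OF f YW_cadlag]) (use YW_measurable in auto)
    show "((\<lambda>\<epsilon>. \<integral>\<omega>. f (step_path \<epsilon> (\<lambda>m. \<phi> \<epsilon> (X \<epsilon> m \<omega>, V \<epsilon> m \<omega>))) \<partial>M \<epsilon>) \<longlongrightarrow>
        (\<integral>\<omega>. f (\<lambda>t\<in>{0..}. (Y t \<omega>, W t \<omega>)) \<partial>N)) (at_right 0)"
      \<comment> \<open>Dominated convergence works along sequences, so an arbitrary sequence of
        positive \<epsilon> tending to 0 is considered.\<close>
      unfolding tendsto_at_iff_sequentially
    proof (intro allI impI)
      fix \<epsilon> :: "nat \<Rightarrow> real" assume "\<forall>k. \<epsilon> k \<in> {0<..} - {0}" and lim: "\<epsilon> \<longlonglongrightarrow> 0"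
      then have e: "0 < \<epsilon> k" for k by auto
      have "\<epsilon> k \<noteq> 0" for k using e[of k] by simp
      then have "filterlim \<epsilon> (at_right 0) sequentially"
        using lim e by (auto simp: filterlim_at)
      from filterlim_compose[OF assms(5) this]
      have x: "(\<lambda>k. \<epsilon> k * of_int (x0 (\<epsilon> k))) \<longlonglongrightarrow> x0_star" .
      \<comment> \<open>Here the given walk on \<open>M (\<epsilon> k)\<close> is exchanged for the
        coupled walk on \<open>N\<close>, which has the same law.\<close>
      have eq: "(\<integral>\<omega>. f (step_path (\<epsilon> k) (\<lambda>m. \<phi> (\<epsilon> k) (X (\<epsilon> k) m \<omega>, V (\<epsilon> k) m \<omega>))) \<partial>M (\<epsilon> k)) =
         (\<integral>\<omega>. f (step_path (\<epsilon> k) (\<lambda>m. \<phi> (\<epsilon> k) (D (\<epsilon> k) m \<omega>))) \<partial>N)" for k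
        by (rule markov_chain_step_path_integral_eq[OF chain_M[OF e] chain_N f bdd' e])
      have "(\<lambda>k. \<integral>\<omega>. f (step_path (\<epsilon> k) (\<lambda>m. \<phi> (\<epsilon> k) (D (\<epsilon> k) m \<omega>))) \<partial>N) \<longlonglongrightarrow> (\<integral>\<omega>. f (\<lambda>t\<in>{0..}. (Y t \<omega>, W t \<omega>)) \<partial>N)"
      proof (rule integral_dominated_convergence[where w = "\<lambda>_. B"])
        show "(\<lambda>\<omega>. f (\<lambda>t\<in>{0..}. (Y t \<omega>, W t \<omega>))) \<in> borel_measurable N" by (rule Z_measurable)
        show "(\<lambda>\<omega>. f (step_path (\<epsilon> k) (\<lambda>m. \<phi> (\<epsilon> k) (D (\<epsilon> k) m \<omega>)))) \<in> borel_measurable N" for k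
          by (rule step_path_functional_measurable[OF f e D_measurable])
        show "AE \<omega> in N. norm (f (step_path (\<epsilon> k) (\<lambda>m. \<phi> (\<epsilon> k) (D (\<epsilon> k) m \<omega>)))) \<le> B" for k
          using B[OF step_path_cadlag[OF e]] by simp
        show "AE \<omega> in N. (\<lambda>k. f (step_path (\<epsilon> k) (\<lambda>m. \<phi> (\<epsilon> k) (D (\<epsilon> k) m \<omega>)))) \<longlonglongrightarrow> f (\<lambda>t\<in>{0..}. (Y t \<omega>, W t \<omega>))"
          using AE_driven_walk_skorohod_conv[OF refl e lim x] AE_space
        proof eventually_elim
          case (elim \<omega>)
          show ?case
            by (rule skorohod_conv_continuous_map[OF f step_path_cadlag[OF e] YW_cadlag[OF elim(2)]])
              (use elim(1) in \<open>simp add: \<phi>_def D_def\<close>)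
        qed
      qed simp
      then show "((\<lambda>\<epsilon>. \<integral>\<omega>. f (step_path \<epsilon> (\<lambda>m. \<phi> \<epsilon> (X \<epsilon> m \<omega>, V \<epsilon> m \<omega>))) \<partial>M \<epsilon>) \<circ> \<epsilon>) \<longlonglongrightarrow>
        (\<integral>\<omega>. f (\<lambda>t\<in>{0..}. (Y t \<omega>, W t \<omega>)) \<partial>N)"
        by (simp add: comp_def eq)
    qed
  qed
qed

end
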